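(* Fix the domain $[n]^d$, let $p\ge1$, let $\mathsf{dist}$ be the normalized $\ell_p$ metric on $[n]^d$, and let $0<8\Delta\le\epsilon$. Then there is a $(\mathcal B,\mathcal B,\Delta)$-diameter-guarded $\epsilon$-tester for identity under $\mathsf{EMD}_{\mathsf{dist}}$ using at most $m(\epsilon)=2^{O(d)}\cdot\widetilde O(\epsilon^{-\max\{2,\frac d2\}})$ samples and $q(\epsilon)=O(m(\epsilon)\cdot d\log n)$ queries; and there is a $(\mathcal B,\mathcal B,\Delta)$-diameter-guarded $\epsilon$-tester for equivalence under $\mathsf{EMD}_{\mathsf{dist}}$ using at most $m(\epsilon)=2^{O(d)}\cdot\widetilde O(\epsilon^{-\max\{2,\frac{2d}{3}\}})$ samples and $q(\epsilon)=O(\frac1\epsilon\cdot d\log n)$ queries. Here $\widetilde O(\cdot)$ hides polylogarithmic factors in $1/\epsilon$.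
   Context: The normalized $\ell_p$ metric on $[n]^d$ is $\mathsf{dist}(x,y)=\|x-y\|_p/(d^{1/p}n)$. For distributions $\mu,\nu$, $\mathsf{EMD}_{\mathsf{dist}}(\mu,\nu)=\inf_\pi\mathbb{E}_{(x,y)\sim\pi}[\mathsf{dist}(x,y)]$ over couplings $\pi$ of $\mu,\nu$. A clustering of a domain $\mathcal X$ is a pair $(\Gamma,\mathsf{rep})$ where $\Gamma=\{\Gamma_1,\dots,\Gamma_k\}$ partitions $\mathcal X$ into cells and $\mathsf{rep}(i)\in\Gamma_i$; $\gamma(x)$ is the index of the cell containing $x$. For a distribution $\mu$ the clustered-sample oracle returns independent samples $\mathsf{rep}(\gamma(x))$, $x\sim\mu$; the label oracle on query $x$ returns $\mathsf{rep}(\gamma(x))$. Samples are calls to clustered-sample oracles, queries are calls to the label oracle. $\mathcal B$ is the class of clusterings of $[n]^d$ each of whose cells is an axis-aligned box (a set $\{x\in[n]^d: a_i\le x_i\le b_i\ \forall i\}$). Let $c=\frac{1}{384\ln 24}$. For a universe $\mathcal U$ of clusterings, a subclass $\mathcal G\subseteq\mathcal U$ and $\Delta>0$: an algorithm is a $(\mathcal U,\mathcal G,\Delta)$-diameter-guarded $\epsilon$-tester for identity (with known target $\nu$) if it outputs ACCEPT, REJECT or CLUSTER-REJECT and, for every input $((\Gamma,\mathsf{rep}),\mu)$ with $(\Gamma,\mathsf{rep})\in\mathcal U$: (1) if $(\Gamma,\mathsf{rep})\in\mathcal G$ and $\Pr_{x\sim\mu}[\mathrm{diam}_{\mathsf{dist}}(\Gamma_{\gamma(x)})>\Delta]\le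 c\epsilon$, it outputs CLUSTER-REJECT with probability at most $1/6$; (2) if $\mu=\nu$ it outputs ACCEPT or CLUSTER-REJECT with probability at least $5/6$; (3) if $\mathsf{EMD}_{\mathsf{dist}}(\mu,\nu)>\epsilon$ it outputs REJECT or CLUSTER-REJECT with probability at least $5/6$. For equivalence testing there are two unknown distributions $\mu,\nu$, each accessed through its own clustered-sample oracle under the same clustering; condition (1) applies when $(\Gamma,\mathsf{rep})\in\mathcal G$ and both $\mu$ and $\nu$ satisfy the diameter condition, (2) applies when $\mu=\nu$, and (3) when $\mathsf{EMD}_{\mathsf{dist}}(\mu,\nu)>\epsilon$. *)

theory Defs
  imports "HOL-Probability.Probability"
begin

definition grid :: "nat \<Rightarrow> nat \<Rightarrow> (nat \<Rightarrow> nat) set" where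
  "grid n d = {..<d} \<rightarrow>\<^sub>E {1..n}"

definition lp_norm :: "real \<Rightarrow> nat \<Rightarrow> (nat \<Rightarrow> real) \<Rightarrow> real" where
  "lp_norm p d v = (\<Sum>i<d. \<bar>v i\<bar> powr p) powr (1 / p)"

definition ndist :: "real \<Rightarrow> nat \<Rightarrow> nat \<Rightarrow> (nat \<Rightarrow> nat) \<Rightarrow> (nat \<Rightarrow> nat) \<Rightarrow> real" where
  "ndist p n d x y = lp_norm p d (\<lambda>i. real (x i) - real (y i)) / (real d powr (1 / p) * real n)"

definition couplings :: "'a pmf \<Rightarrow> 'a pmf \<Rightarrow> ('a \<times> 'a) pmf set" where
  "couplings \<mu> \<nu> = {\<pi>. map_pmf fst \<pi> = \<mu> \<and> map_pmf snd \<pi> = \<nu>}"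

definition EMD :: "('a \<Rightarrow> 'a \<Rightarrow> real) \<Rightarrow> 'a pmf \<Rightarrow> 'a pmf \<Rightarrow> real" where
  "EMD dst \<mu> \<nu> = (INF \<pi>\<in>couplings \<mu> \<nu>. measure_pmf.expectation \<pi> (\<lambda>(x, y). dst x y))"

definition diam :: "('a \<Rightarrow> 'a \<Rightarrow> real) \<Rightarrow> 'a set \<Rightarrow> real" where
  "diam dst S = (SUP (x, y)\<in>S \<times> S. dst x y)"

record 'a clustering =
  num_cells :: nat
  cell :: "nat \<Rightarrow> 'a set"
  rep :: "nat \<Rightarrow> 'a"

text \<open>The cells are those with index in \<open>{1..num_cells C}\<close>; they are nonempty because each
  contains its representative.\<close>

definition clusterings :: "'a set \<Rightarrow> 'a clustering set" where
  "clusterings X = {C.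
     (\<Union>i\<in>{1..num_cells C}. cell C i) = X \<and>
     disjoint_family_on (cell C) {1..num_cells C} \<and>
     (\<forall>i\<in>{1..num_cells C}. rep C i \<in> cell C i)}"

definition cell_index :: "'a clustering \<Rightarrow> 'a \<Rightarrow> nat" where
  "cell_index C x = (THE i. i \<in> {1..num_cells C} \<and> x \<in> cell C i)"

definition label :: "'a clustering \<Rightarrow> 'a \<Rightarrow> 'a" where
  "label C x = rep C (cell_index C x)"

definition clustered :: "'a clustering \<Rightarrow> 'a pmf \<Rightarrow> 'a pmf" where
  "clustered C \<mu> = map_pmf (label C) \<mu>"

definition is_box :: "nat \<Rightarrow> nat \<Rightarrow> (nat \<Rightarrow> nat) set \<Rightarrow> bool" where
  "is_box n d S \<longleftrightarrow> (\<exists>a b. S = {x \<in> grid n d. \<forall>i<d. a i \<le> x i \<and> x i \<le> b i})"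

definition box_clusterings :: "nat \<Rightarrow> nat \<Rightarrow> (nat \<Rightarrow> nat) clustering set" where
  "box_clusterings n d =
     {C \<in> clusterings (grid n d). \<forall>i\<in>{1..num_cells C}. is_box n d (cell C i)}"

datatype verdict = Accept | Reject | Cluster_Reject

text \<open>An adaptive randomized algorithm is a decision tree. \<open>Sample i\<close> calls the \<open>i\<close>-th
  clustered-sample oracle, \<open>Query x\<close> calls the label oracle on \<open>x\<close>, and the continuation
  receives the answer. \<open>Random P\<close> uses internal randomness: any discrete distribution, encoded
  on the natural numbers, may be drawn from at no cost.\<close>

datatype ('i, 'a) algo =
    Output verdict
  | Sample 'i "'a \<Rightarrow> ('i, 'a) algo"
  | Query 'a "'a \<Rightarrow> ('i, 'a) algo"
  | Random "nat pmf" "nat \<Rightarrow> ('i, 'a) algo"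

primrec run :: "('i \<Rightarrow> 'a pmf) \<Rightarrow> ('a \<Rightarrow> 'a) \<Rightarrow> ('i, 'a) algo \<Rightarrow> verdict pmf" where
  "run smp lab (Output v) = return_pmf v"
| "run smp lab (Sample i f) = bind_pmf (smp i) (\<lambda>x. run smp lab (f x))"
| "run smp lab (Query x f) = run smp lab (f (lab x))"
| "run smp lab (Random P f) = bind_pmf P (\<lambda>r. run smp lab (f r))"

text \<open>\<open>uses_at_most X T s q\<close>: on the domain \<open>X\<close>, where all oracle answers lie, the
  algorithm \<open>T\<close> only queries points of \<open>X\<close>, and on every path it makes at most \<open>s\<close> calls to
  clustered-sample oracles (in total over all of them) and at most \<open>q\<close> calls to the label
  oracle.\<close>

primrec uses_at_most :: "'a set \<Rightarrow> ('i, 'a) algo \<Rightarrow> nat \<Rightarrow> nat \<Rightarrow> bool" where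
  "uses_at_most X (Output v) s q \<longleftrightarrow> True"
| "uses_at_most X (Sample i f) s q \<longleftrightarrow> 0 < s \<and> (\<forall>x\<in>X. uses_at_most X (f x) (s - 1) q)"
| "uses_at_most X (Query x f) s q \<longleftrightarrow> x \<in> X \<and> 0 < q \<and> (\<forall>y\<in>X. uses_at_most X (f y) s (q - 1))"
| "uses_at_most X (Random P f) s q \<longleftrightarrow> (\<forall>r\<in>set_pmf P. uses_at_most X (f r) s q)"

definition guard_const :: real where
  "guard_const = 1 / (384 * ln 24)"

definition diam_condition ::
    "('a \<Rightarrow> 'a \<Rightarrow> real) \<Rightarrow> real \<Rightarrow> real \<Rightarrow> 'a clustering \<Rightarrow> 'a pmf \<Rightarrow> bool" where
  "diam_condition dst \<Delta> \<epsilon> C \<mu> \<longleftrightarrow>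
     measure_pmf.prob \<mu> {x. diam dst (cell C (cell_index C x)) > \<Delta>} \<le> guard_const * \<epsilon>"

definition identity_tester ::
    "'a set \<Rightarrow> ('a \<Rightarrow> 'a \<Rightarrow> real) \<Rightarrow> 'a clustering set \<Rightarrow> 'a clustering set \<Rightarrow>
     real \<Rightarrow> real \<Rightarrow> 'a pmf \<Rightarrow> (unit, 'a) algo \<Rightarrow> bool" where
  "identity_tester X dst U G \<Delta> \<epsilon> \<nu> T \<longleftrightarrow>
     (\<forall>C\<in>U. \<forall>\<mu>. set_pmf \<mu> \<subseteq> X \<longrightarrow>
        (let out = run (\<lambda>_. clustered C \<mu>) (label C) T in
          (C \<in> G \<and> diam_condition dst \<Delta> \<epsilon> C \<mu> \<longrightarrow>
             measure_pmf.prob out {Cluster_Reject} \<le> 1 / 6) \<and>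
          (\<mu> = \<nu> \<longrightarrow> measure_pmf.prob out {Accept, Cluster_Reject} \<ge> 5 / 6) \<and>
          (EMD dst \<mu> \<nu> > \<epsilon> \<longrightarrow> measure_pmf.prob out {Reject, Cluster_Reject} \<ge> 5 / 6)))"

text \<open>For equivalence there are two sample oracles, \<open>True\<close> for \<open>\<mu>\<close> and \<open>False\<close> for \<open>\<nu>\<close>.\<close>

definition equivalence_tester ::
    "'a set \<Rightarrow> ('a \<Rightarrow> 'a \<Rightarrow> real) \<Rightarrow> 'a clustering set \<Rightarrow> 'a clustering set \<Rightarrow>
     real \<Rightarrow> real \<Rightarrow> (bool, 'a) algo \<Rightarrow> bool" where
  "equivalence_tester X dst U G \<Delta> \<epsilon> T \<longleftrightarrow>
     (\<forall>C\<in>U. \<forall>\<mu> \<nu>. set_pmf \<mu> \<subseteq> X \<longrightarrow> set_pmf \<nu> \<subseteq> X \<longrightarrow>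
        (let out = run (\<lambda>b. clustered C (if b then \<mu> else \<nu>)) (label C) T in
          (C \<in> G \<and> diam_condition dst \<Delta> \<epsilon> C \<mu> \<and> diam_condition dst \<Delta> \<epsilon> C \<nu> \<longrightarrow>
             measure_pmf.prob out {Cluster_Reject} \<le> 1 / 6) \<and>
          (\<mu> = \<nu> \<longrightarrow> measure_pmf.prob out {Accept, Cluster_Reject} \<ge> 5 / 6) \<and>
          (EMD dst \<mu> \<nu> > \<epsilon> \<longrightarrow> measure_pmf.prob out {Reject, Cluster_Reject} \<ge> 5 / 6)))"

text \<open>\<open>exp_soft_O e m\<close> says that \<open>m d \<epsilon> = 2\<^bsup>O(d)\<^esup> \<cdot> \<close>soft-O of \<open>(1/\<epsilon>)\<^bsup>e d\<^esup>\<close>, with constants that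
  depend on neither \<open>d\<close> nor \<open>\<epsilon>\<close>. The offset \<open>exp 1\<close> keeps the logarithmic factor at least \<open>1\<close>
  when \<open>\<epsilon>\<close> is not small.\<close>

definition exp_soft_O :: "(nat \<Rightarrow> real) \<Rightarrow> (nat \<Rightarrow> real \<Rightarrow> real) \<Rightarrow> bool" where
  "exp_soft_O e m \<longleftrightarrow>
     (\<exists>(A::real) (B::real) (k::nat). \<forall>d\<ge>1. \<forall>\<epsilon>>0.
        \<bar>m d \<epsilon>\<bar> \<le> 2 powr (A * real d) * (B * (1 / \<epsilon>) powr e d * ln (exp 1 + 1 / \<epsilon>) ^ k))"

end

theory Submission
  imports Defs
begin

text \<open>Both testers first draw \<open>O(1/\<epsilon>)\<close> clustered samples, learn the box around each of them by binary
  search along the \<open>d\<close> coordinate lines, and answer \<open>Cluster_Reject\<close> if one of these boxes is wider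
  than \<open>\<Delta>\<close>. If this does not happen then, up to a small failure probability, wide cells have mass at
  most \<open>\<epsilon>/16\<close>, so that moving every point inside its own cell costs at most \<open>3\<epsilon>/16\<close>. For
  equivalence the two clustered distributions can therefore be compared instead of the original ones;
  for identity every sample is replaced by a fresh draw from the known \<open>\<nu>\<close> conditioned on the learned
  box, which leaves \<open>\<nu>\<close> invariant.

  The earth mover distance of two distributions on the cube is at most \<open>2\<^bsup>-L\<^esup>\<close> plus the sum over the
  dyadic levels \<open>l \<le> L\<close> of \<open>2\<^bsup>1-l\<^esup>\<close> times their total variation distance on the \<open>2\<^bsup>ld\<^esup>\<close> subcubes, so a
  large distance shows up as an \<open>\<ell>\<^sub>1\<close> distance \<open>2\<^sup>l\<epsilon>/(4L)\<close> at some level. This is detected by a bilinear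
  collision statistic of two independent lists of sample pairs, weighted by \<open>1/(1 + \<kappa> \<cdot> count)\<close> where
  the counts come from separate flattening samples; its mean and variance are explicit and Chebyshev's
  inequality suffices. Flattening samples are free for identity (they are drawn from the known \<open>\<nu>\<close>),
  which gives the exponent \<open>d/2\<close>; for equivalence, balancing them against the other samples gives
  \<open>2d/3\<close>.\<close>

section \<open>Expectations under finitely supported distributions\<close>

text \<open>Because the two lists of pairs are independent, the mean of the statistic is exactly a
  weighted squared distance, and its second moment is built from second moments of a single list.
  Level l has N = 2^(l*d) subcubes. A distance 2^l * \<epsilon> there becomes, up to powers of L, a
  weighted squared distance 4^l * \<epsilon>^2 / N, and k flattening samples bring the weighted
  collision norm of the reference to about 1 / min k N. Chebyshev then asks for m of order N / (sqrt
  (min k N) * 4^l * \<epsilon>^2). For k \<ge> N this is 2^(l*(d/2 - 2)) / \<epsilon>^2, which for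
  2^l \<le> 8 / \<epsilon> gives the exponent max 2 (d/2). For smaller k it is 2^(l*(d - 2)) / (sqrt
  k * \<epsilon>^2), at the finest level about \<epsilon>^(-d) / sqrt k, which equals k at k =
  \<epsilon>^(-2*d/3). Identity could also compare clustered distributions by labelling draws from
  the known \<nu>, but each of the 2^(L*d) flattening draws would then cost a query. Keeping \<nu>
  itself as the reference avoids this; the unknown samples are moved towards it instead.\<close>

abbreviation expect :: "'a pmf \<Rightarrow> ('a \<Rightarrow> real) \<Rightarrow> real" where
  "expect D f \<equiv> measure_pmf.expectation D f"

lemma expect_bind:
  assumes "finite (set_pmf D)" "\<And>x. x \<in> set_pmf D \<Longrightarrow> finite (set_pmf (f x))"
  shows "expect (bind_pmf D f) h = expect D (\<lambda>x. expect (f x) h)"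
  using assms
  by (subst pmf_expectation_bind[where A = "set_pmf D"])
     (auto simp: integral_measure_pmf_real[where A = "set_pmf D"] mult.commute)

lemma expect_add:
  "finite (set_pmf D) \<Longrightarrow> expect D (\<lambda>x. f x + g x) = expect D f + expect D g"
  by (simp add: integrable_measure_pmf_finite)

lemma expect_diff:
  "finite (set_pmf D) \<Longrightarrow> expect D (\<lambda>x. f x - g x) = expect D f - expect D g"
  by (simp add: integrable_measure_pmf_finite)

lemma expect_sum:
  "finite (set_pmf D) \<Longrightarrow> expect D (\<lambda>x. \<Sum>i\<in>I. f i x) = (\<Sum>i\<in>I. expect D (f i))"
  by (simp add: integrable_measure_pmf_finite)

lemma expect_mono:
  assumes "finite (set_pmf D)" "\<And>x. x \<in> set_pmf D \<Longrightarrow> f x \<le> g x"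
  shows "expect D f \<le> expect D g"
  using assms by (intro integral_mono_AE) (auto simp: integrable_measure_pmf_finite AE_measure_pmf_iff)

lemma expect_nonneg:
  assumes "\<And>x. x \<in> set_pmf D \<Longrightarrow> 0 \<le> f x"
  shows "0 \<le> expect D f"
  using assms by (intro integral_nonneg_AE) (auto simp: AE_measure_pmf_iff)

lemma expect_cong:
  assumes "\<And>x. x \<in> set_pmf D \<Longrightarrow> f x = g x"
  shows "expect D f = expect D g"
  using assms by (intro integral_cong_AE) (auto simp: AE_measure_pmf_iff)

lemma prob_eq_expect: "measure_pmf.prob D S = expect D (indicator S)"
  by simp

lemma prob_bind:
  assumes "finite (set_pmf D)" "\<And>x. x \<in> set_pmf D \<Longrightarrow> finite (set_pmf (f x))"
  shows "measure_pmf.prob (bind_pmf D f) S = expect D (\<lambda>x. measure_pmf.prob (f x) S)"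
  unfolding prob_eq_expect by (rule expect_bind[OF assms])

lemma markov_bound:
  assumes "finite (set_pmf D)" "\<And>x. x \<in> set_pmf D \<Longrightarrow> 0 \<le> f x" "0 < a"
    and "\<And>x. x \<in> set_pmf D \<Longrightarrow> x \<in> S \<Longrightarrow> a \<le> f x"
  shows "measure_pmf.prob D S \<le> expect D f / a"
proof -
  have "a * measure_pmf.prob D S = expect D (\<lambda>x. a * indicator S x)"
    by simp
  also have "\<dots> \<le> expect D f"
    using assms by (intro expect_mono) (auto simp: indicator_def)
  finally show ?thesis
    using \<open>0 < a\<close> by (simp add: field_simps)
qed

lemma expect_pair:
  assumes "finite (set_pmf p)" "finite (set_pmf q)"
  shows "expect (pair_pmf p q) h = expect p (\<lambda>x. expect q (\<lambda>y. h (x, y)))"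
  unfolding pair_pmf_def using assms
  by (subst expect_bind; simp add: expect_bind)

lemma sum_prob_cells:
  assumes "finite (set_pmf r)" "finite I" "f ` set_pmf r \<subseteq> I"
  shows "(\<Sum>c\<in>I. measure_pmf.prob r {x. f x = c}) = 1"
proof -
  have "(\<Sum>c\<in>I. measure_pmf.prob r {x. f x = c}) = expect r (\<lambda>x. \<Sum>c\<in>I. indicator {x. f x = c} x)"
    by (simp add: expect_sum assms)
  also have "\<dots> = expect r (\<lambda>_. 1)"
    using assms by (intro expect_cong) (auto simp: indicator_def)
  finally show ?thesis by simp
qed

section \<open>Moments of sums over independent lists\<close>

lemma finite_set_replicate_pmf:
  assumes "finite (set_pmf p)"
  shows "finite (set_pmf (replicate_pmf m p))"
  using finite_lists_length_eq[OF assms, of m]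
  by (simp add: set_replicate_pmf lists_eq_set conj_commute Collect_conj_eq Int_commute)

lemma expect_replicate_Suc:
  assumes "finite (set_pmf p)"
  shows "expect (replicate_pmf (Suc m) p) h =
         expect p (\<lambda>x. expect (replicate_pmf m p) (\<lambda>xs. h (x # xs)))"
  using assms finite_set_replicate_pmf[OF assms, of m]
  by (simp, subst expect_bind; simp add: expect_bind)

lemma expect_sum_list:
  assumes "finite (set_pmf p)"
  shows "expect (replicate_pmf m p) (\<lambda>zs. \<Sum>z\<leftarrow>zs. f z) = real m * expect p f"
proof (induction m)
  case (Suc m)
  note fin = assms finite_set_replicate_pmf[OF assms, of m]
  show ?case
    unfolding expect_replicate_Suc[OF assms]
    by (simp add: expect_add fin Suc algebra_simps)
qed simp

text \<open>Equal positions contribute the joint moment; the \<open>m * (m - 1)\<close> ordered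
  pairs of distinct positions factorize by independence.\<close>

lemma expect_sum_list_prod:
  assumes "finite (set_pmf p)"
  shows "expect (replicate_pmf m p) (\<lambda>zs. (\<Sum>z\<leftarrow>zs. f z) * (\<Sum>z\<leftarrow>zs. g z)) =
         real m * expect p (\<lambda>z. f z * g z) + real m * (real m - 1) * expect p f * expect p g"
proof (induction m)
  case (Suc m)
  note fin = assms finite_set_replicate_pmf[OF assms, of m]
  let ?F = "\<lambda>zs. \<Sum>z\<leftarrow>zs. f z" and ?G = "\<lambda>zs. \<Sum>z\<leftarrow>zs. g z"
  have "expect (replicate_pmf (Suc m) p) (\<lambda>zs. ?F zs * ?G zs) =
      expect p (\<lambda>x. expect (replicate_pmf m p)
        (\<lambda>zs. (f x * g x + f x * ?G zs) + (g x * ?F zs + ?F zs * ?G zs)))"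
    unfolding expect_replicate_Suc[OF assms] by (simp add: algebra_simps)
  also have "\<dots> = expect p (\<lambda>z. f z * g z) + real m * expect p f * expect p g
      + (real m * expect p g * expect p f + expect (replicate_pmf m p) (\<lambda>zs. ?F zs * ?G zs))"
    by (simp add: expect_add fin expect_sum_list ac_simps)
  finally show ?case
    unfolding Suc by (simp add: algebra_simps)
qed simp

text \<open>Exchangeability identity for binomial counts; it replaces the integral
  representation of \<open>E[1 / (1 + count)]\<close>.\<close>

lemma expect_count_shift:
  fixes g :: "real \<Rightarrow> real" and P :: "'a \<Rightarrow> bool"
  assumes "finite (set_pmf p)"
  defines "a \<equiv> \<lambda>zs. \<Sum>z\<leftarrow>zs. of_bool (P z)"
  shows "expect (replicate_pmf (Suc k) p) (\<lambda>zs. a zs * g (a zs)) =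
         real (Suc k) * measure_pmf.prob p {z. P z} * expect (replicate_pmf k p) (\<lambda>zs. g (1 + a zs))"
proof (induction k arbitrary: g)
  case 0
  have "expect p (\<lambda>x. of_bool (P x) * g (of_bool (P x))) = expect p (\<lambda>x. indicator {z. P z} x * g 1)"
    by (rule expect_cong) (auto simp: indicator_def)
  then show ?case
    unfolding expect_replicate_Suc[OF assms(1)] by (simp add: a_def)
next
  case (Suc k)
  let ?q = "measure_pmf.prob p {z. P z}"
  let ?E = "\<lambda>k f. expect (replicate_pmf k p) f"
  note fin = assms(1) finite_set_replicate_pmf[OF assms(1), of k] finite_set_replicate_pmf[OF assms(1), of "Suc k"]
  have split: "expect p (\<lambda>x. of_bool (P x) * u + of_bool (\<not> P x) * v) = ?q * u + (1 - ?q) * v" for u v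
  proof -
    have "expect p (\<lambda>x. of_bool (P x) * u + of_bool (\<not> P x) * v) =
          expect p (\<lambda>x. indicator {z. P z} x * (u - v) + v)"
      by (rule expect_cong) (auto simp: indicator_def)
    also have "\<dots> = ?q * (u - v) + v"
      by (simp add: expect_add fin)
    finally show ?thesis
      by (simp only: algebra_simps)
  qed
  \<comment> \<open>Condition on whether the first draw satisfies \<open>P\<close>.\<close>
  have step: "?E (Suc j) (\<lambda>zs. h (a zs)) = ?q * ?E j (\<lambda>zs. h (1 + a zs)) + (1 - ?q) * ?E j (\<lambda>zs. h (a zs))"
    for h :: "real \<Rightarrow> real" and j
  proof -
    have "?E (Suc j) (\<lambda>zs. h (a zs)) =
        expect p (\<lambda>x. of_bool (P x) * ?E j (\<lambda>zs. h (1 + a zs)) + of_bool (\<not> P x) * ?E j (\<lambda>zs. h (a zs)))"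
      unfolding expect_replicate_Suc[OF assms(1)] by (rule expect_cong) (simp add: a_def)
    then show ?thesis
      by (simp only: split)
  qed
  have "?E (Suc (Suc k)) (\<lambda>zs. a zs * g (a zs)) =
      ?q * ?E (Suc k) (\<lambda>zs. (1 + a zs) * g (1 + a zs)) + (1 - ?q) * ?E (Suc k) (\<lambda>zs. a zs * g (a zs))"
    by (rule step)
  also have "?E (Suc k) (\<lambda>zs. (1 + a zs) * g (1 + a zs)) =
      ?E (Suc k) (\<lambda>zs. g (1 + a zs)) + ?E (Suc k) (\<lambda>zs. a zs * g (1 + a zs))"
    by (subst expect_add[symmetric]) (auto intro: finite_set_replicate_pmf assms(1) simp: algebra_simps)
  also have "?E (Suc k) (\<lambda>zs. a zs * g (1 + a zs)) = real (Suc k) * ?q * ?E k (\<lambda>zs. g (1 + (1 + a zs)))"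
    by (rule Suc.IH)
  also have "?E (Suc k) (\<lambda>zs. a zs * g (a zs)) = real (Suc k) * ?q * ?E k (\<lambda>zs. g (1 + a zs))"
    by (rule Suc.IH)
  also have "?q * (?E (Suc k) (\<lambda>zs. g (1 + a zs)) + real (Suc k) * ?q * ?E k (\<lambda>zs. g (1 + (1 + a zs)))) +
      (1 - ?q) * (real (Suc k) * ?q * ?E k (\<lambda>zs. g (1 + a zs))) =
      ?q * ?E (Suc k) (\<lambda>zs. g (1 + a zs)) + real (Suc k) * ?q *
        (?q * ?E k (\<lambda>zs. g (1 + (1 + a zs))) + (1 - ?q) * ?E k (\<lambda>zs. g (1 + a zs)))"
    by (simp add: algebra_simps)
  also have "?q * ?E k (\<lambda>zs. g (1 + (1 + a zs))) + (1 - ?q) * ?E k (\<lambda>zs. g (1 + a zs)) =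
      ?E (Suc k) (\<lambda>zs. g (1 + a zs))"
    by (rule step[symmetric])
  finally show ?case
    by (simp add: algebra_simps)
qed

text \<open>With \<open>g = 1 / x\<close> the shift identity, after enlarging \<open>k\<close> to
  \<open>Suc k\<close>, turns the left side into the expectation of count times 1 / count, which is
  1 or, for an empty count, 0 because \<open>1 / 0 = 0\<close>.\<close>

lemma expect_inverse_count_le:
  assumes "finite (set_pmf p)"
  shows "real k * measure_pmf.prob p {z. P z} *
         expect (replicate_pmf k p) (\<lambda>zs. 1 / (1 + (\<Sum>z\<leftarrow>zs. of_bool (P z)))) \<le> 1"
    (is "real k * ?q * ?e \<le> 1")
proof -
  have nn: "0 \<le> (\<Sum>z\<leftarrow>zs. of_bool (P z) :: real)" for zs
    by (induction zs) auto
  have "0 \<le> ?e"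
    using nn by (intro expect_nonneg) (auto intro!: divide_nonneg_nonneg add_nonneg_nonneg)
  then have "real k * ?q * ?e \<le> real (Suc k) * ?q * ?e"
    by (intro mult_right_mono) (auto simp: measure_nonneg)
  also have "\<dots> = expect (replicate_pmf (Suc k) p)
      (\<lambda>zs. (\<Sum>z\<leftarrow>zs. of_bool (P z)) * (1 / (\<Sum>z\<leftarrow>zs. of_bool (P z))))"
    by (rule expect_count_shift[OF assms, symmetric, where g = "\<lambda>x. 1 / x"])
  also have "\<dots> \<le> expect (replicate_pmf (Suc k) p) (\<lambda>_. 1)"
    using finite_set_replicate_pmf[OF assms, of "Suc k"] by (intro expect_mono) (auto simp: divide_simps)
  finally show ?thesis
    by simp
qed

section \<open>Closeness testing with cell weights\<close>

definition hits :: "('a \<Rightarrow> 'b) \<Rightarrow> 'b \<Rightarrow> ('a \<times> 'a) list \<Rightarrow> real" where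
  "hits f c zs = (\<Sum>z\<leftarrow>zs. of_bool (f (fst z) = c) - of_bool (f (snd z) = c))"

text \<open>Multiplying counts from two independent lists makes the expectation exactly a weighted
  squared distance; no sample can collide with itself, so no correction term arises.\<close>

definition stat :: "('b \<Rightarrow> real) \<Rightarrow> ('a \<Rightarrow> 'b) \<Rightarrow> 'b set \<Rightarrow> ('a \<times> 'a) list \<times> ('a \<times> 'a) list \<Rightarrow> real" where
  "stat w f I = (\<lambda>(zs, zs'). \<Sum>c\<in>I. w c * (hits f c zs * hits f c zs'))"

locale closeness =
  fixes p q :: "'a pmf" and f :: "'a \<Rightarrow> 'b" and I :: "'b set" and w :: "'b \<Rightarrow> real"
  assumes fin_p: "finite (set_pmf p)" and fin_q: "finite (set_pmf q)" and fin_I: "finite I"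
    and f_p: "f ` set_pmf p \<subseteq> I" and f_q: "f ` set_pmf q \<subseteq> I"
    and w_pos: "\<And>c. 0 < w c" and w_le: "\<And>c. w c \<le> 1"
begin

definition P where "P c = measure_pmf.prob p {x. f x = c}"
definition Q where "Q c = measure_pmf.prob q {x. f x = c}"
definition D where "D c = P c - Q c"
definition \<Theta> where "\<Theta> = (\<Sum>c\<in>I. w c * (D c)\<^sup>2)"
text \<open>The weighted collision norm of both distributions together. It controls the noise: its
  square root acts like an operator norm bound for the matrix \<open>S\<close>.\<close>

definition R where "R = (\<Sum>c\<in>I. w c * (P c + Q c)\<^sup>2)"
text \<open>Second-moment matrix of the signed cell indicators of one sample pair.\<close>

definition S where "S c c' = of_bool (c = c') * (P c + Q c) - P c * Q c' - Q c * P c'"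

abbreviation joint where "joint m \<equiv> pair_pmf (replicate_pmf m (pair_pmf p q)) (replicate_pmf m (pair_pmf p q))"

lemma fin_pq: "finite (set_pmf (pair_pmf p q))"
  by (simp add: fin_p fin_q)

lemma fin_rep: "finite (set_pmf (replicate_pmf m (pair_pmf p q)))"
  by (rule finite_set_replicate_pmf[OF fin_pq])

lemma fin_joint: "finite (set_pmf (joint m))"
  using fin_rep by simp

lemma P_nonneg: "0 \<le> P c" and Q_nonneg: "0 \<le> Q c" and P_le_1: "P c \<le> 1" and Q_le_1: "Q c \<le> 1"
  by (simp_all add: P_def Q_def)

lemma expect_P: "expect p (\<lambda>x. of_bool (f x = c)) = P c"
  and expect_Q: "expect q (\<lambda>x. of_bool (f x = c)) = Q c"
proof -
  have ind: "(\<lambda>x. of_bool (f x = c)) = indicat_real {x. f x = c}"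
    by (auto simp: indicator_def)
  show "expect p (\<lambda>x. of_bool (f x = c)) = P c" "expect q (\<lambda>x. of_bool (f x = c)) = Q c"
    by (simp_all add: ind P_def Q_def)
qed

lemma sum_P: "sum P I = 1" and sum_Q: "sum Q I = 1"
  unfolding P_def Q_def using fin_p f_p fin_q f_q fin_I by (simp_all add: sum_prob_cells)

section \<open>Mean and second moment of the collision statistic\<close>

lemma expect_hit:
  "expect (pair_pmf p q) (\<lambda>z. of_bool (f (fst z) = c) - of_bool (f (snd z) = c)) = D c"
  by (simp add: expect_pair expect_diff fin_p fin_q expect_P expect_Q D_def)

lemma expect_hit_prod:
  "expect (pair_pmf p q) (\<lambda>z. (of_bool (f (fst z) = c) - of_bool (f (snd z) = c)) *
     (of_bool (f (fst z) = c') - of_bool (f (snd z) = c'))) = S c c'"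
proof -
  have eq: "(of_bool (f x = c) - of_bool (f y = c)) * ((of_bool (f x = c') - of_bool (f y = c')) :: real) =
    of_bool (c = c') * of_bool (f x = c) - of_bool (f x = c) * of_bool (f y = c')
    - (of_bool (f x = c') * of_bool (f y = c) - of_bool (c = c') * of_bool (f y = c))" for x y
    by (auto simp: algebra_simps)
  show ?thesis
    unfolding expect_pair[OF fin_p fin_q] fst_conv snd_conv eq
    by (simp add: fin_p fin_q expect_diff expect_add expect_P expect_Q S_def)
qed

lemma expect_stat: "expect (joint m) (stat w f I) = (real m)\<^sup>2 * \<Theta>"
proof -
  have "expect (joint m) (stat w f I) = (\<Sum>c\<in>I. w c * ((real m * D c) * (real m * D c)))"
    by (simp add: stat_def expect_pair fin_rep expect_sum hits_def expect_sum_list fin_p fin_q expect_hit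
        del: replicate_pmf.simps)
  then show ?thesis
    by (simp add: \<Theta>_def sum_distrib_left power2_eq_square algebra_simps)
qed

text \<open>The two lists are independent and identically distributed, so the expectation of a
  product of four counts is the square of a second moment of one list.\<close>

lemma expect_stat_sq:
  "expect (joint m) (\<lambda>z. (stat w f I z)\<^sup>2) =
   (\<Sum>c\<in>I. \<Sum>c'\<in>I. w c * w c' * (real m * S c c' + real m * (real m - 1) * D c * D c')\<^sup>2)"
proof -
  have sq: "(stat w f I (zs, zs'))\<^sup>2 = (\<Sum>c\<in>I. \<Sum>c'\<in>I.
      w c * w c' * ((hits f c zs * hits f c' zs) * (hits f c zs' * hits f c' zs')))" for zs zs'
    unfolding stat_def power2_eq_square by (simp add: sum_product algebra_simps)
  have hh: "expect (replicate_pmf m (pair_pmf p q)) (\<lambda>zs. hits f c zs * hits f c' zs) =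
      real m * S c c' + real m * (real m - 1) * D c * D c'" for c c'
    unfolding hits_def by (simp add: expect_sum_list_prod fin_p fin_q expect_hit expect_hit_prod)
  show ?thesis
    unfolding expect_pair[OF fin_rep fin_rep] sq
    by (simp add: fin_rep expect_sum hh power2_eq_square)
qed

lemma R_nonneg: "0 \<le> R" and \<Theta>_nonneg: "0 \<le> \<Theta>"
  unfolding R_def \<Theta>_def using w_pos by (auto intro!: sum_nonneg mult_nonneg_nonneg simp: less_imp_le)

lemma R_le_4: "R \<le> 4"
proof -
  have "R \<le> (\<Sum>c\<in>I. 2 * (P c + Q c))"
    unfolding R_def
  proof (rule sum_mono)
    fix c
    have "w c * (P c + Q c)\<^sup>2 \<le> 1 * (P c + Q c)\<^sup>2"
      by (rule mult_right_mono) (auto simp: w_le)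
    also have "\<dots> \<le> 2 * (P c + Q c)"
      unfolding power2_eq_square mult_1
      using P_nonneg[of c] Q_nonneg[of c] P_le_1[of c] Q_le_1[of c] by (intro mult_right_mono) auto
    finally show "w c * (P c + Q c)\<^sup>2 \<le> 2 * (P c + Q c)" .
  qed
  also have "\<dots> = 4"
    by (simp add: sum_distrib_left[symmetric] sum.distrib sum_P sum_Q)
  finally show ?thesis .
qed

text \<open>The diagonal part contributes \<open>2 * R\<close> because weights are at most 1, the
  rank-two part \<open>2 * R\<^sup>2\<close>, which is at most \<open>8 * R\<close> by
  \<open>R_le_4\<close>.\<close>

lemma S_norm_le: "(\<Sum>c\<in>I. \<Sum>c'\<in>I. w c * w c' * (S c c')\<^sup>2) \<le> 10 * R"
proof -
  have S_sq: "(S c c')\<^sup>2 \<le> 2 * (of_bool (c = c') * (P c + Q c)\<^sup>2) + 2 * ((P c + Q c)\<^sup>2 * (P c' + Q c')\<^sup>2)" for c c'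
  proof -
    let ?a = "of_bool (c = c') * (P c + Q c)" and ?b = "P c * Q c' + Q c * P c'"
    have "0 \<le> (?a + ?b)\<^sup>2" by simp
    then have "(S c c')\<^sup>2 \<le> 2 * ?a\<^sup>2 + 2 * ?b\<^sup>2"
      unfolding S_def by (simp add: power2_eq_square algebra_simps)
    moreover have "?b\<^sup>2 \<le> ((P c + Q c) * (P c' + Q c'))\<^sup>2"
      using P_nonneg[of c] Q_nonneg[of c] P_nonneg[of c'] Q_nonneg[of c']
      by (intro power_mono) (auto simp: algebra_simps)
    ultimately show ?thesis
      by (cases "c = c'") (auto simp: power_mult_distrib)
  qed
  have "(\<Sum>c\<in>I. \<Sum>c'\<in>I. w c * w c' * (S c c')\<^sup>2) \<le>
      (\<Sum>c\<in>I. \<Sum>c'\<in>I. w c * w c' * (2 * (of_bool (c = c') * (P c + Q c)\<^sup>2) + 2 * ((P c + Q c)\<^sup>2 * (P c' + Q c')\<^sup>2)))"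
    using w_pos S_sq by (intro sum_mono mult_left_mono) (auto simp: less_imp_le)
  also have "\<dots> = (\<Sum>c\<in>I. \<Sum>c'\<in>I. of_bool (c' = c) * (2 * w c * w c * (P c + Q c)\<^sup>2)) +
      2 * (\<Sum>c\<in>I. \<Sum>c'\<in>I. (w c * (P c + Q c)\<^sup>2) * (w c' * (P c' + Q c')\<^sup>2))"
    unfolding sum_distrib_left sum.distrib[symmetric]
    by (intro sum.cong refl) (auto simp: algebra_simps)
  also have "\<dots> = (\<Sum>c\<in>I. 2 * w c * w c * (P c + Q c)\<^sup>2) + 2 * (R * R)"
    by (simp add: R_def sum_product fin_I of_bool_def if_distrib if_distribR cong: if_cong)
  also have "(\<Sum>c\<in>I. 2 * w c * w c * (P c + Q c)\<^sup>2) \<le> (\<Sum>c\<in>I. 2 * (w c * (P c + Q c)\<^sup>2))"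
  proof (rule sum_mono)
    fix c
    have "w c * (w c * (P c + Q c)\<^sup>2) \<le> 1 * (w c * (P c + Q c)\<^sup>2)"
      using w_le w_pos[of c] by (intro mult_right_mono) auto
    then show "2 * w c * w c * (P c + Q c)\<^sup>2 \<le> 2 * (w c * (P c + Q c)\<^sup>2)"
      by simp
  qed
  also have "\<dots> = 2 * R"
    by (simp add: R_def sum_distrib_left)
  also have "R * R \<le> 4 * R"
    by (rule mult_right_mono[OF R_le_4 R_nonneg])
  finally show ?thesis
    by simp
qed

text \<open>The diagonal part is governed by the largest \<open>w c * (P c + Q c)\<close>, hence by
  \<open>sqrt R\<close>. The rest is \<open>- 2 * a * b\<close>, where Cauchy-Schwarz bounds
  \<open>a\<^sup>2\<close> and \<open>b\<^sup>2\<close> by \<open>R * \<Theta>\<close>; with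
  \<open>R \<le> 2 * sqrt R\<close> the coefficients are 1 and 4.\<close>

lemma S_form_le: "(\<Sum>c\<in>I. \<Sum>c'\<in>I. w c * w c' * (S c c' * (D c * D c'))) \<le> 5 * sqrt R * \<Theta>"
proof -
  define a where "a = (\<Sum>c\<in>I. (w c * P c) * D c)"
  define b where "b = (\<Sum>c\<in>I. (w c * Q c) * D c)"
  have cs: "(\<Sum>c\<in>I. (w c * T c) * D c)\<^sup>2 \<le> R * \<Theta>" if "\<And>c. 0 \<le> T c" "\<And>c. T c \<le> P c + Q c" for T
  proof -
    have eq: "(w c * T c) * D c = (sqrt (w c) * T c) * (sqrt (w c) * D c)" for c
      using w_pos[of c] by (simp add: algebra_simps)
    have "(\<Sum>c\<in>I. (w c * T c) * D c)\<^sup>2 \<le> (\<Sum>c\<in>I. (sqrt (w c) * T c)\<^sup>2) * (\<Sum>c\<in>I. (sqrt (w c) * D c)\<^sup>2)"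
      unfolding eq by (rule Cauchy_Schwarz_ineq_sum)
    also have "\<dots> = (\<Sum>c\<in>I. w c * (T c)\<^sup>2) * \<Theta>"
      using w_pos by (simp add: power_mult_distrib \<Theta>_def less_imp_le)
    also have "\<dots> \<le> R * \<Theta>"
      unfolding R_def using w_pos that
      by (intro mult_right_mono[OF _ \<Theta>_nonneg] sum_mono mult_left_mono power_mono) (auto simp: less_imp_le)
    finally show ?thesis .
  qed
  have "a\<^sup>2 \<le> R * \<Theta>" "b\<^sup>2 \<le> R * \<Theta>"
    unfolding a_def b_def using P_nonneg Q_nonneg by (auto intro!: cs)
  moreover have "0 \<le> (a + b)\<^sup>2" by simp
  ultimately have ab: "- (2 * a * b) \<le> 2 * (R * \<Theta>)"
    by (simp add: power2_eq_square algebra_simps)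
  have sqrtR: "R \<le> 2 * sqrt R"
  proof -
    have "sqrt R \<le> 2"
      using real_sqrt_le_mono[OF R_le_4] by simp
    then have "sqrt R * sqrt R \<le> 2 * sqrt R"
      by (rule mult_right_mono) (simp add: R_nonneg)
    then show ?thesis
      using R_nonneg by simp
  qed
  have wPQ: "w c * (P c + Q c) \<le> sqrt R" if "c \<in> I" for c
  proof (rule real_le_rsqrt)
    have "(w c * (P c + Q c))\<^sup>2 = w c * (w c * (P c + Q c)\<^sup>2)"
      by (simp add: power2_eq_square algebra_simps)
    also have "\<dots> \<le> 1 * (w c * (P c + Q c)\<^sup>2)"
      using w_le w_pos[of c] by (intro mult_right_mono) auto
    also have "\<dots> \<le> R"
      unfolding R_def mult_1 using w_pos that fin_I
      by (intro member_le_sum[where f = "\<lambda>c. w c * (P c + Q c)\<^sup>2"]) (auto simp: less_imp_le)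
    finally show "(w c * (P c + Q c))\<^sup>2 \<le> R" .
  qed
  have "(\<Sum>c\<in>I. \<Sum>c'\<in>I. w c * w c' * (S c c' * (D c * D c'))) =
      (\<Sum>c\<in>I. \<Sum>c'\<in>I. of_bool (c' = c) * (w c * (P c + Q c) * (w c * (D c)\<^sup>2))) -
      (\<Sum>c\<in>I. \<Sum>c'\<in>I. (w c * P c * D c) * (w c' * Q c' * D c')) -
      (\<Sum>c\<in>I. \<Sum>c'\<in>I. (w c * Q c * D c) * (w c' * P c' * D c'))"
    unfolding sum_subtractf[symmetric] S_def
    by (intro sum.cong refl) (auto simp: algebra_simps power2_eq_square)
  also have "\<dots> = (\<Sum>c\<in>I. w c * (P c + Q c) * (w c * (D c)\<^sup>2)) - 2 * a * b"
    by (simp add: a_def b_def sum_product[symmetric] fin_I of_bool_def if_distrib if_distribR cong: if_cong)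
  also have "(\<Sum>c\<in>I. w c * (P c + Q c) * (w c * (D c)\<^sup>2)) \<le> (\<Sum>c\<in>I. sqrt R * (w c * (D c)\<^sup>2))"
    using wPQ w_pos by (intro sum_mono mult_right_mono) (auto simp: less_imp_le)
  also have "\<dots> = sqrt R * \<Theta>"
    by (simp add: \<Theta>_def sum_distrib_left)
  also have "sqrt R * \<Theta> - 2 * a * b \<le> sqrt R * \<Theta> + 2 * (R * \<Theta>)"
    using ab by simp
  also have "\<dots> \<le> sqrt R * \<Theta> + 2 * (2 * sqrt R * \<Theta>)"
    using mult_right_mono[OF sqrtR \<Theta>_nonneg] by linarith
  finally show ?thesis
    by (simp add: mult.commute mult.left_commute)
qed

text \<open>The last term is the squared mean, so the first two bound the variance: pure noise, and
  noise interacting with signal.\<close>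

lemma expect_stat_sq_le:
  "expect (joint m) (\<lambda>z. (stat w f I z)\<^sup>2) \<le>
   10 * (real m)\<^sup>2 * R + 10 * (real m)^3 * sqrt R * \<Theta> + (real m)^4 * \<Theta>\<^sup>2"
proof -
  let ?m = "real m"
  have "expect (joint m) (\<lambda>z. (stat w f I z)\<^sup>2) =
      ?m\<^sup>2 * (\<Sum>c\<in>I. \<Sum>c'\<in>I. w c * w c' * (S c c')\<^sup>2) +
      2 * (?m\<^sup>2 * (?m - 1)) * (\<Sum>c\<in>I. \<Sum>c'\<in>I. w c * w c' * (S c c' * (D c * D c'))) +
      (?m * (?m - 1))\<^sup>2 * (\<Sum>c\<in>I. \<Sum>c'\<in>I. (w c * (D c)\<^sup>2) * (w c' * (D c')\<^sup>2))"
    unfolding expect_stat_sq sum_distrib_left sum.distrib[symmetric]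
    by (intro sum.cong refl) (simp add: power2_eq_square algebra_simps)
  also have "(\<Sum>c\<in>I. \<Sum>c'\<in>I. (w c * (D c)\<^sup>2) * (w c' * (D c')\<^sup>2)) = \<Theta>\<^sup>2"
    by (simp add: \<Theta>_def power2_eq_square sum_product)
  also have "?m\<^sup>2 * (\<Sum>c\<in>I. \<Sum>c'\<in>I. w c * w c' * (S c c')\<^sup>2) \<le> ?m\<^sup>2 * (10 * R)"
    by (intro mult_left_mono S_norm_le) simp
  also have "2 * (?m\<^sup>2 * (?m - 1)) * (\<Sum>c\<in>I. \<Sum>c'\<in>I. w c * w c' * (S c c' * (D c * D c'))) \<le>
      2 * (?m\<^sup>2 * (?m - 1)) * (5 * sqrt R * \<Theta>)"
    by (intro mult_left_mono S_form_le) (cases m; simp)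
  also have "2 * (?m\<^sup>2 * (?m - 1)) * (5 * sqrt R * \<Theta>) \<le> 2 * ?m^3 * (5 * sqrt R * \<Theta>)"
    using R_nonneg \<Theta>_nonneg by (intro mult_right_mono) (auto simp: power2_eq_square power3_eq_cube algebra_simps)
  also have "(?m * (?m - 1))\<^sup>2 * \<Theta>\<^sup>2 \<le> ?m^4 * \<Theta>\<^sup>2"
  proof (intro mult_right_mono)
    have "(?m * (?m - 1))\<^sup>2 \<le> (?m * ?m)\<^sup>2"
      by (cases m) (auto intro!: power_mono mult_left_mono)
    then show "(?m * (?m - 1))\<^sup>2 \<le> ?m^4"
      by (simp add: power2_eq_square power4_eq_xxxx)
  qed simp
  finally show ?thesis
    by (simp add: algebra_simps)
qed

text \<open>From \<open>P + Q = D + 2 * Q\<close>. This is why it suffices to flatten with samples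
  of \<open>q\<close> alone: mass of \<open>p\<close> that escapes the flattening reappears in
  \<open>\<Theta>\<close>, the quantity to be detected.\<close>

lemma R_le: "R \<le> 8 * (\<Sum>c\<in>I. w c * (Q c)\<^sup>2) + 2 * \<Theta>"
proof -
  have "R \<le> (\<Sum>c\<in>I. w c * (8 * (Q c)\<^sup>2 + 2 * (D c)\<^sup>2))"
    unfolding R_def
  proof (intro sum_mono mult_left_mono)
    fix c
    have "0 \<le> (D c - 2 * Q c)\<^sup>2" by simp
    then show "(P c + Q c)\<^sup>2 \<le> 8 * (Q c)\<^sup>2 + 2 * (D c)\<^sup>2"
      unfolding D_def by (simp add: power2_eq_square algebra_simps)
  qed (use w_pos less_imp_le in auto)
  then show ?thesis
    by (simp add: \<Theta>_def sum_distrib_left algebra_simps sum.distrib)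
qed

text \<open>The statistic is centred here, and Chebyshev at the threshold leaves
  \<open>320 * B / (m * \<theta>)\<^sup>2\<close>. The factor \<open>L\<close> in the sample
  condition buys a failure probability of order 1 / L, for a union bound over all levels.\<close>

lemma stat_sound:
  assumes pq: "P = Q" and B: "(\<Sum>c\<in>I. w c * (Q c)\<^sup>2) \<le> B" and "0 < \<theta>" "1 \<le> L"
    and m: "5000 * L * sqrt B \<le> real m * \<theta>" and "0 < B"
  shows "measure_pmf.prob (joint m) {z. (real m)\<^sup>2 * \<theta> / 2 \<le> stat w f I z} \<le> 1 / (24 * L)"
proof -
  have "0 < 5000 * L * sqrt B"
    using assms by simp
  with m have "0 < real m * \<theta>"
    by linarith
  then have m_pos: "0 < real m"
    using \<open>0 < \<theta>\<close> by (rule zero_less_mult_pos2)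
  define a where "a = (real m)\<^sup>2 * \<theta> / 2"
  have a_pos: "0 < a"
    using m_pos \<open>0 < \<theta>\<close> by (simp add: a_def)
  have \<Theta>0: "\<Theta> = 0"
    by (simp add: \<Theta>_def D_def pq)
  have "measure_pmf.prob (joint m) {z. a \<le> stat w f I z} \<le> expect (joint m) (\<lambda>z. (stat w f I z)\<^sup>2) / a\<^sup>2"
    using a_pos by (intro markov_bound fin_joint) (auto intro: power_mono)
  also have "\<dots> \<le> 10 * (real m)\<^sup>2 * (8 * B) / a\<^sup>2"
  proof (intro divide_right_mono)
    have "R \<le> 8 * B"
      using R_le B \<Theta>0 by simp
    then have "10 * (real m)\<^sup>2 * R \<le> 10 * (real m)\<^sup>2 * (8 * B)"
      by (intro mult_left_mono) auto
    moreover have "expect (joint m) (\<lambda>z. (stat w f I z)\<^sup>2) \<le> 10 * (real m)\<^sup>2 * R"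
      using expect_stat_sq_le[of m] by (simp add: \<Theta>0)
    ultimately show "expect (joint m) (\<lambda>z. (stat w f I z)\<^sup>2) \<le> 10 * (real m)\<^sup>2 * (8 * B)"
      by (rule order.trans[rotated])
  qed simp
  also have "\<dots> = 320 * B / (real m * \<theta>)\<^sup>2"
    using m_pos by (simp add: a_def power2_eq_square field_simps)
  also have "\<dots> \<le> 320 * B / (5000 * L * sqrt B)\<^sup>2"
    using m_pos \<open>0 < B\<close> \<open>0 < \<theta>\<close> \<open>1 \<le> L\<close>
    by (intro divide_left_mono power_mono m) (auto intro!: mult_pos_pos zero_less_power)
  also have "\<dots> = 320 / (25000000 * L\<^sup>2)"
    using \<open>0 < B\<close> by (simp add: power_mult_distrib)
  also have "\<dots> \<le> 1 / (24 * L)"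
    using \<open>1 \<le> L\<close> by (simp add: divide_simps power2_eq_square)
  finally show ?thesis
    by (simp add: a_def)
qed

text \<open>A single far level triggers rejection, so a constant failure probability is enough.
  Large \<open>R\<close> does no harm: beyond the part bounded by \<open>B\<close> it is due to
  \<open>\<Theta>\<close>, and then the signal is large as well.\<close>

lemma stat_complete:
  assumes \<theta>: "\<theta> \<le> \<Theta>" and B: "(\<Sum>c\<in>I. w c * (Q c)\<^sup>2) \<le> B" and "0 < \<theta>" "\<theta> \<le> B" "1 \<le> L"
    and m: "5000 * L * sqrt B \<le> real m * \<theta>"
  shows "measure_pmf.prob (joint m) {z. stat w f I z < (real m)\<^sup>2 * \<theta> / 2} \<le> 1 / 12"
proof -
  have "0 < B" "0 < \<Theta>"
    using assms by auto
  have "0 < 5000 * L * sqrt B"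
    using assms \<open>0 < B\<close> by simp
  with m have "0 < real m * \<theta>"
    by linarith
  then have m_pos: "0 < real m"
    using \<open>0 < \<theta>\<close> by (rule zero_less_mult_pos2)
  \<comment> \<open>Noise-to-signal ratio: the variance over \<open>a\<^sup>2\<close> is at most
    \<open>40 * (r * r + r)\<close>.\<close>
  define r where "r = sqrt R / (real m * \<Theta>)"
  have r_nonneg: "0 \<le> r"
    using R_nonneg \<Theta>_nonneg by (simp add: r_def)
  have r_le: "r \<le> 1 / 1000"
  proof -
    have "R \<le> (3 * sqrt B + 2 * sqrt \<Theta>)\<^sup>2"
    proof -
      have "R \<le> 8 * B + 2 * \<Theta>"
        using R_le B by simp
      also have "\<dots> \<le> 9 * B + 4 * \<Theta> + 12 * (sqrt B * sqrt \<Theta>)"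
        using \<open>0 < B\<close> \<Theta>_nonneg by (simp add: add_increasing2)
      also have "\<dots> = (3 * sqrt B + 2 * sqrt \<Theta>)\<^sup>2"
        using \<open>0 < B\<close> \<Theta>_nonneg by (simp add: power2_sum power_mult_distrib)
      finally show ?thesis .
    qed
    then have "sqrt R \<le> 3 * sqrt B + 2 * sqrt \<Theta>"
      using \<open>0 < B\<close> \<Theta>_nonneg by (intro real_le_lsqrt) auto
    moreover have "5000 * sqrt B \<le> real m * \<Theta>"
    proof -
      have "5000 * sqrt B * 1 \<le> 5000 * sqrt B * L"
        using \<open>1 \<le> L\<close> \<open>0 < B\<close> by (intro mult_left_mono) auto
      also have "\<dots> \<le> real m * \<theta>"
        using m by (simp add: algebra_simps)
      also have "\<dots> \<le> real m * \<Theta>"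
        using \<theta> by (intro mult_left_mono) auto
      finally show ?thesis by simp
    qed
    \<comment> \<open>Here \<open>\<theta> \<le> B\<close> enters: with the sample condition it
      gives \<open>5000 \<le> m * sqrt \<theta>\<close>, which survives replacing
      \<open>\<theta>\<close> by the larger \<open>\<Theta>\<close>.\<close>
    moreover have "5000 * sqrt \<Theta> \<le> real m * \<Theta>"
    proof -
      have "5000 * sqrt \<theta> * 1 \<le> 5000 * sqrt B * L"
        using assms \<open>0 < B\<close> by (intro mult_mono) auto
      also have "\<dots> \<le> real m * (sqrt \<theta> * sqrt \<theta>)"
        using m \<open>0 < \<theta>\<close> by (simp add: algebra_simps)
      finally have "5000 * sqrt \<theta> \<le> (real m * sqrt \<theta>) * sqrt \<theta>"
        by (simp add: algebra_simps)
      then have "5000 \<le> real m * sqrt \<theta>"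
        using \<open>0 < \<theta>\<close> by simp
      also have "\<dots> \<le> real m * sqrt \<Theta>"
        using \<theta> by (intro mult_left_mono) auto
      finally have "5000 * sqrt \<Theta> \<le> (real m * sqrt \<Theta>) * sqrt \<Theta>"
        by (intro mult_right_mono) (auto simp: \<Theta>_nonneg)
      then show ?thesis
        using \<Theta>_nonneg by (simp add: mult.assoc)
    qed
    ultimately have "1000 * sqrt R \<le> real m * \<Theta>"
      by linarith
    then show ?thesis
      using m_pos \<open>0 < \<Theta>\<close> by (simp add: r_def field_simps)
  qed
  \<comment> \<open>The mean is \<open>2 * a\<close>, so falling below the threshold is a deviation
    of at least \<open>a\<close>.\<close>
  define a where "a = (real m)\<^sup>2 * \<Theta> / 2"
  have a_pos: "0 < a"
    using m_pos \<open>0 < \<Theta>\<close> by (simp add: a_def)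
  have below: "(real m)\<^sup>2 * \<theta> / 2 \<le> a"
    using \<theta> by (simp add: a_def mult_left_mono)
  have "measure_pmf.prob (joint m) {z. stat w f I z < (real m)\<^sup>2 * \<theta> / 2} \<le>
      expect (joint m) (\<lambda>z. (stat w f I z - 2 * a)\<^sup>2) / a\<^sup>2"
  proof (intro markov_bound fin_joint)
    fix z assume "z \<in> {z. stat w f I z < (real m)\<^sup>2 * \<theta> / 2}"
    then have "a \<le> 2 * a - stat w f I z"
      using below by auto
    then show "a\<^sup>2 \<le> (stat w f I z - 2 * a)\<^sup>2"
      using a_pos by (subst power2_commute) (auto intro: power_mono)
  qed (use a_pos in auto)
  also have "expect (joint m) (\<lambda>z. (stat w f I z - 2 * a)\<^sup>2) =
      expect (joint m) (\<lambda>z. (stat w f I z)\<^sup>2 - 4 * a * stat w f I z + 4 * a\<^sup>2)"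
    by (intro expect_cong) (simp add: power2_eq_square algebra_simps)
  also have "\<dots> = expect (joint m) (\<lambda>z. (stat w f I z)\<^sup>2) - 4 * a\<^sup>2"
    by (simp add: expect_add expect_diff fin_joint expect_stat del: set_pair_pmf)
      (simp add: a_def power2_eq_square)
  also have "\<dots> \<le> 10 * (real m)\<^sup>2 * R + 10 * (real m)^3 * sqrt R * \<Theta>"
  proof -
    have "4 * a\<^sup>2 = (real m)^4 * \<Theta>\<^sup>2"
      by (simp add: a_def power2_eq_square power4_eq_xxxx)
    then show ?thesis
      using expect_stat_sq_le[of m] by linarith
  qed
  also have "(10 * (real m)\<^sup>2 * R + 10 * (real m)^3 * sqrt R * \<Theta>) / a\<^sup>2 = 40 * (r * r + r)"
  proof -
    have sR: "sqrt R = r * (real m * \<Theta>)"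
      using m_pos \<open>0 < \<Theta>\<close> by (simp add: r_def)
    have RR: "R = (r * (real m * \<Theta>))\<^sup>2"
      using R_nonneg by (simp flip: sR)
    show ?thesis
      unfolding sR using m_pos \<open>0 < \<Theta>\<close>
      by (subst RR) (simp add: a_def field_simps power2_eq_square power3_eq_cube)
  qed
  also have "\<dots> \<le> 40 * (1/1000 * (1/1000) + 1/1000)"
    using r_le r_nonneg by (intro mult_left_mono add_mono mult_mono) auto
  finally show ?thesis
    using a_pos by (simp add: divide_right_mono)
qed

end

section \<open>Flattening and simultaneous testing of all levels\<close>

definition count_in :: "('a \<Rightarrow> 'b) \<Rightarrow> 'b \<Rightarrow> 'a list \<Rightarrow> real" where
  "count_in f c xs = (\<Sum>x\<leftarrow>xs. of_bool (f x = c))"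

text \<open>The weights play the role of splitting cell \<open>c\<close> into \<open>1 + \<kappa> \<cdot> count\<close> equal pieces; this
  makes the reference distribution flat without any random splitting.\<close>

definition flat_weight :: "real \<Rightarrow> ('a \<Rightarrow> 'b) \<Rightarrow> 'a list \<Rightarrow> 'b \<Rightarrow> real" where
  "flat_weight \<kappa> f xs c = 1 / (1 + \<kappa> * count_in f c xs)"

lemma count_in_nonneg: "0 \<le> count_in f c xs"
  unfolding count_in_def by (induction xs) auto

lemma flat_weight_pos: "0 \<le> \<kappa> \<Longrightarrow> 0 < flat_weight \<kappa> f xs c"
  by (simp add: flat_weight_def add_pos_nonneg count_in_nonneg)

lemma flat_weight_le: "0 \<le> \<kappa> \<Longrightarrow> flat_weight \<kappa> f xs c \<le> 1"
  by (simp add: flat_weight_def add_pos_nonneg count_in_nonneg)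

lemma sum_count_in_le:
  assumes "finite I"
  shows "(\<Sum>c\<in>I. count_in f c xs) \<le> real (length xs)"
proof (induction xs)
  case (Cons x xs)
  have "(\<Sum>c\<in>I. of_bool (f x = c)) \<le> (1::real)"
    using assms by (simp add: of_bool_def)
  with Cons show ?case
    by (simp add: count_in_def sum.distrib)
qed (simp add: count_in_def)

text \<open>As \<open>\<kappa> \<le> 1\<close>, the denominator of the weight is at least
  \<open>\<kappa> * (1 + count)\<close>, which reduces the claim to the inverse count bound.\<close>

lemma expect_flat_weight:
  assumes fin: "finite (set_pmf q)" and \<kappa>: "0 < \<kappa>" "\<kappa> \<le> 1" and "0 < k"
  shows "expect (replicate_pmf k q) (\<lambda>xs. flat_weight \<kappa> f xs c) * (measure_pmf.prob q {x. f x = c})\<^sup>2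
    \<le> measure_pmf.prob q {x. f x = c} / (\<kappa> * real k)"
proof -
  let ?q = "measure_pmf.prob q {x. f x = c}"
  let ?e = "expect (replicate_pmf k q) (\<lambda>xs. 1 / (1 + count_in f c xs))"
  have "expect (replicate_pmf k q) (\<lambda>xs. flat_weight \<kappa> f xs c) \<le>
      expect (replicate_pmf k q) (\<lambda>xs. (1 / \<kappa>) * (1 / (1 + count_in f c xs)))"
  proof (intro expect_mono finite_set_replicate_pmf fin)
    fix xs
    have "1 / (1 + \<kappa> * count_in f c xs) \<le> 1 / (\<kappa> * (1 + count_in f c xs))"
      using \<kappa> count_in_nonneg[of f c xs]
      by (intro divide_left_mono) (auto simp: algebra_simps intro!: mult_pos_pos add_pos_nonneg)
    then show "flat_weight \<kappa> f xs c \<le> (1 / \<kappa>) * (1 / (1 + count_in f c xs))"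
      by (simp add: flat_weight_def)
  qed
  also have "\<dots> = (1 / \<kappa>) * ?e"
    by (rule integral_mult_right_zero)
  finally have "expect (replicate_pmf k q) (\<lambda>xs. flat_weight \<kappa> f xs c) * ?q\<^sup>2 \<le> ((1 / \<kappa>) * ?e) * ?q\<^sup>2"
    by (rule mult_right_mono) simp
  also have "\<dots> = ?q / (\<kappa> * real k) * (real k * ?q * ?e)"
    using \<open>0 < k\<close> \<kappa> by (simp add: power2_eq_square field_simps)
  also have "\<dots> \<le> ?q / (\<kappa> * real k) * 1"
    unfolding count_in_def using \<kappa> by (intro mult_left_mono expect_inverse_count_le[OF fin]) auto
  finally show ?thesis
    by simp
qed

text \<open>Flattening absorbs one factor of each squared cell probability; the remaining factors
  sum to 1, and Markov's inequality applies.\<close>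

lemma flat_weight_collision:
  assumes fin: "finite (set_pmf q)" and \<kappa>: "0 < \<kappa>" "\<kappa> \<le> 1" and "0 < k"
    and I: "finite I" "f ` set_pmf q \<subseteq> I" and "0 < B"
  shows "measure_pmf.prob (replicate_pmf k q)
      {xs. B < (\<Sum>c\<in>I. flat_weight \<kappa> f xs c * (measure_pmf.prob q {x. f x = c})\<^sup>2)} \<le> 1 / (\<kappa> * real k * B)"
proof -
  let ?q = "\<lambda>c. measure_pmf.prob q {x. f x = c}"
  have total: "(\<Sum>c\<in>I. ?q c) = 1"
    by (rule sum_prob_cells[OF fin I])
  have "measure_pmf.prob (replicate_pmf k q) {xs. B < (\<Sum>c\<in>I. flat_weight \<kappa> f xs c * (?q c)\<^sup>2)} \<le>
      expect (replicate_pmf k q) (\<lambda>xs. \<Sum>c\<in>I. flat_weight \<kappa> f xs c * (?q c)\<^sup>2) / B"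
    using \<open>0 < B\<close> \<kappa> by (intro markov_bound finite_set_replicate_pmf fin)
      (auto intro!: sum_nonneg mult_nonneg_nonneg less_imp_le[OF flat_weight_pos])
  also have "expect (replicate_pmf k q) (\<lambda>xs. \<Sum>c\<in>I. flat_weight \<kappa> f xs c * (?q c)\<^sup>2) =
      (\<Sum>c\<in>I. expect (replicate_pmf k q) (\<lambda>xs. flat_weight \<kappa> f xs c) * (?q c)\<^sup>2)"
    by (simp add: expect_sum finite_set_replicate_pmf fin)
  also have "\<dots> \<le> (\<Sum>c\<in>I. ?q c / (\<kappa> * real k))"
    by (intro sum_mono expect_flat_weight assms)
  also have "\<dots> = 1 / (\<kappa> * real k)"
    by (simp add: sum_divide_distrib[symmetric] total)
  finally show ?thesis
    using \<open>0 < B\<close> by (simp add: divide_right_mono)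
qed

text \<open>Cauchy-Schwarz against the inverse weights. Their sum is the number of cells after the
  virtual splitting, at most \<open>2 * N\<close>, so weighting loses only a factor 2 against the
  uniform bound.\<close>

lemma flat_weight_norm:
  assumes "finite I" "0 \<le> \<kappa>" "real (card I) \<le> N" "\<kappa> * real (length xs) \<le> N" "0 < N"
  shows "(\<Sum>c\<in>I. \<bar>D c\<bar>)\<^sup>2 / (2 * N) \<le> (\<Sum>c\<in>I. flat_weight \<kappa> f xs c * (D c)\<^sup>2)"
proof -
  let ?w = "flat_weight \<kappa> f xs"
  have w: "0 < ?w c" for c
    by (rule flat_weight_pos[OF assms(2)])
  have eq: "\<bar>D c\<bar> = (sqrt (?w c) * \<bar>D c\<bar>) * (1 / sqrt (?w c))" for c
    using w[of c] by simp
  have "(\<Sum>c\<in>I. \<bar>D c\<bar>)\<^sup>2 \<le> (\<Sum>c\<in>I. (sqrt (?w c) * \<bar>D c\<bar>)\<^sup>2) * (\<Sum>c\<in>I. (1 / sqrt (?w c))\<^sup>2)"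
    by (subst eq) (rule Cauchy_Schwarz_ineq_sum)
  also have "(\<Sum>c\<in>I. (sqrt (?w c) * \<bar>D c\<bar>)\<^sup>2) = (\<Sum>c\<in>I. ?w c * (D c)\<^sup>2)"
    using w by (simp add: power_mult_distrib less_imp_le)
  also have "(\<Sum>c\<in>I. (1 / sqrt (?w c))\<^sup>2) = (\<Sum>c\<in>I. 1 + \<kappa> * count_in f c xs)"
    using w assms(2) by (simp add: power_divide less_imp_le flat_weight_def add_nonneg_nonneg count_in_nonneg)
  also have "\<dots> = real (card I) + \<kappa> * (\<Sum>c\<in>I. count_in f c xs)"
    by (simp add: sum.distrib sum_distrib_left)
  also have "(\<Sum>c\<in>I. ?w c * (D c)\<^sup>2) * \<dots> \<le> (\<Sum>c\<in>I. ?w c * (D c)\<^sup>2) * (2 * N)"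
  proof (rule mult_left_mono)
    have "\<kappa> * (\<Sum>c\<in>I. count_in f c xs) \<le> \<kappa> * real (length xs)"
      by (intro mult_left_mono sum_count_in_le assms)
    with assms show "real (card I) + \<kappa> * (\<Sum>c\<in>I. count_in f c xs) \<le> 2 * N"
      by linarith
  qed (auto intro!: sum_nonneg mult_nonneg_nonneg simp: w less_imp_le)
  finally show ?thesis
    using \<open>0 < N\<close> by (simp add: field_simps)
qed

definition final_dist :: "nat \<Rightarrow> 'a pmf \<Rightarrow> nat \<Rightarrow> 'a pmf \<Rightarrow>
    ('a list \<Rightarrow> ('a \<times> 'a) list \<times> ('a \<times> 'a) list \<Rightarrow> bool) \<Rightarrow> bool pmf" where
  "final_dist k q m p dec = bind_pmf (replicate_pmf k q) (\<lambda>fs.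
     map_pmf (dec fs) (pair_pmf (replicate_pmf m (pair_pmf p q)) (replicate_pmf m (pair_pmf p q))))"

text \<open>All levels \<open>1, \<dots>, L\<close> share the same \<open>k\<close> flattening samples and the same two lists of \<open>m\<close> pairs;
  \<open>\<delta> l\<close> is the \<open>\<ell>\<^sub>1\<close> distance to be detected at level \<open>l\<close>.\<close>

locale level_test =
  fixes f :: "nat \<Rightarrow> 'a \<Rightarrow> 'b" and I :: "nat \<Rightarrow> 'b set" and N \<delta> :: "nat \<Rightarrow> real" and X :: "'a set"
    and L k m :: nat
  assumes fin_X: "finite X" and L_pos: "1 \<le> L" and k_pos: "0 < k"
    and I: "\<And>l. finite (I l)" "\<And>l. f l ` X \<subseteq> I l" "\<And>l. real (card (I l)) \<le> N l"
    and N_ge_1: "\<And>l. 1 \<le> N l"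
    and \<delta>: "\<And>l. l \<in> {1..L} \<Longrightarrow> 0 < \<delta> l" "\<And>l. l \<in> {1..L} \<Longrightarrow> \<delta> l \<le> 2"
    and m: "\<And>l. l \<in> {1..L} \<Longrightarrow> 5000 * real L * sqrt (24 * real L / min (real k) (N l)) \<le> real m * ((\<delta> l)\<^sup>2 / (2 * N l))"
begin

text \<open>Scaling the counts down at coarse levels keeps the added weight
  \<open>\<kappa> l * k\<close> at \<open>min k (N l)\<close>, so the splitting at most doubles
  \<open>N l\<close> even when \<open>k\<close> is far larger.\<close>

definition \<kappa> where "\<kappa> l = min 1 (N l / real k)"
text \<open>What \<open>flat_weight_norm\<close> guarantees for the weighted squared distance when
  the \<open>\<ell>\<^sub>1\<close> distance is \<open>\<delta> l\<close>.\<close>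

definition \<theta> where "\<theta> l = (\<delta> l)\<^sup>2 / (2 * N l)"
text \<open>\<open>24 * L\<close> times the bound \<open>1 / (\<kappa> l * k)\<close> on the
  expected collision norm, so that Markov fails with probability at most
  \<open>1 / (24 * L)\<close>.\<close>

definition B where "B l = 24 * real L / min (real k) (N l)"

definition far where
  "far fs zz \<longleftrightarrow> (\<exists>l\<in>{1..L}. (real m)\<^sup>2 * \<theta> l / 2 \<le> stat (flat_weight (\<kappa> l) (f l) fs) (f l) (I l) zz)"

lemma \<kappa>_pos: "0 < \<kappa> l" and \<kappa>_le_1: "\<kappa> l \<le> 1"
  using k_pos N_ge_1[of l] by (auto simp: \<kappa>_def)

lemma \<kappa>_k: "\<kappa> l * real k = min (real k) (N l)"
  using k_pos by (auto simp: \<kappa>_def min_def field_simps)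

lemma B_pos: "0 < B l"
  using k_pos N_ge_1[of l] L_pos by (auto simp: B_def intro!: divide_pos_pos)

lemma \<theta>_pos:
  assumes "l \<in> {1..L}"
  shows "0 < \<theta> l"
  using N_ge_1[of l] \<delta>(1)[OF assms] by (simp add: \<theta>_def)

lemma \<theta>_le_B:
  assumes "l \<in> {1..L}"
  shows "\<theta> l \<le> B l"
proof -
  have "(\<delta> l)\<^sup>2 \<le> 2\<^sup>2"
    using \<delta>[OF assms] by (intro power_mono) auto
  then have "\<theta> l \<le> 2\<^sup>2 / (2 * N l)"
    unfolding \<theta>_def using N_ge_1[of l] by (intro divide_right_mono) auto
  also have "\<dots> \<le> 2\<^sup>2 / (2 * min (real k) (N l))"
    using N_ge_1[of l] k_pos by (intro divide_left_mono) auto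
  also have "\<dots> \<le> B l"
    using N_ge_1[of l] k_pos L_pos by (auto simp: B_def divide_simps min_def)
  finally show ?thesis .
qed

lemma closeness:
  assumes "set_pmf p \<subseteq> X" "set_pmf q \<subseteq> X"
  shows "closeness p q (f l) (I l) (flat_weight (\<kappa> l) (f l) fs)"
  using assms I(1,2)[of l] finite_subset[OF _ fin_X] \<kappa>_pos[of l]
  by unfold_locales (auto intro!: flat_weight_pos flat_weight_le)

lemma bad_flattening:
  assumes "set_pmf q \<subseteq> X"
  shows "measure_pmf.prob (replicate_pmf k q)
    {fs. B l < (\<Sum>c\<in>I l. flat_weight (\<kappa> l) (f l) fs c * (measure_pmf.prob q {x. f l x = c})\<^sup>2)} \<le> 1 / (24 * real L)"
proof -
  have "measure_pmf.prob (replicate_pmf k q)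
    {fs. B l < (\<Sum>c\<in>I l. flat_weight (\<kappa> l) (f l) fs c * (measure_pmf.prob q {x. f l x = c})\<^sup>2)} \<le> 1 / (\<kappa> l * real k * B l)"
    using assms I(1,2)[of l] finite_subset[OF assms fin_X] \<kappa>_pos[of l] \<kappa>_le_1[of l] k_pos B_pos[of l]
    by (intro flat_weight_collision) auto
  also have "\<dots> = 1 / (24 * real L)"
    unfolding \<kappa>_k using N_ge_1[of l] k_pos by (simp add: B_def)
  finally show ?thesis .
qed

lemma final_dist_finite:
  assumes "set_pmf p \<subseteq> X" "set_pmf q \<subseteq> X"
  shows "finite (set_pmf (replicate_pmf k q))" "finite (set_pmf (map_pmf g
    (pair_pmf (replicate_pmf m (pair_pmf p q)) (replicate_pmf m (pair_pmf p q)))))"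
proof -
  have fin: "finite (set_pmf p)" "finite (set_pmf q)"
    using assms finite_subset[OF _ fin_X] by auto
  show "finite (set_pmf (replicate_pmf k q))"
    by (rule finite_set_replicate_pmf[OF fin(2)])
  have "finite (set_pmf (replicate_pmf m (pair_pmf p q)))"
    using fin by (intro finite_set_replicate_pmf) simp
  then show "finite (set_pmf (map_pmf g
      (pair_pmf (replicate_pmf m (pair_pmf p q)) (replicate_pmf m (pair_pmf p q)))))"
    by simp
qed

lemma expect_bad_flattening:
  assumes "set_pmf q \<subseteq> X"
  shows "expect (replicate_pmf k q) (\<lambda>fs. of_bool (B l < (\<Sum>c\<in>I l. flat_weight (\<kappa> l) (f l) fs c *
      (measure_pmf.prob q {x. f l x = c})\<^sup>2))) \<le> 1 / (24 * real L)"
proof -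
  have eq: "(\<lambda>fs. of_bool (A fs)) = indicat_real {fs. A fs}" for A :: "'a list \<Rightarrow> bool"
    by (auto simp: indicator_def)
  show ?thesis
    unfolding eq using bad_flattening[OF assms] by simp
qed

text \<open>Union bound: every level pays \<open>1 / (24 * L)\<close> for a bad flattening and the
  same for its statistic, in total 1 / 12.\<close>

lemma far_same:
  assumes "set_pmf p \<subseteq> X"
  shows "measure_pmf.prob (final_dist k p m p far) {True} \<le> 1 / 6"
proof -
  let ?bad = "\<lambda>l fs. B l < (\<Sum>c\<in>I l. flat_weight (\<kappa> l) (f l) fs c * (measure_pmf.prob p {x. f l x = c})\<^sup>2)"
  let ?J = "pair_pmf (replicate_pmf m (pair_pmf p p)) (replicate_pmf m (pair_pmf p p))"
  let ?A = "\<lambda>l fs. {z. (real m)\<^sup>2 * \<theta> l / 2 \<le> stat (flat_weight (\<kappa> l) (f l) fs) (f l) (I l) z}"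
  note fin = final_dist_finite[OF assms assms]
  have "measure_pmf.prob (final_dist k p m p far) {True} =
      expect (replicate_pmf k p) (\<lambda>fs. measure_pmf.prob (map_pmf (far fs) ?J) {True})"
    unfolding final_dist_def by (intro prob_bind fin)
  \<comment> \<open>The indicator of a bad flattening replaces conditioning on a good one.\<close>
  also have "\<dots> \<le> expect (replicate_pmf k p) (\<lambda>fs. \<Sum>l\<in>{1..L}. 1 / (24 * real L) + of_bool (?bad l fs))"
  proof (intro expect_mono fin)
    fix fs
    have "measure_pmf.prob (map_pmf (far fs) ?J) {True} = measure_pmf.prob ?J (\<Union>l\<in>{1..L}. ?A l fs)"
    proof -
      have "far fs -` {True} = (\<Union>l\<in>{1..L}. ?A l fs)"
        by (rule set_eqI) (simp add: far_def)
      then show ?thesis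
        unfolding measure_map_pmf by (rule arg_cong)
    qed
    also have "\<dots> \<le> (\<Sum>l\<in>{1..L}. measure_pmf.prob ?J (?A l fs))"
      by (intro measure_pmf.finite_measure_subadditive_finite) auto
    also have "\<dots> \<le> (\<Sum>l\<in>{1..L}. 1 / (24 * real L) + of_bool (?bad l fs))"
    proof (rule sum_mono)
      fix l assume l: "l \<in> {1..L}"
      interpret closeness p p "f l" "I l" "flat_weight (\<kappa> l) (f l) fs"
        by (rule closeness[OF assms assms])
      show "measure_pmf.prob ?J (?A l fs) \<le> 1 / (24 * real L) + of_bool (?bad l fs)"
      proof (cases "?bad l fs")
        case False
        have PQ: "P = Q"
          by (rule ext) (simp add: P_def Q_def)
        have "measure_pmf.prob ?J (?A l fs) \<le> 1 / (24 * real L)"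
          using False \<theta>_pos[OF l] L_pos m[OF l] B_pos[of l]
          by (intro stat_sound[OF PQ, where B = "B l"]) (simp_all add: Q_def \<theta>_def B_def not_less)
        then show ?thesis by simp
      next
        case True
        have "measure_pmf.prob ?J (?A l fs) \<le> 1"
          by simp
        also have "1 \<le> 1 / (24 * real L) + of_bool (?bad l fs)"
          using True by simp
        finally show ?thesis .
      qed
    qed
    finally show "measure_pmf.prob (map_pmf (far fs) ?J) {True} \<le> (\<Sum>l\<in>{1..L}. 1 / (24 * real L) + of_bool (?bad l fs))" .
  qed
  also have "\<dots> = (\<Sum>l\<in>{1..L}. 1 / (24 * real L) + expect (replicate_pmf k p) (\<lambda>fs. of_bool (?bad l fs)))"
    by (simp add: expect_sum expect_add fin)
  also have "\<dots> \<le> (\<Sum>l\<in>{1..L}. 1 / (24 * real L) + 1 / (24 * real L))"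
    by (intro sum_mono add_left_mono expect_bad_flattening assms)
  also have "\<dots> \<le> 1 / 6"
    using L_pos by simp
  finally show ?thesis .
qed

text \<open>Only the level \<open>l\<close> matters: 1 / 12 from Chebyshev plus
  \<open>1 / (24 * L)\<close> for its flattening.\<close>

lemma far_different:
  assumes p: "set_pmf p \<subseteq> X" and q: "set_pmf q \<subseteq> X" and l: "l \<in> {1..L}"
    and dist: "\<delta> l \<le> (\<Sum>c\<in>I l. \<bar>measure_pmf.prob p {x. f l x = c} - measure_pmf.prob q {x. f l x = c}\<bar>)"
  shows "measure_pmf.prob (final_dist k q m p far) {False} \<le> 1 / 6"
proof -
  let ?bad = "\<lambda>fs. B l < (\<Sum>c\<in>I l. flat_weight (\<kappa> l) (f l) fs c * (measure_pmf.prob q {x. f l x = c})\<^sup>2)"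
  let ?J = "pair_pmf (replicate_pmf m (pair_pmf p q)) (replicate_pmf m (pair_pmf p q))"
  let ?A = "\<lambda>fs. {z. stat (flat_weight (\<kappa> l) (f l) fs) (f l) (I l) z < (real m)\<^sup>2 * \<theta> l / 2}"
  note fin = final_dist_finite[OF p q]
  have "measure_pmf.prob (final_dist k q m p far) {False} =
      expect (replicate_pmf k q) (\<lambda>fs. measure_pmf.prob (map_pmf (far fs) ?J) {False})"
    unfolding final_dist_def by (intro prob_bind fin)
  also have "\<dots> \<le> expect (replicate_pmf k q) (\<lambda>fs. 1 / 12 + of_bool (?bad fs))"
  proof (intro expect_mono fin)
    fix fs assume fs: "fs \<in> set_pmf (replicate_pmf k q)"
    then have len: "length fs = k"
      by (simp add: set_replicate_pmf)
    interpret closeness p q "f l" "I l" "flat_weight (\<kappa> l) (f l) fs"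
      by (rule closeness[OF p q])
    have "measure_pmf.prob (map_pmf (far fs) ?J) {False} = measure_pmf.prob ?J {z. \<not> far fs z}"
    proof -
      have "far fs -` {False} = {z. \<not> far fs z}"
        by auto
      then show ?thesis
        unfolding measure_map_pmf by (rule arg_cong)
    qed
    also have "\<dots> \<le> measure_pmf.prob ?J (?A fs)"
      using l by (intro measure_pmf.finite_measure_mono) (auto simp: far_def not_le)
    also have "\<dots> \<le> 1 / 12 + of_bool (?bad fs)"
    proof (cases "?bad fs")
      case False
      have "\<theta> l \<le> \<Theta>"
      proof -
        have "(\<delta> l)\<^sup>2 \<le> (\<Sum>c\<in>I l. \<bar>D c\<bar>)\<^sup>2"
          using dist \<delta>(1)[OF l] by (intro power_mono) (auto simp: D_def P_def Q_def)
        then have "\<theta> l \<le> (\<Sum>c\<in>I l. \<bar>D c\<bar>)\<^sup>2 / (2 * N l)"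
          unfolding \<theta>_def using N_ge_1[of l] by (intro divide_right_mono) auto
        also have "\<dots> \<le> \<Theta>"
          unfolding \<Theta>_def using I(1)[of l] I(3)[of l] \<kappa>_pos[of l] N_ge_1[of l] \<kappa>_k[of l]
          by (intro flat_weight_norm) (auto simp: len)
        finally show ?thesis .
      qed
      then have "measure_pmf.prob ?J (?A fs) \<le> 1 / 12"
        using \<theta>_pos[OF l] \<theta>_le_B[OF l] L_pos m[OF l] False
        by (intro stat_complete[where B = "B l" and L = L]) (simp_all add: Q_def \<theta>_def B_def not_less)
      then show ?thesis by simp
    next
      case True
      have "measure_pmf.prob ?J (?A fs) \<le> 1"
        by simp
      also have "1 \<le> 1 / 12 + (of_bool (?bad fs) :: real)"
        using True by simp
      finally show ?thesis .
    qed
    finally show "measure_pmf.prob (map_pmf (far fs) ?J) {False} \<le> 1 / 12 + of_bool (?bad fs)" .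
  qed
  also have "\<dots> = 1 / 12 + expect (replicate_pmf k q) (\<lambda>fs. of_bool (?bad fs))"
    by (simp add: expect_add fin)
  also have "\<dots> \<le> 1 / 12 + 1 / (24 * real L)"
    by (intro add_left_mono expect_bad_flattening q)
  also have "\<dots> \<le> 1 / 6"
    using L_pos by (simp add: field_simps)
  finally show ?thesis .
qed

end

section \<open>Earth mover distance and nested partitions\<close>

definition mass :: "'z set \<Rightarrow> ('z \<Rightarrow> 'c) \<Rightarrow> ('z \<Rightarrow> real) \<Rightarrow> 'c \<Rightarrow> real" where
  "mass Z f a c = (\<Sum>x\<in>Z. of_bool (f x = c) * a x)"

definition tv :: "'z set \<Rightarrow> ('z \<Rightarrow> 'c) \<Rightarrow> ('z \<Rightarrow> real) \<Rightarrow> ('z \<Rightarrow> real) \<Rightarrow> real" where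
  "tv Z f a b = (\<Sum>c\<in>f ` Z. \<bar>mass Z f a c - mass Z f b c\<bar>) / 2"

lemma sum_mass:
  assumes "finite Z"
  shows "(\<Sum>c\<in>f ` Z. mass Z f a c * g c) = (\<Sum>x\<in>Z. a x * g (f x))"
proof -
  have "(\<Sum>c\<in>f ` Z. mass Z f a c * g c) = (\<Sum>x\<in>Z. \<Sum>c\<in>f ` Z. of_bool (f x = c) * a x * g c)"
    unfolding mass_def sum_distrib_right by (rule sum.swap)
  also have "\<dots> = (\<Sum>x\<in>Z. a x * g (f x))"
  proof (rule sum.cong[OF refl])
    fix x assume "x \<in> Z"
    have "(\<Sum>c\<in>f ` Z. of_bool (f x = c) * a x * g c) = (\<Sum>c\<in>f ` Z. if c = f x then a x * g c else 0)"
      by (rule sum.cong) auto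
    also have "\<dots> = a x * g (f x)"
      using assms \<open>x \<in> Z\<close> by simp
    finally show "(\<Sum>c\<in>f ` Z. of_bool (f x = c) * a x * g c) = a x * g (f x)" .
  qed
  finally show ?thesis .
qed

lemma mass_nonneg: "(\<And>x. x \<in> Z \<Longrightarrow> 0 \<le> a x) \<Longrightarrow> 0 \<le> mass Z f a c"
  unfolding mass_def by (intro sum_nonneg) auto

text \<open>Inside every cell \<open>c\<close> of a partition match \<open>a\<close> and \<open>b\<close> proportionally, as much as
  possible, i.e. up to mass \<open>min (mass a c) (mass b c)\<close>. What is left over is the total
  variation distance of the two mass functions, and since matched pairs share a cell, the
  differences of the masses of coarser cells do not change.\<close>

definition cell_match :: "'z set \<Rightarrow> ('z \<Rightarrow> 'c) \<Rightarrow> ('z \<Rightarrow> real) \<Rightarrow> ('z \<Rightarrow> real) \<Rightarrow> 'z \<Rightarrow> 'z \<Rightarrow> real" where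
  "cell_match Z f a b x y =
     of_bool (f x = f y) * (a x * b y / max (mass Z f a (f x)) (mass Z f b (f x)))"

lemma cell_match_row:
  "(\<Sum>y\<in>Z. cell_match Z f a b x y) = a x * (mass Z f b (f x) / max (mass Z f a (f x)) (mass Z f b (f x)))"
proof -
  have "(\<Sum>y\<in>Z. cell_match Z f a b x y) =
      (\<Sum>y\<in>Z. a x * (of_bool (f y = f x) * b y / max (mass Z f a (f x)) (mass Z f b (f x))))"
    by (rule sum.cong) (auto simp: cell_match_def)
  also have "\<dots> = a x * (mass Z f b (f x) / max (mass Z f a (f x)) (mass Z f b (f x)))"
    by (simp only: sum_distrib_left[symmetric] sum_divide_distrib[symmetric] mass_def)
  finally show ?thesis .
qed

lemma cell_match_commute: "cell_match Z f a b x y = cell_match Z f b a y x"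
  unfolding cell_match_def by (auto simp: max.commute mult.commute)

text \<open>What remains of \<open>a\<close> in a cell is the positive part of the mass difference;
  equal totals make the positive parts add up to half the \<open>\<ell>\<^sub>1\<close>
  distance.\<close>

lemma cell_match_leftover:
  assumes "finite Z" "\<And>x. x \<in> Z \<Longrightarrow> 0 \<le> a x" "\<And>x. x \<in> Z \<Longrightarrow> 0 \<le> b x" "sum a Z = sum b Z"
  shows "(\<Sum>x\<in>Z. a x - (\<Sum>y\<in>Z. cell_match Z f a b x y)) = tv Z f a b"
proof -
  let ?A = "mass Z f a" and ?B = "mass Z f b"
  have "(\<Sum>x\<in>Z. a x - (\<Sum>y\<in>Z. cell_match Z f a b x y)) =
      (\<Sum>x\<in>Z. a x * (1 - ?B (f x) / max (?A (f x)) (?B (f x))))"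
    unfolding cell_match_row by (simp add: algebra_simps)
  also have "\<dots> = (\<Sum>c\<in>f ` Z. ?A c * (1 - ?B c / max (?A c) (?B c)))"
    by (rule sum_mass[OF assms(1), symmetric])
  also have "\<dots> = (\<Sum>c\<in>f ` Z. (\<bar>?A c - ?B c\<bar> + ?A c * 1 - ?B c * 1) / 2)"
  proof (rule sum.cong[OF refl])
    fix c
    have "0 \<le> ?A c" "0 \<le> ?B c"
      using assms by (auto intro: mass_nonneg)
    then show "?A c * (1 - ?B c / max (?A c) (?B c)) = (\<bar>?A c - ?B c\<bar> + ?A c * 1 - ?B c * 1) / 2"
      by (cases "?A c = 0") (auto simp: max_def field_simps abs_if)
  qed
  also have "\<dots> = tv Z f a b + (\<Sum>c\<in>f ` Z. ?A c * 1) / 2 - (\<Sum>c\<in>f ` Z. ?B c * 1) / 2"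
    unfolding tv_def sum_divide_distrib sum.distrib[symmetric] sum_subtractf[symmetric]
    by (rule sum.cong) (auto simp: field_simps)
  also have "\<dots> = tv Z f a b"
    unfolding sum_mass[OF assms(1)] using assms(4) by simp
  finally show ?thesis .
qed

text \<open>Match inside the cells of the finest level and recurse on the leftovers one level up.
  The leftovers are no longer distributions, hence the formulation for nonnegative functions of
  equal total.\<close>

lemma tree_matching:
  fixes f :: "nat \<Rightarrow> 'z \<Rightarrow> 'c" and dst :: "'z \<Rightarrow> 'z \<Rightarrow> real"
  assumes fin: "finite Z"
    and nested: "\<And>j l x y. x \<in> Z \<Longrightarrow> y \<in> Z \<Longrightarrow> j \<le> l \<Longrightarrow> f l x = f l y \<Longrightarrow> f j x = f j y"
    and dst: "\<And>l x y. x \<in> Z \<Longrightarrow> y \<in> Z \<Longrightarrow> f l x = f l y \<Longrightarrow> dst x y \<le> 1 / 2 ^ l"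
    and dst_le_1: "\<And>x y. x \<in> Z \<Longrightarrow> y \<in> Z \<Longrightarrow> dst x y \<le> 1"
  shows "(\<And>x. x \<in> Z \<Longrightarrow> 0 \<le> a x) \<Longrightarrow> (\<And>x. x \<in> Z \<Longrightarrow> 0 \<le> b x) \<Longrightarrow> sum a Z = sum b Z \<Longrightarrow>
    \<exists>M. (\<forall>x\<in>Z. \<forall>y\<in>Z. 0 \<le> M x y) \<and> (\<forall>x\<in>Z. (\<Sum>y\<in>Z. M x y) = a x) \<and> (\<forall>y\<in>Z. (\<Sum>x\<in>Z. M x y) = b y) \<and>
      (\<Sum>x\<in>Z. \<Sum>y\<in>Z. M x y * dst x y) \<le> sum a Z / 2 ^ l + (\<Sum>j<l. tv Z (f (Suc j)) a b / 2 ^ j)"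
proof (induction l arbitrary: a b)
  case (0 a b)
  \<comment> \<open>Product matching, at distance at most 1. For total 0 the division by 0 yields
    the zero matrix, which is then the right one.\<close>
  define M where "M x y = a x * b y / sum a Z" for x y
  have zero: "a x = 0" "b x = 0" if "sum a Z = 0" "x \<in> Z" for x
  proof -
    show "a x = 0"
      using that sum_nonneg_eq_0_iff[OF fin, of a] 0(1) by auto
    show "b x = 0"
      using that sum_nonneg_eq_0_iff[OF fin, of b] 0(2,3) by auto
  qed
  have M_nonneg: "0 \<le> M x y" if "x \<in> Z" "y \<in> Z" for x y
    unfolding M_def using 0 that by (auto intro!: divide_nonneg_nonneg sum_nonneg)
  have row: "(\<Sum>y\<in>Z. M x y) = a x" if "x \<in> Z" for x
    using zero[OF _ that] 0(3)
    by (cases "sum a Z = 0") (simp_all add: M_def sum_distrib_left[symmetric] sum_divide_distrib[symmetric])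
  have col: "(\<Sum>x\<in>Z. M x y) = b y" if "y \<in> Z" for y
    using zero[OF _ that]
    by (cases "sum a Z = 0") (simp_all add: M_def sum_distrib_right[symmetric] sum_divide_distrib[symmetric])
  have "(\<Sum>x\<in>Z. \<Sum>y\<in>Z. M x y * dst x y) \<le> (\<Sum>x\<in>Z. \<Sum>y\<in>Z. M x y * 1)"
    using M_nonneg dst_le_1 by (intro sum_mono mult_left_mono) auto
  also have "\<dots> = sum a Z"
    by (simp add: row)
  finally show ?case
    using M_nonneg row col by (intro exI[of _ M]) auto
next
  case (Suc l a b)
  let ?f = "f (Suc l)"
  let ?m = "cell_match Z ?f a b"
  define a' where "a' x = a x - (\<Sum>y\<in>Z. ?m x y)" for x
  define b' where "b' y = b y - (\<Sum>x\<in>Z. ?m x y)" for y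
  have A_nonneg: "0 \<le> mass Z ?f a c" and B_nonneg: "0 \<le> mass Z ?f b c" for c
    using Suc by (auto intro: mass_nonneg)
  have m_nonneg: "0 \<le> ?m x y" if "x \<in> Z" "y \<in> Z" for x y
    unfolding cell_match_def using Suc.prems that A_nonneg
    by (auto intro!: mult_nonneg_nonneg divide_nonneg_nonneg simp: le_max_iff_disj)
  have ratio: "u / max v u \<le> 1" "u / max u v \<le> 1" if "0 \<le> u" "0 \<le> v" for u v :: real
    using that by (auto simp: divide_le_eq max_def)
  have a'_nonneg: "0 \<le> a' x" if "x \<in> Z" for x
  proof -
    have "a x * (mass Z ?f b (?f x) / max (mass Z ?f a (?f x)) (mass Z ?f b (?f x))) \<le> a x * 1"
      using Suc.prems that A_nonneg B_nonneg by (intro mult_left_mono ratio) auto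
    then show ?thesis
      unfolding a'_def cell_match_row by simp
  qed
  have b'_nonneg: "0 \<le> b' y" if "y \<in> Z" for y
  proof -
    have "b y * (mass Z ?f a (?f y) / max (mass Z ?f b (?f y)) (mass Z ?f a (?f y))) \<le> b y * 1"
      using Suc.prems that A_nonneg B_nonneg by (intro mult_left_mono ratio) auto
    then show ?thesis
      unfolding b'_def cell_match_commute[of Z ?f a b] cell_match_row by simp
  qed
  \<comment> \<open>A matched pair shares its cell at level \<open>Suc l\<close> and so at every
    coarser level, where matching therefore removes equal mass from both sides.\<close>
  have diff: "mass Z (f j) a' d - mass Z (f j) b' d = mass Z (f j) a d - mass Z (f j) b d" if "j \<le> Suc l" for j d
  proof -
    have "(\<Sum>x\<in>Z. of_bool (f j x = d) * (\<Sum>y\<in>Z. ?m x y)) = (\<Sum>x\<in>Z. \<Sum>y\<in>Z. of_bool (f j y = d) * ?m x y)"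
      unfolding sum_distrib_left
    proof (intro sum.cong refl)
      fix x y assume xy: "x \<in> Z" "y \<in> Z"
      show "of_bool (f j x = d) * ?m x y = of_bool (f j y = d) * ?m x y"
      proof (cases "?f x = ?f y")
        case True
        then show ?thesis
          using nested[OF xy that True] by simp
      next
        case False
        then show ?thesis
          by (simp add: cell_match_def)
      qed
    qed
    also have "\<dots> = (\<Sum>y\<in>Z. of_bool (f j y = d) * (\<Sum>x\<in>Z. ?m x y))"
      unfolding sum_distrib_left by (rule sum.swap)
    finally show ?thesis
      unfolding mass_def a'_def b'_def by (simp add: right_diff_distrib sum_subtractf)
  qed
  have left: "sum a' Z = tv Z ?f a b"
    unfolding a'_def using fin Suc.prems by (rule cell_match_leftover)
  have sums: "sum a' Z = sum b' Z"
  proof -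
    have "(\<Sum>x\<in>Z. \<Sum>y\<in>Z. ?m x y) = (\<Sum>y\<in>Z. \<Sum>x\<in>Z. ?m x y)"
      by (rule sum.swap)
    then show ?thesis
      unfolding a'_def b'_def sum_subtractf using Suc.prems(3) by simp
  qed
  have tv_eq: "tv Z (f j) a' b' = tv Z (f j) a b" if "j \<le> Suc l" for j
    unfolding tv_def diff[OF that] ..
  obtain M where M: "\<And>x y. x \<in> Z \<Longrightarrow> y \<in> Z \<Longrightarrow> 0 \<le> M x y"
    "\<And>x. x \<in> Z \<Longrightarrow> (\<Sum>y\<in>Z. M x y) = a' x" "\<And>y. y \<in> Z \<Longrightarrow> (\<Sum>x\<in>Z. M x y) = b' y"
    "(\<Sum>x\<in>Z. \<Sum>y\<in>Z. M x y * dst x y) \<le> sum a' Z / 2 ^ l + (\<Sum>j<l. tv Z (f (Suc j)) a' b' / 2 ^ j)"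
    using Suc.IH[of a' b', OF a'_nonneg b'_nonneg sums] by blast
  define M' where "M' x y = ?m x y + M x y" for x y
  have "(\<Sum>x\<in>Z. \<Sum>y\<in>Z. ?m x y * dst x y) \<le> (\<Sum>x\<in>Z. \<Sum>y\<in>Z. ?m x y * (1 / 2 ^ Suc l))"
  proof (intro sum_mono)
    fix x y assume xy: "x \<in> Z" "y \<in> Z"
    show "?m x y * dst x y \<le> ?m x y * (1 / 2 ^ Suc l)"
    proof (cases "?f x = ?f y")
      case True
      then show ?thesis
        by (intro mult_left_mono m_nonneg dst xy)
    next
      case False
      then show ?thesis
        by (simp add: cell_match_def)
    qed
  qed
  also have "\<dots> = (\<Sum>x\<in>Z. a x - a' x) / 2 ^ Suc l"
    by (simp add: a'_def sum_distrib_right[symmetric] sum_divide_distrib[symmetric])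
  also have "\<dots> \<le> sum a Z / 2 ^ Suc l"
    using a'_nonneg by (intro divide_right_mono sum_mono) auto
  finally have "(\<Sum>x\<in>Z. \<Sum>y\<in>Z. ?m x y * dst x y) \<le> sum a Z / 2 ^ Suc l" .
  moreover have "(\<Sum>x\<in>Z. \<Sum>y\<in>Z. M' x y * dst x y) =
      (\<Sum>x\<in>Z. \<Sum>y\<in>Z. ?m x y * dst x y) + (\<Sum>x\<in>Z. \<Sum>y\<in>Z. M x y * dst x y)"
    by (simp add: M'_def distrib_right sum.distrib)
  \<comment> \<open>The leftover total is the total variation at level \<open>Suc l\<close>, so its
    coarse cost is exactly the new last summand.\<close>
  moreover have "sum a' Z / 2 ^ l + (\<Sum>j<l. tv Z (f (Suc j)) a' b' / 2 ^ j) =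
      (\<Sum>j<Suc l. tv Z (f (Suc j)) a b / 2 ^ j)"
    by (simp add: left tv_eq)
  ultimately have "(\<Sum>x\<in>Z. \<Sum>y\<in>Z. M' x y * dst x y) \<le>
      sum a Z / 2 ^ Suc l + (\<Sum>j<Suc l. tv Z (f (Suc j)) a b / 2 ^ j)"
    using M(4) by linarith
  moreover have "(\<Sum>y\<in>Z. M' x y) = a x" if "x \<in> Z" for x
    using M(2)[OF that] by (simp add: M'_def sum.distrib a'_def)
  moreover have "(\<Sum>x\<in>Z. M' x y) = b y" if "y \<in> Z" for y
    using M(3)[OF that] by (simp add: M'_def sum.distrib b'_def)
  ultimately show ?case
    using M(1) m_nonneg by (intro exI[of _ M']) (auto simp: M'_def)
qed

section \<open>From transport matrices to the earth mover distance\<close>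

lemma coupling_of_matrix:
  assumes fin: "finite Z" and p: "set_pmf p \<subseteq> Z" and q: "set_pmf q \<subseteq> Z"
    and M: "\<And>x y. x \<in> Z \<Longrightarrow> y \<in> Z \<Longrightarrow> 0 \<le> M x y"
    "\<And>x. x \<in> Z \<Longrightarrow> (\<Sum>y\<in>Z. M x y) = pmf p x" "\<And>y. y \<in> Z \<Longrightarrow> (\<Sum>x\<in>Z. M x y) = pmf q y"
  shows "\<exists>\<pi>\<in>couplings p q. set_pmf \<pi> \<subseteq> Z \<times> Z \<and>
    (\<forall>h. expect \<pi> (\<lambda>(x, y). h x y) = (\<Sum>x\<in>Z. \<Sum>y\<in>Z. M x y * h x y))"
proof -
  define g where "g = (\<lambda>z. if z \<in> Z \<times> Z then M (fst z) (snd z) else 0)"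
  define \<pi> where "\<pi> = embed_pmf g"
  have g_nonneg: "0 \<le> g z" for z
    using M(1) by (auto simp: g_def)
  have total: "(\<Sum>x\<in>Z. pmf p x) = 1"
    by (rule sum_pmf_eq_1[OF fin p])
  have "(\<integral>\<^sup>+z. ennreal (g z) \<partial>count_space UNIV) = (\<Sum>z\<in>Z \<times> Z. ennreal (g z))"
    using fin by (intro nn_integral_count_space'[of "Z \<times> Z"]) (auto simp: g_def)
  also have "\<dots> = ennreal (\<Sum>z\<in>Z \<times> Z. g z)"
    by (rule sum_ennreal) (rule g_nonneg)
  also have "(\<Sum>z\<in>Z \<times> Z. g z) = (\<Sum>x\<in>Z. \<Sum>y\<in>Z. M x y)"
    unfolding sum.cartesian_product by (intro sum.cong) (auto simp: g_def)
  also have "\<dots> = 1"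
    using total by (simp add: M(2))
  finally have pmf_\<pi>: "pmf \<pi> z = g z" for z
    unfolding \<pi>_def using g_nonneg by (intro pmf_embed_pmf) auto
  have set_\<pi>: "set_pmf \<pi> \<subseteq> Z \<times> Z"
    by (auto simp: set_pmf_iff pmf_\<pi> g_def split: if_splits)
  have ex: "expect \<pi> (\<lambda>(x, y). h x y) = (\<Sum>x\<in>Z. \<Sum>y\<in>Z. M x y * h x y)" for h
  proof -
    have "expect \<pi> (\<lambda>(x, y). h x y) = (\<Sum>z\<in>Z \<times> Z. (case z of (x, y) \<Rightarrow> h x y) * pmf \<pi> z)"
      using fin set_\<pi> by (intro integral_measure_pmf_real) auto
    also have "\<dots> = (\<Sum>x\<in>Z. \<Sum>y\<in>Z. M x y * h x y)"
      unfolding sum.cartesian_product by (intro sum.cong) (auto simp: pmf_\<pi> g_def)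
    finally show ?thesis .
  qed
  have ind: "measure_pmf.prob \<pi> {z. S (fst z) (snd z)} = (\<Sum>x\<in>Z. \<Sum>y\<in>Z. M x y * of_bool (S x y))" for S
  proof -
    have "measure_pmf.prob \<pi> {z. S (fst z) (snd z)} = expect \<pi> (\<lambda>(x, y). of_bool (S x y))"
      unfolding prob_eq_expect by (rule expect_cong) (auto simp: indicator_def)
    then show ?thesis
      unfolding ex .
  qed
  have "map_pmf fst \<pi> = p"
  proof (rule pmf_eqI)
    fix x
    have "pmf (map_pmf fst \<pi>) x = measure_pmf.prob \<pi> {z. fst z = x}"
      by (simp add: pmf_map vimage_def)
    also have "\<dots> = (\<Sum>x'\<in>Z. \<Sum>y\<in>Z. M x' y * of_bool (x' = x))"
      by (rule ind[of "\<lambda>x' y. x' = x"])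
    also have "\<dots> = (\<Sum>x'\<in>Z. if x' = x then pmf p x' else 0)"
      by (intro sum.cong) (auto simp: M(2))
    also have "\<dots> = pmf p x"
      using fin p by (auto simp: pmf_eq_0_set_pmf)
    finally show "pmf (map_pmf fst \<pi>) x = pmf p x" .
  qed
  moreover have "map_pmf snd \<pi> = q"
  proof (rule pmf_eqI)
    fix y
    have "pmf (map_pmf snd \<pi>) y = measure_pmf.prob \<pi> {z. snd z = y}"
      by (simp add: pmf_map vimage_def)
    also have "\<dots> = (\<Sum>y'\<in>Z. \<Sum>x\<in>Z. M x y' * of_bool (y' = y))"
      by (subst sum.swap) (rule ind[of "\<lambda>x y'. y' = y"])
    also have "\<dots> = (\<Sum>y'\<in>Z. if y' = y then pmf q y' else 0)"
      by (intro sum.cong) (auto simp: M(3))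
    also have "\<dots> = pmf q y"
      using fin q by (auto simp: pmf_eq_0_set_pmf)
    finally show "pmf (map_pmf snd \<pi>) y = pmf q y" .
  qed
  ultimately show ?thesis
    using set_\<pi> ex by (intro bexI[of _ \<pi>]) (auto simp: couplings_def)
qed

lemma EMD_le_expect:
  assumes "\<pi> \<in> couplings p q" "\<And>x y. 0 \<le> dst x y"
  shows "EMD dst p q \<le> expect \<pi> (\<lambda>(x, y). dst x y)"
  unfolding EMD_def
  using assms by (intro cINF_lower bdd_belowI2[where m = 0] expect_nonneg) auto

text \<open>A pair \<open>(x, x')\<close> consists of a point and the point that represents it in the test;
  working with pairs avoids gluing couplings.\<close>

lemma EMD_tree_bound:
  fixes f :: "nat \<Rightarrow> 'a \<Rightarrow> 'c" and dst :: "'a \<Rightarrow> 'a \<Rightarrow> real"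
  assumes fin: "finite X"
    and nested: "\<And>j l x y. x \<in> X \<Longrightarrow> y \<in> X \<Longrightarrow> j \<le> l \<Longrightarrow> f l x = f l y \<Longrightarrow> f j x = f j y"
    and dst: "\<And>l x y. x \<in> X \<Longrightarrow> y \<in> X \<Longrightarrow> f l x = f l y \<Longrightarrow> dst x y \<le> 1 / 2 ^ l"
    and dst_le_1: "\<And>x y. x \<in> X \<Longrightarrow> y \<in> X \<Longrightarrow> dst x y \<le> 1"
    and dst_nonneg: "\<And>x y. 0 \<le> dst x y" and dst_sym: "\<And>x y. dst x y = dst y x"
    and dst_tri: "\<And>x y z. dst x z \<le> dst x y + dst y z"
    and P: "set_pmf P \<subseteq> X \<times> X" and Q: "set_pmf Q \<subseteq> X \<times> X"
    and I: "\<And>l. finite (I l)" "\<And>l. f l ` X \<subseteq> I l"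
    and close: "\<And>l. l \<in> {1..L} \<Longrightarrow> (\<Sum>c\<in>I l. \<bar>measure_pmf.prob (map_pmf snd P) {x. f l x = c} -
      measure_pmf.prob (map_pmf snd Q) {x. f l x = c}\<bar>) \<le> \<delta> l"
  shows "EMD dst (map_pmf fst P) (map_pmf fst Q) \<le>
    expect P (\<lambda>(x, y). dst x y) + expect Q (\<lambda>(x, y). dst x y) + (1 / 2 ^ L + (\<Sum>j<L. \<delta> (Suc j) / 2 / 2 ^ j))"
proof -
  let ?Z = "X \<times> X"
  have finZ: "finite ?Z"
    using fin by simp
  have total: "sum (pmf P) ?Z = 1" "sum (pmf Q) ?Z = 1"
    using finZ P Q by (simp_all add: sum_pmf_eq_1)
  have "\<exists>M. (\<forall>x\<in>?Z. \<forall>y\<in>?Z. 0 \<le> M x y) \<and> (\<forall>x\<in>?Z. (\<Sum>y\<in>?Z. M x y) = pmf P x) \<and>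
      (\<forall>y\<in>?Z. (\<Sum>x\<in>?Z. M x y) = pmf Q y) \<and>
      (\<Sum>x\<in>?Z. \<Sum>y\<in>?Z. M x y * dst (snd x) (snd y)) \<le>
        sum (pmf P) ?Z / 2 ^ L + (\<Sum>j<L. tv ?Z (\<lambda>z. f (Suc j) (snd z)) (pmf P) (pmf Q) / 2 ^ j)"
  \<comment> \<open>The cells see second components only: representing points are matched, while the
    marginals still carry the original points.\<close>
  proof (rule tree_matching[where f = "\<lambda>l z. f l (snd z)"])
    fix j l x y assume "x \<in> ?Z" "y \<in> ?Z" "j \<le> l" "f l (snd x) = f l (snd y)"
    then show "f j (snd x) = f j (snd y)"
      using nested[of "snd x" "snd y" j l] by (simp add: mem_Times_iff)
  qed (use finZ dst dst_le_1 total in \<open>simp_all add: mem_Times_iff\<close>)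
  then obtain M where nonneg: "\<forall>x\<in>?Z. \<forall>y\<in>?Z. 0 \<le> M x y"
    and rows: "\<forall>x\<in>?Z. (\<Sum>y\<in>?Z. M x y) = pmf P x"
    and cols: "\<forall>y\<in>?Z. (\<Sum>x\<in>?Z. M x y) = pmf Q y"
    and cost: "(\<Sum>x\<in>?Z. \<Sum>y\<in>?Z. M x y * dst (snd x) (snd y)) \<le>
      sum (pmf P) ?Z / 2 ^ L + (\<Sum>j<L. tv ?Z (\<lambda>z. f (Suc j) (snd z)) (pmf P) (pmf Q) / 2 ^ j)"
    by (elim exE conjE) (rule that)
  note M = nonneg[rule_format] rows[rule_format] cols[rule_format] cost
  obtain \<pi> where \<pi>: "\<pi> \<in> couplings P Q" "set_pmf \<pi> \<subseteq> ?Z \<times> ?Z"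
    "\<And>h. expect \<pi> (\<lambda>(x, y). h x y) = (\<Sum>x\<in>?Z. \<Sum>y\<in>?Z. M x y * h x y)"
    using coupling_of_matrix[OF finZ P Q M(1-3)] by blast
  have fin_\<pi>: "finite (set_pmf \<pi>)"
    using finite_subset[OF \<pi>(2)] finZ by simp
  have mass: "mass ?Z g (pmf R) c = measure_pmf.prob R {z. g z = c}" if "set_pmf R \<subseteq> ?Z" for g :: "'a \<times> 'a \<Rightarrow> 'c" and R c
  proof -
    have "measure_pmf.prob R {z. g z = c} = (\<Sum>z\<in>?Z. indicator {z. g z = c} z * pmf R z)"
      unfolding prob_eq_expect using finZ that by (intro integral_measure_pmf_real) auto
    then show ?thesis
      by (simp add: mass_def indicator_def of_bool_def)
  qed
  have tv_le: "tv ?Z (\<lambda>z. f l (snd z)) (pmf P) (pmf Q) \<le> \<delta> l / 2" if "l \<in> {1..L}" for l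
  proof -
    have "(\<Sum>c\<in>(\<lambda>z. f l (snd z)) ` ?Z. \<bar>measure_pmf.prob (map_pmf snd P) {x. f l x = c} -
        measure_pmf.prob (map_pmf snd Q) {x. f l x = c}\<bar>) \<le> (\<Sum>c\<in>I l. \<bar>measure_pmf.prob (map_pmf snd P) {x. f l x = c} -
      measure_pmf.prob (map_pmf snd Q) {x. f l x = c}\<bar>)"
      using I[of l] by (intro sum_mono2) auto
    also have "\<dots> \<le> \<delta> l"
      by (rule close[OF that])
    finally show ?thesis
      unfolding tv_def mass[OF P] mass[OF Q] by (simp add: vimage_def)
  qed
  \<comment> \<open>Forgetting the representing points gives a coupling of the originals, whose cost
    splits by the triangle inequality through both representing points.\<close>
  let ?\<pi>' = "map_pmf (\<lambda>(z, z'). (fst z, fst z')) \<pi>"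
  have "?\<pi>' \<in> couplings (map_pmf fst P) (map_pmf fst Q)"
    using \<pi>(1) unfolding couplings_def by (auto simp: pmf.map_comp o_def case_prod_unfold)
  then have "EMD dst (map_pmf fst P) (map_pmf fst Q) \<le> expect ?\<pi>' (\<lambda>(x, y). dst x y)"
    by (rule EMD_le_expect) (rule dst_nonneg)
  also have "\<dots> = expect \<pi> (\<lambda>z. dst (fst (fst z)) (fst (snd z)))"
    by (simp add: case_prod_unfold)
  also have "\<dots> \<le> expect \<pi> (\<lambda>z. dst (fst (fst z)) (snd (fst z)) + dst (fst (snd z)) (snd (snd z)) +
      dst (snd (fst z)) (snd (snd z)))"
  proof (intro expect_mono fin_\<pi>)
    fix z
    show "dst (fst (fst z)) (fst (snd z)) \<le> dst (fst (fst z)) (snd (fst z)) + dst (fst (snd z)) (snd (snd z)) +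
      dst (snd (fst z)) (snd (snd z))"
      using dst_tri[of "fst (fst z)" "fst (snd z)" "snd (fst z)"] dst_tri[of "snd (fst z)" "fst (snd z)" "snd (snd z)"]
        dst_sym[of "fst (snd z)" "snd (snd z)"] by linarith
  qed
  also have "\<dots> = expect (map_pmf fst \<pi>) (\<lambda>z. dst (fst z) (snd z)) + expect (map_pmf snd \<pi>) (\<lambda>z. dst (fst z) (snd z)) +
      expect \<pi> (\<lambda>(x, y). dst (snd x) (snd y))"
    by (simp add: expect_add fin_\<pi> case_prod_unfold)
  also have "map_pmf fst \<pi> = P"
    using \<pi>(1) by (simp add: couplings_def)
  also have "map_pmf snd \<pi> = Q"
    using \<pi>(1) by (simp add: couplings_def)
  also have "expect \<pi> (\<lambda>(x, y). dst (snd x) (snd y)) \<le> 1 / 2 ^ L + (\<Sum>j<L. \<delta> (Suc j) / 2 / 2 ^ j)"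
  proof -
    have "(\<Sum>j<L. tv ?Z (\<lambda>z. f (Suc j) (snd z)) (pmf P) (pmf Q) / 2 ^ j) \<le> (\<Sum>j<L. \<delta> (Suc j) / 2 / 2 ^ j)"
      by (intro sum_mono divide_right_mono tv_le) auto
    then show ?thesis
      using M(4) unfolding \<pi>(3) total by linarith
  qed
  finally show ?thesis
    by (simp add: case_prod_unfold)
qed

section \<open>The normalized metric on the grid\<close>

text \<open>For positive arguments this is convexity of the power function. If one argument is 0 it
  becomes \<open>(s * z) powr p \<le> s * z powr p\<close>, which follows from
  \<open>s powr p \<le> s\<close>.\<close>

lemma powr_convex_nonneg:
  fixes p t x y :: real
  assumes "1 \<le> p" "0 \<le> t" "t \<le> 1" "0 \<le> x" "0 \<le> y"
  shows "((1 - t) * x + t * y) powr p \<le> (1 - t) * x powr p + t * y powr p"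
proof -
  have scale: "(s * z) powr p \<le> s * z powr p" if "0 \<le> s" "s \<le> 1" "0 \<le> z" for s z :: real
  proof (cases "s = 0")
    case False
    have "s powr p \<le> s powr 1"
      using that False assms(1) by (intro powr_mono') auto
    then show ?thesis
      using that False by (simp add: powr_mult mult_right_mono)
  qed (use assms(1) in simp)
  consider "x = 0" | "y = 0" | "0 < x" "0 < y"
    using assms by linarith
  then show ?thesis
  proof cases
    case 3
    then show ?thesis
      using convex_onD[OF powr_convex[OF assms(1)], of t x y] assms by simp
  qed (use scale[of t y] scale[of "1 - t" x] assms in auto)
qed

lemma lp_norm_nonneg: "0 \<le> lp_norm p d v"
  by (simp add: lp_norm_def)

lemma lp_norm_powr: "1 \<le> p \<Longrightarrow> lp_norm p d v powr p = (\<Sum>i<d. \<bar>v i\<bar> powr p)"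
  by (simp add: lp_norm_def powr_powr sum_nonneg)

lemma lp_norm_leI:
  assumes "1 \<le> p" "0 \<le> s" "(\<Sum>i<d. \<bar>v i\<bar> powr p) \<le> s powr p"
  shows "lp_norm p d v \<le> s"
proof -
  have "lp_norm p d v \<le> (s powr p) powr (1 / p)"
    unfolding lp_norm_def using assms by (intro powr_mono2) (auto intro: sum_nonneg)
  then show ?thesis
    using assms by (simp add: powr_powr)
qed

lemma lp_norm_eq_0D:
  assumes "1 \<le> p" "lp_norm p d v = 0" "i < d"
  shows "v i = 0"
proof -
  have "(\<Sum>i<d. \<bar>v i\<bar> powr p) = 0"
    using lp_norm_powr[OF assms(1), of d v] assms by simp
  then show ?thesis
    using assms(3) by (subst (asm) sum_nonneg_eq_0_iff) auto
qed

text \<open>Minkowski by convexity: \<open>u + v\<close> is \<open>a + b\<close> times a convex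
  combination, with weight \<open>t = b / (a + b)\<close>, of \<open>u / a\<close> and
  \<open>v / b\<close>, whose sums of p-th powers are 1. Zero norms are split off because of the
  division.\<close>

lemma lp_norm_triangle:
  assumes p: "1 \<le> p"
  shows "lp_norm p d (\<lambda>i. u i + v i) \<le> lp_norm p d u + lp_norm p d v"
proof -
  define a b where "a = lp_norm p d u" and "b = lp_norm p d v"
  have nonneg: "0 \<le> a" "0 \<le> b"
    by (simp_all add: a_def b_def lp_norm_nonneg)
  consider "a = 0" | "b = 0" | "0 < a" "0 < b"
    using nonneg by linarith
  then show ?thesis
  proof cases
    case 1
    then have zero: "u i = 0" if "i < d" for i
      using lp_norm_eq_0D[OF p _ that] by (simp add: a_def)
    have "lp_norm p d (\<lambda>i. u i + v i) = b"
      unfolding lp_norm_def b_def by (intro arg_cong[where f = "\<lambda>s. s powr (1 / p)"] sum.cong) (simp_all add: zero)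
    then show ?thesis
      using nonneg by (simp add: a_def b_def)
  next
    case 2
    then have zero: "v i = 0" if "i < d" for i
      using lp_norm_eq_0D[OF p _ that] by (simp add: b_def)
    have "lp_norm p d (\<lambda>i. u i + v i) = a"
      unfolding lp_norm_def a_def by (intro arg_cong[where f = "\<lambda>s. s powr (1 / p)"] sum.cong) (simp_all add: zero)
    then show ?thesis
      using nonneg by (simp add: a_def b_def)
  next
    case 3
    define t where "t = b / (a + b)"
    have t: "0 \<le> t" "t \<le> 1" "1 - t = a / (a + b)"
      using 3 by (auto simp: t_def field_simps)
    have "(\<Sum>i<d. \<bar>u i + v i\<bar> powr p) \<le>
        (\<Sum>i<d. (a + b) powr p * ((1 - t) * (\<bar>u i\<bar> / a) powr p + t * (\<bar>v i\<bar> / b) powr p))"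
    proof (rule sum_mono)
      fix i
      have "\<bar>u i + v i\<bar> powr p \<le> ((a + b) * ((1 - t) * (\<bar>u i\<bar> / a) + t * (\<bar>v i\<bar> / b))) powr p"
      proof (intro powr_mono2)
        have "(a + b) * ((1 - t) * (\<bar>u i\<bar> / a) + t * (\<bar>v i\<bar> / b)) = \<bar>u i\<bar> + \<bar>v i\<bar>"
        proof -
          have "(a + b) * (1 - t) = a" "(a + b) * t = b"
            unfolding t(3) unfolding t_def using 3 by simp_all
          then show ?thesis
            using 3 by (simp add: distrib_left mult.assoc[symmetric])
        qed
        then show "\<bar>u i + v i\<bar> \<le> (a + b) * ((1 - t) * (\<bar>u i\<bar> / a) + t * (\<bar>v i\<bar> / b))"
          by simp
      qed (use p in auto)
      also have "\<dots> = (a + b) powr p * ((1 - t) * (\<bar>u i\<bar> / a) + t * (\<bar>v i\<bar> / b)) powr p"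
        using t 3 by (intro powr_mult)
      also have "\<dots> \<le> (a + b) powr p * ((1 - t) * (\<bar>u i\<bar> / a) powr p + t * (\<bar>v i\<bar> / b) powr p)"
        using t p 3 by (intro mult_left_mono powr_convex_nonneg) auto
      finally show "\<bar>u i + v i\<bar> powr p \<le> (a + b) powr p * ((1 - t) * (\<bar>u i\<bar> / a) powr p + t * (\<bar>v i\<bar> / b) powr p)" .
    qed
    also have "\<dots> = (a + b) powr p * ((1 - t) * (\<Sum>i<d. (\<bar>u i\<bar> / a) powr p) + t * (\<Sum>i<d. (\<bar>v i\<bar> / b) powr p))"
      by (simp only: sum_distrib_left[symmetric] sum.distrib)
    also have "(\<Sum>i<d. (\<bar>u i\<bar> / a) powr p) = 1"
      using 3 by (simp add: powr_divide sum_divide_distrib[symmetric] lp_norm_powr[OF p, of d u, symmetric] a_def)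
    also have "(\<Sum>i<d. (\<bar>v i\<bar> / b) powr p) = 1"
      using 3 by (simp add: powr_divide sum_divide_distrib[symmetric] lp_norm_powr[OF p, of d v, symmetric] b_def)
    finally have "(\<Sum>i<d. \<bar>u i + v i\<bar> powr p) \<le> (a + b) powr p"
      by simp
    then show ?thesis
      unfolding a_def[symmetric] b_def[symmetric] using p nonneg by (intro lp_norm_leI) auto
  qed
qed

lemma ndist_nonneg: "0 \<le> ndist p n d x y"
  by (simp add: ndist_def lp_norm_nonneg)

lemma ndist_sym: "ndist p n d x y = ndist p n d y x"
  by (simp add: ndist_def lp_norm_def abs_minus_commute)

lemma ndist_triangle:
  assumes "1 \<le> p"
  shows "ndist p n d x z \<le> ndist p n d x y + ndist p n d y z"
  using lp_norm_triangle[OF assms, of d "\<lambda>i. real (x i) - real (y i)" "\<lambda>i. real (y i) - real (z i)"]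
  unfolding ndist_def add_divide_distrib[symmetric] by (intro divide_right_mono) auto

text \<open>The normalization by \<open>d powr (1 / p)\<close> cancels the sum over the coordinates,
  so coordinatewise bounds transfer with no dependence on \<open>d\<close> or
  \<open>p\<close>.\<close>

lemma ndist_leI:
  assumes "1 \<le> p" "1 \<le> n" "1 \<le> d" "0 \<le> r" and le: "\<And>i. i < d \<Longrightarrow> \<bar>real (x i) - real (y i)\<bar> \<le> r * real n"
  shows "ndist p n d x y \<le> r"
proof -
  have "lp_norm p d (\<lambda>i. real (x i) - real (y i)) \<le> real d powr (1 / p) * (r * real n)"
  proof (rule lp_norm_leI[OF assms(1)])
    have "(\<Sum>i<d. \<bar>real (x i) - real (y i)\<bar> powr p) \<le> (\<Sum>i<d. (r * real n) powr p)"
      using assms by (intro sum_mono powr_mono2) auto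
    also have "\<dots> = (real d powr (1 / p) * (r * real n)) powr p"
      using assms by (simp add: powr_mult powr_powr)
    finally show "(\<Sum>i<d. \<bar>real (x i) - real (y i)\<bar> powr p) \<le> (real d powr (1 / p) * (r * real n)) powr p" .
  qed (use assms in auto)
  then show ?thesis
    unfolding ndist_def using assms by (simp add: divide_le_eq mult_ac)
qed

lemma finite_grid: "finite (grid n d)"
  unfolding grid_def by (intro finite_PiE) auto

lemma gridD:
  assumes "x \<in> grid n d" "i < d"
  shows "1 \<le> x i" "x i \<le> n"
  using PiE_mem[of x "{..<d}" "\<lambda>_. {1..n}" i] assms by (simp_all add: grid_def)

lemma ndist_grid_le_1:
  assumes "1 \<le> p" "1 \<le> n" "1 \<le> d" "x \<in> grid n d" "y \<in> grid n d"
  shows "ndist p n d x y \<le> 1"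
proof (rule ndist_leI[OF assms(1-3)])
  fix i assume "i < d"
  then show "\<bar>real (x i) - real (y i)\<bar> \<le> 1 * real n"
    using gridD[OF assms(4), of i] gridD[OF assms(5), of i] by (simp add: abs_if)
qed simp

text \<open>Scaling by \<open>2 ^ l\<close> before dividing by \<open>n\<close> cuts
  \<open>[n]\<close> into nearly equal intervals for every \<open>n\<close>, power of two or not;
  some may be empty.\<close>

definition subcube :: "nat \<Rightarrow> nat \<Rightarrow> nat \<Rightarrow> (nat \<Rightarrow> nat) \<Rightarrow> nat \<Rightarrow> nat" where
  "subcube n d l x = restrict (\<lambda>i. ((x i - 1) * 2 ^ l) div n) {..<d}"

definition subcubes :: "nat \<Rightarrow> nat \<Rightarrow> (nat \<Rightarrow> nat) set" where
  "subcubes d l = {..<d} \<rightarrow>\<^sub>E {..<2 ^ l}"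

lemma finite_subcubes: "finite (subcubes d l)"
  unfolding subcubes_def by (intro finite_PiE) auto

lemma card_subcubes: "card (subcubes d l) = 2 ^ (l * d)"
  by (simp add: subcubes_def card_PiE power_mult)

lemma subcube_in:
  assumes "1 \<le> n"
  shows "subcube n d l ` grid n d \<subseteq> subcubes d l"
proof safe
  fix x assume x: "x \<in> grid n d"
  have "((x i - 1) * 2 ^ l) div n < 2 ^ l" if "i < d" for i
  proof -
    have "(x i - 1) * 2 ^ l < n * 2 ^ l"
      using gridD[OF x that] by (intro mult_strict_right_mono) auto
    then show ?thesis
      by (simp add: less_mult_imp_div_less mult.commute)
  qed
  then show "subcube n d l x \<in> subcubes d l"
    by (auto simp: subcube_def subcubes_def)
qed

text \<open>Rounding down in two steps agrees with rounding down once, so the coarse index is a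
  function of the fine one.\<close>

lemma subcube_nested:
  assumes "j \<le> l" "subcube n d l x = subcube n d l y"
  shows "subcube n d j x = subcube n d j y"
proof -
  have coarse: "(v * 2 ^ j) div n = ((v * 2 ^ l) div n) div 2 ^ (l - j)" for v
  proof -
    have "v * 2 ^ l = (v * 2 ^ j) * 2 ^ (l - j)"
      using assms(1) by (simp add: power_add[symmetric])
    then have "((v * 2 ^ l) div n) div 2 ^ (l - j) = ((v * 2 ^ j) * 2 ^ (l - j)) div (n * 2 ^ (l - j))"
      by (simp only: div_mult2_eq[symmetric])
    then show ?thesis
      by simp
  qed
  have "((x i - 1) * 2 ^ l) div n = ((y i - 1) * 2 ^ l) div n" if "i < d" for i
    using fun_cong[OF assms(2), of i] that by (simp add: subcube_def)
  then show ?thesis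
    unfolding subcube_def coarse by (auto simp: restrict_def)
qed

lemma subcube_diam:
  assumes "1 \<le> p" "1 \<le> n" "1 \<le> d" "x \<in> grid n d" "y \<in> grid n d"
    and eq: "subcube n d l x = subcube n d l y"
  shows "ndist p n d x y \<le> 1 / 2 ^ l"
proof (rule ndist_leI[OF assms(1-3)])
  fix i assume i: "i < d"
  define u v where "u = x i - 1" and "v = y i - 1"
  have uv: "real (x i) - real (y i) = real u - real v"
    using gridD[OF assms(4) i] gridD[OF assms(5) i] by (simp add: u_def v_def of_nat_diff)
  have "(u * 2 ^ l) div n = (v * 2 ^ l) div n" (is "?q = _")
    using fun_cong[OF eq, of i] i by (simp add: subcube_def u_def v_def)
  then have "u * 2 ^ l = ?q * n + (u * 2 ^ l) mod n" "v * 2 ^ l = ?q * n + (v * 2 ^ l) mod n"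
    by (metis div_mult_mod_eq)+
  moreover have "(u * 2 ^ l) mod n < n" "(v * 2 ^ l) mod n < n"
    using assms(2) by simp_all
  ultimately have "u * 2 ^ l < v * 2 ^ l + n" "v * 2 ^ l < u * 2 ^ l + n"
    by linarith+
  then have "real (u * 2 ^ l) < real (v * 2 ^ l + n)" "real (v * 2 ^ l) < real (u * 2 ^ l + n)"
    by (simp_all only: of_nat_less_iff)
  then have "(real u - real v) * 2 ^ l \<le> real n" "(real v - real u) * 2 ^ l \<le> real n"
    by (simp_all add: algebra_simps)
  then show "\<bar>real (x i) - real (y i)\<bar> \<le> 1 / 2 ^ l * real n"
    unfolding uv by (auto simp: abs_if field_simps)
qed simp

section \<open>Algorithms and learning of box cells\<close>

text \<open>Algorithms are composed in continuation-passing style: a step with results of type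
  \<open>'b\<close> maps a continuation to an algorithm.\<close>

type_synonym ('i, 'a, 'b) step = "('b \<Rightarrow> ('i, 'a) algo) \<Rightarrow> ('i, 'a) algo"

definition draws :: "('i \<Rightarrow> 'a pmf) \<Rightarrow> ('a \<Rightarrow> 'a) \<Rightarrow> ('i, 'a, 'b) step \<Rightarrow> 'b pmf \<Rightarrow> bool" where
  "draws smp lab c D \<longleftrightarrow> (\<forall>g. run smp lab (c g) = bind_pmf D (\<lambda>b. run smp lab (g b)))"

text \<open>\<open>B\<close> confines the results: budgets are guaranteed only for oracle answers
  inside the domain, so continuations are charged only on possible results.\<close>

definition costs :: "'a set \<Rightarrow> ('i, 'a, 'b) step \<Rightarrow> 'b set \<Rightarrow> nat \<Rightarrow> nat \<Rightarrow> bool" where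
  "costs X c B s q \<longleftrightarrow> (\<forall>g s' q'. (\<forall>b\<in>B. uses_at_most X (g b) s' q') \<longrightarrow> uses_at_most X (c g) (s + s') (q + q'))"

primrec repeat_step :: "nat \<Rightarrow> ('i, 'a, 'b) step \<Rightarrow> ('i, 'a, 'b list) step" where
  "repeat_step 0 c g = g []"
| "repeat_step (Suc m) c g = c (\<lambda>b. repeat_step m c (\<lambda>bs. g (b # bs)))"

text \<open>\<open>Random\<close> yields natural numbers, so a distribution on \<open>X\<close>
  passes through an enumeration of \<open>X\<close> and back.\<close>

definition rand_step :: "'a set \<Rightarrow> 'a pmf \<Rightarrow> ('i, 'a, 'a) step" where
  "rand_step X D g = Random (map_pmf (to_nat_on X) D) (\<lambda>k. g (from_nat_into X k))"

section \<open>Composition rules for output laws and budgets\<close>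

lemma drawsD: "draws smp lab c D \<Longrightarrow> run smp lab (c g) = bind_pmf D (\<lambda>b. run smp lab (g b))"
  by (simp add: draws_def)

lemma costsD:
  "costs X c B s q \<Longrightarrow> (\<And>b. b \<in> B \<Longrightarrow> uses_at_most X (g b) s' q') \<Longrightarrow> uses_at_most X (c g) (s + s') (q + q')"
  by (simp add: costs_def)

lemma uses_at_most_mono:
  "uses_at_most X T s q \<Longrightarrow> s \<le> s' \<Longrightarrow> q \<le> q' \<Longrightarrow> uses_at_most X T s' q'"
proof (induction T arbitrary: s q s' q')
  case (Sample i f)
  then show ?case
    by (auto intro: Sample.IH[of _ "s - 1" q])
next
  case (Query x f)
  then show ?case
    by (auto intro: Query.IH[of _ s "q - 1"])
next
  case (Random P f)
  then show ?case
    by (auto intro: Random.IH[of _ s q])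
qed simp

lemma costs_Sample: "costs X (Sample i) X 1 0"
  by (simp add: costs_def)

lemma draws_rand_step:
  assumes "finite X" "set_pmf D \<subseteq> X"
  shows "draws smp lab (rand_step X D) D"
  unfolding draws_def rand_step_def
  using assms by (auto simp: bind_map_pmf countable_finite intro!: bind_pmf_cong)

lemma costs_rand_step: "X \<noteq> {} \<Longrightarrow> costs X (rand_step X D) X 0 0"
  by (simp add: costs_def rand_step_def from_nat_into)

lemma draws_repeat_step:
  assumes "draws smp lab c D"
  shows "draws smp lab (repeat_step m c) (replicate_pmf m D)"
proof (induction m)
  case (Suc m)
  show ?case
    unfolding draws_def
    by (simp add: drawsD[OF assms] drawsD[OF Suc] bind_assoc_pmf bind_return_pmf)
qed (simp add: draws_def bind_return_pmf)

lemma costs_repeat_step: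
  fixes c :: "('i, 'a, 'b) step"
  assumes "costs X c B s q"
  shows "costs X (repeat_step m c) (lists B) (m * s) (m * q)"
proof (induction m)
  case (Suc m)
  show ?case
    unfolding costs_def
  proof (intro allI impI)
    fix g :: "'b list \<Rightarrow> ('i, 'a) algo" and s' q'
    assume g: "\<forall>bs\<in>lists B. uses_at_most X (g bs) s' q'"
    have "uses_at_most X (c (\<lambda>b. repeat_step m c (\<lambda>bs. g (b # bs)))) (s + (m * s + s')) (q + (m * q + q'))"
      by (intro costsD[OF assms] costsD[OF Suc]) (use g in auto)
    then show "uses_at_most X (repeat_step (Suc m) c g) (Suc m * s + s') (Suc m * q + q')"
      by (simp add: add.assoc)
  qed
qed (simp add: costs_def)

text \<open>In the intended use \<open>hi\<close> always has label \<open>r\<close>, so it is the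
  answer once the interval is a single point. The fuel \<open>t\<close> makes the recursion
  structural and bounds the queries.\<close>

primrec bsearch :: "nat \<Rightarrow> (nat \<Rightarrow> 'a) \<Rightarrow> 'a \<Rightarrow> nat \<Rightarrow> nat \<Rightarrow> ('i, 'a, nat) step" where
  "bsearch 0 pt r lo hi g = g hi"
| "bsearch (Suc t) pt r lo hi g =
    (if hi \<le> lo then g hi
     else Query (pt ((lo + hi) div 2)) (\<lambda>y.
       if y = r then bsearch t pt r lo ((lo + hi) div 2) g else bsearch t pt r (Suc ((lo + hi) div 2)) hi g))"

lemma run_bsearch:
  assumes "lo \<le> v" "v \<le> hi" "hi - lo < 2 ^ t"
    and "\<And>a. lo \<le> a \<Longrightarrow> a \<le> hi \<Longrightarrow> lab (pt a) = r \<longleftrightarrow> v \<le> a"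
  shows "run smp lab (bsearch t pt r lo hi g) = run smp lab (g v)"
  using assms
proof (induction t arbitrary: lo hi)
  case 0
  then have "v = hi"
    by simp
  then show ?case by simp
next
  case (Suc t)
  show ?case
  proof (cases "hi \<le> lo")
    case True
    then have "v = hi"
      using Suc.prems by simp
    with True show ?thesis by simp
  next
    case False
    define mid where "mid = (lo + hi) div 2"
    have mid: "lo \<le> mid" "mid < hi" "mid - lo < 2 ^ t" "hi - Suc mid < 2 ^ t"
      using False Suc.prems(3) by (auto simp: mid_def)
    show ?thesis
    proof (cases "v \<le> mid")
      case True
      then have "lab (pt mid) = r"
        using Suc.prems(4) mid by auto
      moreover have "run smp lab (bsearch t pt r lo mid g) = run smp lab (g v)"
        by (rule Suc.IH) (use True Suc.prems mid in auto)
      ultimately show ?thesis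
        using False by (simp add: mid_def[symmetric])
    next
      case v: False
      then have "lab (pt mid) \<noteq> r"
        using Suc.prems(4) mid by auto
      moreover have "run smp lab (bsearch t pt r (Suc mid) hi g) = run smp lab (g v)"
        by (rule Suc.IH) (use v Suc.prems mid in auto)
      ultimately show ?thesis
        using False by (simp add: mid_def[symmetric])
    qed
  qed
qed

lemma costs_bsearch:
  assumes "1 \<le> lo" "lo \<le> hi" "hi \<le> n" and pt: "\<And>a. 1 \<le> a \<Longrightarrow> a \<le> n \<Longrightarrow> pt a \<in> X"
  shows "costs X (bsearch t pt r lo hi :: ('i, 'a, nat) step) UNIV 0 t"
  using assms(1-3)
proof (induction t arbitrary: lo hi)
  case 0
  then show ?case by (simp add: costs_def)
next
  case (Suc t)
  show ?case
    unfolding costs_def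
  proof (intro allI impI)
    fix g :: "nat \<Rightarrow> ('i, 'a) algo" and s' q'
    assume g: "\<forall>b\<in>UNIV. uses_at_most X (g b) s' q'"
    define mid where "mid = (lo + hi) div 2"
    show "uses_at_most X (bsearch (Suc t) pt r lo hi g) (0 + s') (Suc t + q')"
    proof (cases "hi \<le> lo")
      case True
      then show ?thesis
        using g by (auto intro: uses_at_most_mono[of _ _ s' q'])
    next
      case False
      then have mid: "lo \<le> mid" "mid < hi"
        by (auto simp: mid_def)
      have "uses_at_most X (bsearch t pt r lo mid g) (0 + s') (t + q')"
        "uses_at_most X (bsearch t pt r (Suc mid) hi g) (0 + s') (t + q')"
        by (intro costsD[OF Suc.IH]; use g mid Suc.prems in auto)+
      then show ?thesis
        using False mid Suc.prems pt[of mid] by (simp add: mid_def[symmetric])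
    qed
  qed
qed

text \<open>In coordinate \<open>j\<close> the points of the cell of \<open>r\<close> on the line through \<open>r\<close> form an
  interval; its upper end is found by searching the reflected line.\<close>

primrec edges :: "nat \<Rightarrow> nat \<Rightarrow> (nat \<Rightarrow> nat) \<Rightarrow> nat \<Rightarrow> ('i, nat \<Rightarrow> nat, nat \<Rightarrow> nat \<times> nat) step" where
  "edges n t r 0 g = g (\<lambda>_. (0, 0))"
| "edges n t r (Suc j) g = edges n t r j (\<lambda>h.
    bsearch t (\<lambda>a. r(j := a)) r 1 (r j) (\<lambda>a.
      bsearch t (\<lambda>b. r(j := n + 1 - b)) r 1 (n + 1 - r j) (\<lambda>b. g (h(j := (a, n + 1 - b))))))"

definition learn_cell :: "nat \<Rightarrow> nat \<Rightarrow> nat \<Rightarrow> (nat \<Rightarrow> nat) \<Rightarrow> ('i, nat \<Rightarrow> nat, (nat \<Rightarrow> nat) set) step" where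
  "learn_cell n d t r g =
     edges n t r d (\<lambda>h. g {x \<in> grid n d. \<forall>i<d. fst (h i) \<le> x i \<and> x i \<le> snd (h i)})"

lemma run_edges:
  assumes "n \<le> 2 ^ t" and "j \<le> d"
    and AB: "\<And>i. i < d \<Longrightarrow> 1 \<le> A i \<and> A i \<le> r i \<and> r i \<le> B i \<and> B i \<le> n"
    and lab: "\<And>i a. i < d \<Longrightarrow> 1 \<le> a \<Longrightarrow> a \<le> n \<Longrightarrow> lab (r(i := a)) = r \<longleftrightarrow> A i \<le> a \<and> a \<le> B i"
  shows "run smp lab (edges n t r j g) = run smp lab (g (\<lambda>i. if i < j then (A i, B i) else (0, 0)))"
  using \<open>j \<le> d\<close>
proof (induction j arbitrary: g)
  case (Suc j)
  then have j: "j < d" by simp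
  have lower: "run smp lab (bsearch t (\<lambda>a. r(j := a)) r 1 (r j) g) = run smp lab (g (A j))" for g
    by (rule run_bsearch) (use AB[OF j] lab[OF j] assms(1) in auto)
  have upper: "run smp lab (bsearch t (\<lambda>b. r(j := n + 1 - b)) r 1 (n + 1 - r j) g) =
      run smp lab (g (n + 1 - B j))" for g
  proof (rule run_bsearch)
    fix b assume b: "1 \<le> b" "b \<le> n + 1 - r j"
    then have "lab (r(j := n + 1 - b)) = r \<longleftrightarrow> A j \<le> n + 1 - b \<and> n + 1 - b \<le> B j"
      using AB[OF j] by (intro lab j) auto
    then show "lab (r(j := n + 1 - b)) = r \<longleftrightarrow> n + 1 - B j \<le> b"
      using AB[OF j] b by auto
  qed (use AB[OF j] assms(1) in auto)
  have fun_eq: "(\<lambda>i. if i < j then (A i, B i) else (0, 0))(j := (A j, n + 1 - (n + 1 - B j))) =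
      (\<lambda>i. if i < Suc j then (A i, B i) else (0, 0))"
    using AB[OF j] by (auto simp: less_Suc_eq)
  have "run smp lab (edges n t r (Suc j) g) =
      run smp lab (g ((\<lambda>i. if i < j then (A i, B i) else (0, 0))(j := (A j, n + 1 - (n + 1 - B j)))))"
    using Suc.IH[OF less_imp_le[OF j]] lower upper by simp
  then show ?case
    unfolding fun_eq .
qed simp

lemma grid_upd: "r \<in> grid n d \<Longrightarrow> j < d \<Longrightarrow> 1 \<le> a \<Longrightarrow> a \<le> n \<Longrightarrow> r(j := a) \<in> grid n d"
  by (simp add: grid_def PiE_iff extensional_def)

lemma costs_edges:
  assumes r: "r \<in> grid n d" and "j \<le> d"
  shows "costs (grid n d) (edges n t r j :: ('i, nat \<Rightarrow> nat, nat \<Rightarrow> nat \<times> nat) step) UNIV 0 (j * (2 * t))"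
  using \<open>j \<le> d\<close>
proof (induction j)
  case (Suc j)
  then have j: "j < d" by simp
  have lower: "costs (grid n d) (bsearch t (\<lambda>a. r(j := a)) r 1 (r j) :: ('i, nat \<Rightarrow> nat, nat) step) UNIV 0 t"
    by (rule costs_bsearch[where n = n]) (use gridD[OF r j] grid_upd[OF r j] in auto)
  have upper: "costs (grid n d) (bsearch t (\<lambda>b. r(j := n + 1 - b)) r 1 (n + 1 - r j) :: ('i, nat \<Rightarrow> nat, nat) step) UNIV 0 t"
    by (rule costs_bsearch[where n = n]) (use gridD[OF r j] in \<open>auto intro!: grid_upd[OF r j]\<close>)
  show ?case
    unfolding costs_def
  proof (intro allI impI)
    fix g :: "(nat \<Rightarrow> nat \<times> nat) \<Rightarrow> ('i, nat \<Rightarrow> nat) algo" and s' q'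
    assume g: "\<forall>b\<in>UNIV. uses_at_most (grid n d) (g b) s' q'"
    have "uses_at_most (grid n d) (edges n t r (Suc j) g) (0 + (0 + (0 + s'))) (j * (2 * t) + (t + (t + q')))"
      unfolding edges.simps
      by (intro costsD[OF Suc.IH[OF less_imp_le[OF j]]] costsD[OF lower] costsD[OF upper]) (use g in auto)
    then show "uses_at_most (grid n d) (edges n t r (Suc j) g) (0 + s') (Suc j * (2 * t) + q')"
      by (simp add: algebra_simps)
  qed
qed (simp add: costs_def)

lemma costs_learn_cell:
  assumes "r \<in> grid n d"
  shows "costs (grid n d) (learn_cell n d t r) UNIV 0 (d * (2 * t))"
  unfolding costs_def learn_cell_def
  by (intro allI impI costsD[OF costs_edges[OF assms order_refl]]) auto

section \<open>Cells, labels and representatives\<close>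

lemma clusteringD:
  assumes C: "C \<in> clusterings X" and x: "x \<in> X"
  shows "cell_index C x \<in> {1..num_cells C}" "x \<in> cell C (cell_index C x)"
    and "label C x \<in> cell C (cell_index C x)" "label C x \<in> X"
    and "cell C (cell_index C x) \<subseteq> X"
proof -
  obtain i where i: "i \<in> {1..num_cells C}" "x \<in> cell C i"
    using C x by (auto simp: clusterings_def)
  have uniq: "j = i" if "j \<in> {1..num_cells C}" "x \<in> cell C j" for j
    using C i that unfolding clusterings_def disjoint_family_on_def by blast
  have "cell_index C x = i"
    unfolding cell_index_def by (rule the_equality) (use i uniq in blast)+
  then show *: "cell_index C x \<in> {1..num_cells C}" "x \<in> cell C (cell_index C x)"
    using i by auto
  show "label C x \<in> cell C (cell_index C x)"
    using C *(1) by (auto simp: clusterings_def label_def)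
  moreover show "cell C (cell_index C x) \<subseteq> X"
    using C *(1) by (auto simp: clusterings_def)
  ultimately show "label C x \<in> X"
    by auto
qed

lemma cell_index_eqI:
  assumes C: "C \<in> clusterings X" and "i \<in> {1..num_cells C}" "x \<in> cell C i"
  shows "cell_index C x = i"
  unfolding cell_index_def
proof (rule the_equality)
  fix j assume "j \<in> {1..num_cells C} \<and> x \<in> cell C j"
  then show "j = i"
    using assms unfolding clusterings_def disjoint_family_on_def by blast
qed (use assms in simp)

lemma cell_index_label:
  assumes "C \<in> clusterings X" "x \<in> X"
  shows "cell_index C (label C x) = cell_index C x"
  using clusteringD[OF assms] by (intro cell_index_eqI[OF assms(1)]) auto

text \<open>This turns the label oracle into a membership test: each representative lies in its own
  cell, so different cells have different labels.\<close>

lemma label_eq_iff: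
  assumes C: "C \<in> clusterings X" and x: "x \<in> X" and y: "y \<in> X"
  shows "label C y = label C x \<longleftrightarrow> y \<in> cell C (cell_index C x)"
proof
  assume "label C y = label C x"
  then have "cell_index C y = cell_index C x"
    using cell_index_label[OF C x] cell_index_label[OF C y] by simp
  then show "y \<in> cell C (cell_index C x)"
    using clusteringD(2)[OF C y] by simp
next
  assume "y \<in> cell C (cell_index C x)"
  then have "cell_index C y = cell_index C x"
    by (intro cell_index_eqI[OF C clusteringD(1)[OF C x]])
  then show "label C y = label C x"
    by (simp add: label_def)
qed

text \<open>The constraints of a box are separate for each coordinate, so its segments through the
  representative along the \<open>d\<close> axes determine it.\<close>

lemma run_learn_cell:
  assumes C: "C \<in> box_clusterings n d" and x: "x \<in> grid n d" and n: "n \<le> 2 ^ t"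
  shows "run smp (label C) (learn_cell n d t (label C x) g) =
    run smp (label C) (g (cell C (cell_index C x)))"
proof -
  let ?r = "label C x" and ?S = "cell C (cell_index C x)"
  have cl: "C \<in> clusterings (grid n d)"
    using C by (simp add: box_clusterings_def)
  note D = clusteringD[OF cl x]
  obtain a b where S: "?S = {y \<in> grid n d. \<forall>i<d. a i \<le> y i \<and> y i \<le> b i}"
    using C D(1) unfolding box_clusterings_def is_box_def by blast
  \<comment> \<open>The bounds that define the box may lie outside \<open>[n]\<close>; the search
    only sees them truncated.\<close>
  define A where "A i = max 1 (a i)" for i
  define B where "B i = min n (b i)" for i
  have r: "?r \<in> grid n d" and r_box: "\<And>i. i < d \<Longrightarrow> a i \<le> ?r i \<and> ?r i \<le> b i"
    using D(3) unfolding S by auto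
  have AB: "1 \<le> A i \<and> A i \<le> ?r i \<and> ?r i \<le> B i \<and> B i \<le> n" if "i < d" for i
    using r_box[OF that] gridD[OF r that] by (auto simp: A_def B_def)
  have lab: "label C (?r(i := c)) = ?r \<longleftrightarrow> A i \<le> c \<and> c \<le> B i" if "i < d" "1 \<le> c" "c \<le> n" for i c
  proof -
    have up: "?r(i := c) \<in> grid n d"
      by (rule grid_upd[OF r that])
    have "label C (?r(i := c)) = ?r \<longleftrightarrow> ?r(i := c) \<in> ?S"
      by (rule label_eq_iff[OF cl x up])
    also have "\<dots> \<longleftrightarrow> a i \<le> c \<and> c \<le> b i"
      unfolding S using up r_box that(1) by auto
    also have "\<dots> \<longleftrightarrow> A i \<le> c \<and> c \<le> B i"
      using that by (auto simp: A_def B_def)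
    finally show ?thesis .
  qed
  have "run smp (label C) (learn_cell n d t ?r g) =
      run smp (label C) (g {y \<in> grid n d. \<forall>i<d. A i \<le> y i \<and> y i \<le> B i})"
    unfolding learn_cell_def by (subst run_edges[OF n order_refl, of d A ?r B]) (use AB lab in \<open>auto cong: conj_cong\<close>)
  also have "{y \<in> grid n d. \<forall>i<d. A i \<le> y i \<and> y i \<le> B i} = ?S"
    unfolding S using gridD by (fastforce simp: A_def B_def)
  finally show ?thesis .
qed

section \<open>The guarded scheme: checks, then flattening and comparison\<close>

definition guarded :: "nat \<Rightarrow> ('i, 'a, bool) step \<Rightarrow> nat \<Rightarrow> ('i, 'a, 'a) step \<Rightarrow> nat \<Rightarrow> ('i, 'a, 'a \<times> 'a) step \<Rightarrow>
    ('a list \<Rightarrow> ('a \<times> 'a) list \<times> ('a \<times> 'a) list \<Rightarrow> bool) \<Rightarrow> ('i, 'a) algo" where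
  "guarded N chk k fl m pr dec = repeat_step N chk (\<lambda>bs.
     if True \<in> set bs then Output Cluster_Reject
     else repeat_step k fl (\<lambda>fs. repeat_step m pr (\<lambda>zs. repeat_step m pr (\<lambda>zs'.
       Output (if dec fs (zs, zs') then Reject else Accept)))))"

lemma guarded_costs:
  assumes "costs X chk UNIV s\<^sub>1 q\<^sub>1" "costs X fl F s\<^sub>2 q\<^sub>2" "costs X pr Z s\<^sub>3 q\<^sub>3"
  shows "uses_at_most X (guarded N chk k fl m pr dec) (N * s\<^sub>1 + k * s\<^sub>2 + 2 * m * s\<^sub>3) (N * q\<^sub>1 + k * q\<^sub>2 + 2 * m * q\<^sub>3)"
proof -
  have "uses_at_most X (repeat_step k fl (\<lambda>fs. repeat_step m pr (\<lambda>zs. repeat_step m pr (\<lambda>zs'.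
       Output (if dec fs (zs, zs') then Reject else Accept))))) (k * s\<^sub>2 + (m * s\<^sub>3 + (m * s\<^sub>3 + 0))) (k * q\<^sub>2 + (m * q\<^sub>3 + (m * q\<^sub>3 + 0)))"
    by (intro costsD[OF costs_repeat_step[OF assms(2)]] costsD[OF costs_repeat_step[OF assms(3)]]) simp
  then have "uses_at_most X (guarded N chk k fl m pr dec) (N * s\<^sub>1 + (k * s\<^sub>2 + (m * s\<^sub>3 + (m * s\<^sub>3 + 0))))
      (N * q\<^sub>1 + (k * q\<^sub>2 + (m * q\<^sub>3 + (m * q\<^sub>3 + 0))))"
    unfolding guarded_def by (intro costsD[OF costs_repeat_step[OF assms(1)]]) auto
  then show ?thesis
    by (simp add: mult_2 distrib_right add.assoc)
qed

lemma guarded_run: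
  assumes "draws smp lab chk Dc" "draws smp lab fl q" "draws smp lab pr (pair_pmf p q)"
  shows "run smp lab (guarded N chk k fl m pr dec) = bind_pmf (replicate_pmf N Dc) (\<lambda>bs.
     if True \<in> set bs then return_pmf Cluster_Reject
     else map_pmf (\<lambda>b. if b then Reject else Accept) (final_dist k q m p dec))"
  unfolding guarded_def drawsD[OF draws_repeat_step[OF assms(1)]]
  by (intro bind_pmf_cong refl)
    (simp add: drawsD[OF draws_repeat_step[OF assms(2)]] drawsD[OF draws_repeat_step[OF assms(3)]]
      final_dist_def map_bind_pmf pair_pmf_def bind_assoc_pmf bind_return_pmf map_pmf_def)

lemma prob_False: "measure_pmf.prob R {False} = 1 - measure_pmf.prob R {True}"
proof -
  have "UNIV - {True} = {False}"
    by auto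
  then show ?thesis
    using measure_pmf.prob_compl[of "{True}" R] by simp
qed

lemma prob_no_True:
  "measure_pmf.prob (replicate_pmf N Dc) {bs. True \<notin> set bs} = (1 - measure_pmf.prob Dc {True}) ^ N"
proof (induction N)
  case (Suc N)
  have fin: "finite (set_pmf Dc)" by simp
  have "measure_pmf.prob (replicate_pmf (Suc N) Dc) {bs. True \<notin> set bs} =
      expect Dc (\<lambda>x. expect (replicate_pmf N Dc) (\<lambda>xs. indicator {False} x * indicator {bs. True \<notin> set bs} xs))"
    unfolding prob_eq_expect expect_replicate_Suc[OF fin]
    by (intro expect_cong) (auto simp: indicator_def)
  also have "\<dots> = measure_pmf.prob Dc {False} * (1 - measure_pmf.prob Dc {True}) ^ N"
    by (simp add: Suc)
  also have "measure_pmf.prob Dc {False} = 1 - measure_pmf.prob Dc {True}"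
    by (rule prob_False)
  finally show ?case
    by simp
qed simp

text \<open>Checks can only turn an answer into \<open>Cluster_Reject\<close>, which the last two
  events allow. A wrong \<open>Accept\<close> needs all checks to miss and, independently, the
  comparison to fail; the first bound is Bernoulli's inequality.\<close>

lemma guarded_prob:
  fixes Dc R :: "bool pmf" and N :: nat
  defines "out \<equiv> bind_pmf (replicate_pmf N Dc) (\<lambda>bs.
     if True \<in> set bs then return_pmf Cluster_Reject else map_pmf (\<lambda>b. if b then Reject else Accept) R)"
  shows "measure_pmf.prob out {Cluster_Reject} \<le> real N * measure_pmf.prob Dc {True}"
    and "measure_pmf.prob out {Accept, Cluster_Reject} \<ge> 1 - measure_pmf.prob R {True}"
    and "measure_pmf.prob out {Reject, Cluster_Reject} \<ge>
      1 - (1 - measure_pmf.prob Dc {True}) ^ N * measure_pmf.prob R {False}"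
proof -
  let ?\<beta> = "measure_pmf.prob Dc {True}"
  have fin: "finite (set_pmf (replicate_pmf N Dc))"
    by (intro finite_set_replicate_pmf) simp
  have prob: "measure_pmf.prob out V = (1 - (1 - ?\<beta>) ^ N) * indicator V Cluster_Reject +
      (1 - ?\<beta>) ^ N * measure_pmf.prob R {b. (if b then Reject else Accept) \<in> V}" for V
  proof -
    let ?c = "measure_pmf.prob R {b. (if b then Reject else Accept) \<in> V}"
    have "measure_pmf.prob out V = expect (replicate_pmf N Dc) (\<lambda>bs.
        indicator V Cluster_Reject + indicator {bs. True \<notin> set bs} bs * (?c - indicator V Cluster_Reject))"
      unfolding out_def
    proof (subst prob_bind[OF fin])
      show "expect (replicate_pmf N Dc) (\<lambda>bs. measure_pmf.prob (if True \<in> set bs then return_pmf Cluster_Reject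
          else map_pmf (\<lambda>b. if b then Reject else Accept) R) V) = expect (replicate_pmf N Dc) (\<lambda>bs.
          indicator V Cluster_Reject + indicator {bs. True \<notin> set bs} bs * (?c - indicator V Cluster_Reject))"
      proof (rule expect_cong)
        fix bs
        show "measure_pmf.prob (if True \<in> set bs then return_pmf Cluster_Reject
          else map_pmf (\<lambda>b. if b then Reject else Accept) R) V =
          indicator V Cluster_Reject + indicator {bs. True \<notin> set bs} bs * (?c - indicator V Cluster_Reject)"
          by (cases "True \<in> set bs") (simp_all add: vimage_def)
      qed
    qed simp
    also have "\<dots> = indicator V Cluster_Reject + (1 - ?\<beta>) ^ N * (?c - indicator V Cluster_Reject)"
      by (simp add: expect_add fin prob_no_True)
    finally show ?thesis
      by (simp add: algebra_simps)
  qed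
  have \<beta>: "0 \<le> (1 - ?\<beta>) ^ N" "(1 - ?\<beta>) ^ N \<le> 1"
    by (auto intro: power_le_one)
  have "1 + real N * (- ?\<beta>) \<le> (1 + (- ?\<beta>)) ^ N"
    by (intro Bernoulli_inequality) simp
  then show "measure_pmf.prob out {Cluster_Reject} \<le> real N * ?\<beta>"
    unfolding prob by simp
  have "(1 - ?\<beta>) ^ N * measure_pmf.prob R {True} \<le> 1 * measure_pmf.prob R {True}"
    by (intro mult_right_mono \<beta>) simp
  moreover have "{b. (if b then Reject else Accept) \<in> {Accept, Cluster_Reject}} = {False}"
    by (auto split: if_splits)
  ultimately show "measure_pmf.prob out {Accept, Cluster_Reject} \<ge> 1 - measure_pmf.prob R {True}"
    unfolding prob by (simp add: prob_False algebra_simps)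
  have "{b. (if b then Reject else Accept) \<in> {Reject, Cluster_Reject}} = {True}"
    by (auto split: if_splits)
  then show "measure_pmf.prob out {Reject, Cluster_Reject} \<ge> 1 - (1 - ?\<beta>) ^ N * measure_pmf.prob R {False}"
    unfolding prob by (simp add: prob_False algebra_simps)
qed

section \<open>The two testers\<close>

lemma dist_le_diam:
  assumes "finite S" "x \<in> S" "y \<in> S"
  shows "dst x y \<le> diam dst S"
proof -
  have "(\<lambda>(x, y). dst x y) (x, y) \<le> (SUP z\<in>S \<times> S. (\<lambda>(x, y). dst x y) z)"
    using assms by (intro cSUP_upper bdd_above_finite) auto
  then show ?thesis
    by (simp add: diam_def)
qed

lemma ndist_self: "1 \<le> p \<Longrightarrow> ndist p n d x x = 0"
  by (simp add: ndist_def lp_norm_def)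

text \<open>The thresholds make every level contribute \<open>\<epsilon> / (4 * L)\<close> to the
  earth mover bound. The lower bound on \<open>N0\<close> ensures that wide mass above
  \<open>\<epsilon> / 16\<close> is seen, the upper bound that wide mass within the guard rarely
  is.\<close>

locale guarded_params = level_test "subcube n d" "subcubes d" "\<lambda>l. 2 ^ (l * d)" "\<lambda>l. 2 ^ l * \<epsilon> / (4 * real L)" "grid n d" L k m
  for n d :: nat and \<epsilon> :: real and L k m :: nat +
  fixes p \<Delta> :: real and t N0 :: nat
  assumes n: "1 \<le> n" and d: "1 \<le> d" and p: "1 \<le> p" and \<Delta>: "0 < 8 * \<Delta>" "8 * \<Delta> \<le> \<epsilon>" and \<epsilon>: "\<epsilon> < 1"
    and t: "n \<le> 2 ^ t" and L_large: "4 / \<epsilon> \<le> 2 ^ L"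
    and N0: "16 * ln 24 / \<epsilon> \<le> real N0" "real N0 \<le> 32 * ln 24 / \<epsilon>"
begin

abbreviation X where "X \<equiv> grid n d"
abbreviation dst where "dst \<equiv> ndist p n d"
abbreviation own_cell where "own_cell C x \<equiv> cell C (cell_index C x)"
abbreviation wide where "wide S \<equiv> \<Delta> < diam dst S"
abbreviation wide_prob where "wide_prob C \<mu> \<equiv> measure_pmf.prob \<mu> {x. wide (own_cell C x)}"

lemma \<epsilon>_pos: "0 < \<epsilon>"
  using \<Delta> by linarith

lemma X_nonempty: "X \<noteq> {}"
  using n by (simp add: grid_def PiE_eq_empty_iff)

lemma fin_sub: "set_pmf \<mu> \<subseteq> X \<Longrightarrow> finite (set_pmf \<mu>)"
  using finite_subset finite_grid by blast

lemma own_cell_subset: "C \<in> clusterings X \<Longrightarrow> x \<in> X \<Longrightarrow> own_cell C x \<subseteq> X"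
  by (rule clusteringD(5))

text \<open>If all levels were close, moving points (3/16 twice), the finest resolution (1/4) and
  the levels together (1/4) would add up to 7/8 of \<open>\<epsilon>\<close>.\<close>

lemma level_of_EMD:
  assumes P: "set_pmf P \<subseteq> X \<times> X" and Q: "set_pmf Q \<subseteq> X \<times> X"
    and EP: "expect P (\<lambda>(x, y). dst x y) \<le> 3 * \<epsilon> / 16" and EQ: "expect Q (\<lambda>(x, y). dst x y) \<le> 3 * \<epsilon> / 16"
    and EMD: "\<epsilon> < EMD dst (map_pmf fst P) (map_pmf fst Q)"
  shows "\<exists>l\<in>{1..L}. 2 ^ l * \<epsilon> / (4 * real L) \<le> (\<Sum>c\<in>subcubes d l.
    \<bar>measure_pmf.prob (map_pmf snd P) {x. subcube n d l x = c} - measure_pmf.prob (map_pmf snd Q) {x. subcube n d l x = c}\<bar>)"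
proof (rule ccontr)
  assume "\<not> ?thesis"
  then have close: "(\<Sum>c\<in>subcubes d l. \<bar>measure_pmf.prob (map_pmf snd P) {x. subcube n d l x = c} -
      measure_pmf.prob (map_pmf snd Q) {x. subcube n d l x = c}\<bar>) \<le> 2 ^ l * \<epsilon> / (4 * real L)" if "l \<in> {1..L}" for l
    using that by (meson not_le less_imp_le)
  have "EMD dst (map_pmf fst P) (map_pmf fst Q) \<le> expect P (\<lambda>(x, y). dst x y) + expect Q (\<lambda>(x, y). dst x y) +
      (1 / 2 ^ L + (\<Sum>j<L. 2 ^ Suc j * \<epsilon> / (4 * real L) / 2 / 2 ^ j))"
  proof (rule EMD_tree_bound[where f = "subcube n d" and I = "subcubes d" and X = X])
    fix j l x y assume "j \<le> l" "subcube n d l x = subcube n d l y"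
    then show "subcube n d j x = subcube n d j y"
      by (rule subcube_nested)
  next
    fix l x y assume "x \<in> X" "y \<in> X" "subcube n d l x = subcube n d l y"
    then show "dst x y \<le> 1 / 2 ^ l"
      by (intro subcube_diam p n d)
  next
    fix x y assume "x \<in> X" "y \<in> X"
    then show "dst x y \<le> 1"
      by (intro ndist_grid_le_1 p n d)
  next
    fix x y z show "dst x z \<le> dst x y + dst y z"
      by (rule ndist_triangle[OF p])
  next
    fix x y show "dst x y = dst y x"
      by (rule ndist_sym)
  qed (use P Q n close in \<open>simp_all add: finite_grid finite_subcubes subcube_in ndist_nonneg\<close>)
  also have "(\<Sum>j<L. 2 ^ Suc j * \<epsilon> / (4 * real L) / 2 / 2 ^ j) = \<epsilon> / 4"
    using L_pos by simp
  also have "1 / 2 ^ L \<le> \<epsilon> / 4"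
    using L_large \<epsilon>_pos by (simp add: field_simps)
  finally show False
    using EP EQ EMD \<epsilon>_pos by linarith
qed

text \<open>Narrow cells cost \<open>\<Delta> \<le> \<epsilon> / 8\<close>, wide ones at most 1 on
  mass \<open>\<epsilon> / 16\<close>. The kernel \<open>K\<close> serves both testers: resampling
  for identity, the deterministic label for equivalence.\<close>

lemma representative_cost:
  assumes C: "C \<in> clusterings X" and \<mu>: "set_pmf \<mu> \<subseteq> X"
    and K: "\<And>x. x \<in> set_pmf \<mu> \<Longrightarrow> set_pmf (K x) \<subseteq> own_cell C x"
    and wide: "wide_prob C \<mu> \<le> \<epsilon> / 16"
  defines "P \<equiv> bind_pmf \<mu> (\<lambda>x. map_pmf (Pair x) (K x))"
  shows "set_pmf P \<subseteq> X \<times> X" "expect P (\<lambda>(x, y). dst x y) \<le> 3 * \<epsilon> / 16"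
    "map_pmf fst P = \<mu>" "map_pmf snd P = bind_pmf \<mu> K"
proof -
  have sub: "set_pmf (K x) \<subseteq> X" if "x \<in> set_pmf \<mu>" for x
    using K[OF that] own_cell_subset[OF C, of x] that \<mu> by auto
  show "set_pmf P \<subseteq> X \<times> X"
    using sub \<mu> by (auto simp: P_def)
  show "map_pmf fst P = \<mu>"
    by (simp add: P_def map_bind_pmf pmf.map_comp o_def bind_return_pmf')
  show "map_pmf snd P = bind_pmf \<mu> K"
    by (simp add: P_def map_bind_pmf pmf.map_comp o_def)
  have "expect P (\<lambda>(x, y). dst x y) = expect \<mu> (\<lambda>x. expect (K x) (\<lambda>y. dst x y))"
    unfolding P_def using sub by (subst expect_bind[OF fin_sub[OF \<mu>]]) (simp_all add: fin_sub)
  also have "\<dots> \<le> expect \<mu> (\<lambda>x. \<Delta> + indicator {x. wide (own_cell C x)} x)"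
  proof (intro expect_mono fin_sub[OF \<mu>])
    fix x assume x: "x \<in> set_pmf \<mu>"
    with \<mu> have xX: "x \<in> X" by auto
    have "expect (K x) (\<lambda>y. dst x y) \<le> expect (K x) (\<lambda>_. \<Delta> + indicator {x. wide (own_cell C x)} x)"
    proof (intro expect_mono fin_sub[OF sub[OF x]])
      fix y assume y: "y \<in> set_pmf (K x)"
      show "dst x y \<le> \<Delta> + indicator {x. wide (own_cell C x)} x"
      proof (cases "wide (own_cell C x)")
        case True
        have "dst x y \<le> 1"
          using y sub[OF x] xX by (intro ndist_grid_le_1 p n d) auto
        with True \<Delta> show ?thesis
          by simp
      next
        case False
        have "dst x y \<le> diam dst (own_cell C x)"
          using y K[OF x] clusteringD(2)[OF C xX] finite_subset[OF own_cell_subset[OF C xX] finite_grid]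
          by (intro dist_le_diam) auto
        with False show ?thesis
          by simp
      qed
    qed
    then show "expect (K x) (\<lambda>y. dst x y) \<le> \<Delta> + indicator {x. wide (own_cell C x)} x"
      by simp
  qed
  also have "\<dots> = \<Delta> + wide_prob C \<mu>"
    by (simp add: expect_add fin_sub[OF \<mu>])
  finally show "expect P (\<lambda>(x, y). dst x y) \<le> 3 * \<epsilon> / 16"
    using wide \<Delta> by linarith
qed

text \<open>The factor 2 is for equivalence, where a check inspects one sample of each distribution.
  The product is 32 * 2 / 384 = 1 / 6, which explains the constant 384.\<close>

lemma few_wide:
  assumes "\<beta> \<le> 2 * (guard_const * \<epsilon>)" "0 \<le> \<beta>"
  shows "real N0 * \<beta> \<le> 1 / 6"
proof -
  have "0 < ln (24::real)"
    by simp
  have "real N0 * \<beta> \<le> (32 * ln 24 / \<epsilon>) * (2 * (guard_const * \<epsilon>))"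
    using N0 assms \<epsilon>_pos by (intro mult_mono) auto
  also have "\<dots> = 1 / 6"
    using \<epsilon>_pos \<open>0 < ln 24\<close> by (simp add: guard_const_def)
  finally show ?thesis .
qed

text \<open>\<open>16 * ln 24 / \<epsilon>\<close> trials of probability
  \<open>\<epsilon> / 16\<close> all miss with probability at most exp (- ln 24) = 1 / 24.\<close>

lemma many_wide:
  assumes "\<epsilon> / 16 < \<beta>" "\<beta> \<le> 1"
  shows "(1 - \<beta>) ^ N0 \<le> 1 / 6"
proof -
  have "(1 - \<beta>) ^ N0 \<le> exp (- \<beta>) ^ N0"
    using assms exp_ge_add_one_self[of "- \<beta>"] by (intro power_mono) auto
  also have "\<dots> = exp (- (real N0 * \<beta>))"
    by (simp add: exp_of_nat_mult[symmetric])
  also have "\<dots> \<le> exp (- ln 24)"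
  proof -
    have "ln 24 = (16 * ln 24 / \<epsilon>) * (\<epsilon> / 16)"
      using \<epsilon>_pos by simp
    also have "\<dots> \<le> real N0 * \<beta>"
      using N0 assms \<epsilon>_pos by (intro mult_mono) auto
    finally show ?thesis
      by simp
  qed
  also have "\<dots> \<le> 1 / 6"
    by (simp add: exp_minus)
  finally show ?thesis .
qed

section \<open>Building blocks of the two algorithms and their costs\<close>

definition check_identity :: "(unit, nat \<Rightarrow> nat, bool) step" where
  "check_identity g = Sample () (\<lambda>r. learn_cell n d t r (\<lambda>S. g (wide S)))"

text \<open>The fallback concerns cells without mass under \<nu>, where conditioning is meaningless;
  returning the representative keeps the point in its cell.\<close>

definition resample :: "(nat \<Rightarrow> nat) pmf \<Rightarrow> (nat \<Rightarrow> nat) \<Rightarrow> (nat \<Rightarrow> nat) set \<Rightarrow> (nat \<Rightarrow> nat) pmf" where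
  "resample \<nu> r S = (if set_pmf \<nu> \<inter> S = {} then return_pmf r else cond_pmf \<nu> S)"

definition pair_identity :: "(nat \<Rightarrow> nat) pmf \<Rightarrow> (unit, nat \<Rightarrow> nat, (nat \<Rightarrow> nat) \<times> (nat \<Rightarrow> nat)) step" where
  "pair_identity \<nu> g = Sample () (\<lambda>r. learn_cell n d t r (\<lambda>S.
     rand_step X (resample \<nu> r S) (\<lambda>u. rand_step X \<nu> (\<lambda>v. g (u, v)))))"

definition check_equivalence :: "(bool, nat \<Rightarrow> nat, bool) step" where
  "check_equivalence g = Sample True (\<lambda>r. learn_cell n d t r (\<lambda>S.
     Sample False (\<lambda>r'. learn_cell n d t r' (\<lambda>S'. g (wide S \<or> wide S')))))"

definition pair_equivalence :: "(bool, nat \<Rightarrow> nat, (nat \<Rightarrow> nat) \<times> (nat \<Rightarrow> nat)) step" where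
  "pair_equivalence g = Sample True (\<lambda>u. Sample False (\<lambda>v. g (u, v)))"

definition identity_algo where
  "identity_algo \<nu> = guarded N0 check_identity k (rand_step X \<nu>) m (pair_identity \<nu>) far"

definition equivalence_algo where
  "equivalence_algo = guarded N0 check_equivalence k (Sample False) m pair_equivalence far"

lemma costs_learn: "r \<in> X \<Longrightarrow> costs X (learn_cell n d t r) UNIV 0 (d * (2 * t))"
  by (rule costs_learn_cell)

lemma costs_check_identity: "costs X check_identity UNIV 1 (d * (2 * t))"
  unfolding costs_def
proof (intro allI impI)
  fix g :: "bool \<Rightarrow> (unit, nat \<Rightarrow> nat) algo" and s q
  assume g: "\<forall>b\<in>UNIV. uses_at_most X (g b) s q"
  have "uses_at_most X (learn_cell n d t r (\<lambda>S. g (wide S))) (0 + s) (d * (2 * t) + q)" if "r \<in> X" for r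
    using g by (intro costsD[OF costs_learn[OF that]]) auto
  then show "uses_at_most X (check_identity g) (1 + s) (d * (2 * t) + q)"
    by (simp add: check_identity_def)
qed

lemma costs_pair_identity: "costs X (pair_identity \<nu>) (X \<times> X) 1 (d * (2 * t))"
  unfolding costs_def
proof (intro allI impI)
  fix g :: "(nat \<Rightarrow> nat) \<times> (nat \<Rightarrow> nat) \<Rightarrow> (unit, nat \<Rightarrow> nat) algo" and s q
  assume g: "\<forall>b\<in>X \<times> X. uses_at_most X (g b) s q"
  have "uses_at_most X (learn_cell n d t r (\<lambda>S. rand_step X (resample \<nu> r S) (\<lambda>u. rand_step X \<nu> (\<lambda>v. g (u, v)))))
      (0 + (0 + (0 + s))) (d * (2 * t) + (0 + (0 + q)))" if "r \<in> X" for r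
    using g by (intro costsD[OF costs_learn[OF that]] costsD[OF costs_rand_step[OF X_nonempty]]) auto
  then show "uses_at_most X (pair_identity \<nu> g) (1 + s) (d * (2 * t) + q)"
    by (simp add: pair_identity_def)
qed

lemma costs_check_equivalence: "costs X check_equivalence UNIV 2 (2 * (d * (2 * t)))"
  unfolding costs_def
proof (intro allI impI)
  fix g :: "bool \<Rightarrow> (bool, nat \<Rightarrow> nat) algo" and s q
  assume g: "\<forall>b\<in>UNIV. uses_at_most X (g b) s q"
  have inner: "uses_at_most X (learn_cell n d t r' (\<lambda>S'. g (wide S \<or> wide S'))) (0 + s) (d * (2 * t) + q)"
    if "r' \<in> X" for r' S
    using g by (intro costsD[OF costs_learn[OF that]]) auto
  have "uses_at_most X (learn_cell n d t r (\<lambda>S. Sample False (\<lambda>r'. learn_cell n d t r' (\<lambda>S'. g (wide S \<or> wide S')))))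
      (0 + (1 + s)) (d * (2 * t) + (d * (2 * t) + q))" if "r \<in> X" for r
    using inner by (intro costsD[OF costs_learn[OF that]]) auto
  then show "uses_at_most X (check_equivalence g) (2 + s) (2 * (d * (2 * t)) + q)"
    by (simp add: check_equivalence_def mult_2 add.assoc)
qed

lemma costs_pair_equivalence: "costs X pair_equivalence (X \<times> X) 2 0"
  by (simp add: costs_def pair_equivalence_def)

lemma identity_cost: "uses_at_most X (identity_algo \<nu>) (N0 + 2 * m) ((N0 + 2 * m) * (d * (2 * t)))"
  using guarded_costs[OF costs_check_identity costs_rand_step[OF X_nonempty, of \<nu>] costs_pair_identity, of N0 k m \<nu> far]
  unfolding identity_algo_def by (simp add: distrib_right)

lemma equivalence_cost: "uses_at_most X equivalence_algo (2 * N0 + k + 4 * m) (2 * N0 * (d * (2 * t)))"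
  using guarded_costs[OF costs_check_equivalence costs_Sample[of X False] costs_pair_equivalence, of N0 k m far]
  unfolding equivalence_algo_def by (simp add: mult_ac)

section \<open>Output laws and correctness for a fixed box clustering\<close>

context
  fixes C :: "(nat \<Rightarrow> nat) clustering"
  assumes C: "C \<in> box_clusterings n d"
begin

lemma cl: "C \<in> clusterings X"
  using C by (simp add: box_clusterings_def)

text \<open>Learning returns exactly the cell of the hidden point, so the run can be rewritten as if
  that point itself had been drawn.\<close>

lemma run_sample_learn:
  assumes "set_pmf \<mu> \<subseteq> X"
  shows "bind_pmf (clustered C \<mu>) (\<lambda>r. run smp (label C) (learn_cell n d t r (h r))) =
    bind_pmf \<mu> (\<lambda>x. run smp (label C) (h (label C x) (own_cell C x)))"
  unfolding clustered_def bind_map_pmf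
proof (intro bind_pmf_cong refl)
  fix x assume "x \<in> set_pmf \<mu>"
  then show "run smp (label C) (learn_cell n d t (label C x) (h (label C x))) =
      run smp (label C) (h (label C x) (own_cell C x))"
    using assms by (intro run_learn_cell[OF C _ t]) auto
qed

lemma clustered_subset: "set_pmf \<mu> \<subseteq> X \<Longrightarrow> set_pmf (clustered C \<mu>) \<subseteq> X"
  using clusteringD(4)[OF cl] by (auto simp: clustered_def)

lemma draws_check_identity:
  assumes "set_pmf \<mu> \<subseteq> X"
  shows "draws (\<lambda>_. clustered C \<mu>) (label C) check_identity (map_pmf (\<lambda>x. wide (own_cell C x)) \<mu>)"
  unfolding draws_def check_identity_def run.simps bind_map_pmf
  by (intro allI run_sample_learn[OF assms])

lemma resample_subset:
  assumes "set_pmf \<nu> \<subseteq> X" "x \<in> X"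
  shows "set_pmf (resample \<nu> (label C x) (own_cell C x)) \<subseteq> own_cell C x"
  using clusteringD(3)[OF cl assms(2)] by (auto simp: resample_def)

lemma draws_pair_identity:
  assumes \<mu>: "set_pmf \<mu> \<subseteq> X" and \<nu>: "set_pmf \<nu> \<subseteq> X"
  shows "draws (\<lambda>_. clustered C \<mu>) (label C) (pair_identity \<nu>)
    (pair_pmf (bind_pmf \<mu> (\<lambda>x. resample \<nu> (label C x) (own_cell C x))) \<nu>)"
  unfolding draws_def
proof
  fix g :: "(nat \<Rightarrow> nat) \<times> (nat \<Rightarrow> nat) \<Rightarrow> (unit, nat \<Rightarrow> nat) algo"
  let ?smp = "\<lambda>_. clustered C \<mu>"
  have "run ?smp (label C) (pair_identity \<nu> g) = bind_pmf \<mu> (\<lambda>x. run ?smp (label C)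
      (rand_step X (resample \<nu> (label C x) (own_cell C x)) (\<lambda>u. rand_step X \<nu> (\<lambda>v. g (u, v)))))"
    unfolding pair_identity_def run.simps by (rule run_sample_learn[OF \<mu>])
  also have "\<dots> = bind_pmf \<mu> (\<lambda>x. bind_pmf (resample \<nu> (label C x) (own_cell C x)) (\<lambda>u. bind_pmf \<nu> (\<lambda>v.
      run ?smp (label C) (g (u, v)))))"
  proof (intro bind_pmf_cong refl)
    fix x assume "x \<in> set_pmf \<mu>"
    then have "x \<in> X" using \<mu> by auto
    then have "set_pmf (resample \<nu> (label C x) (own_cell C x)) \<subseteq> X"
      using resample_subset[OF \<nu>] own_cell_subset[OF cl] by blast
    then show "run ?smp (label C) (rand_step X (resample \<nu> (label C x) (own_cell C x)) (\<lambda>u. rand_step X \<nu> (\<lambda>v. g (u, v)))) =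
        bind_pmf (resample \<nu> (label C x) (own_cell C x)) (\<lambda>u. bind_pmf \<nu> (\<lambda>v. run ?smp (label C) (g (u, v))))"
      by (simp add: drawsD[OF draws_rand_step[OF finite_grid]] \<nu>)
  qed
  finally show "run ?smp (label C) (pair_identity \<nu> g) =
      bind_pmf (pair_pmf (bind_pmf \<mu> (\<lambda>x. resample \<nu> (label C x) (own_cell C x))) \<nu>) (\<lambda>b. run ?smp (label C) (g b))"
    by (simp add: pair_pmf_def bind_assoc_pmf bind_return_pmf)
qed

text \<open>The law of total probability over the cells. \<open>bind_cond_pmf_cancel\<close> wants
  the cell as a relation, here equality of labels, so that both conditional masses agree.\<close>

lemma resample_same:
  assumes \<mu>: "set_pmf \<mu> \<subseteq> X"
  shows "bind_pmf \<mu> (\<lambda>x. resample \<mu> (label C x) (own_cell C x)) = \<mu>"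
proof -
  let ?R = "\<lambda>x y. x \<in> X \<and> y \<in> X \<and> label C x = label C y"
  have "bind_pmf \<mu> (\<lambda>x. resample \<mu> (label C x) (own_cell C x)) = bind_pmf \<mu> (\<lambda>x. cond_pmf \<mu> {y. ?R x y})"
  proof (intro bind_pmf_cong refl)
    fix x assume x: "x \<in> set_pmf \<mu>"
    then have xX: "x \<in> X" using \<mu> by auto
    have "own_cell C x = {y. ?R x y}"
      using label_eq_iff[OF cl xX] own_cell_subset[OF cl xX] xX by (auto simp: eq_commute[of "label C x"])
    moreover have "set_pmf \<mu> \<inter> own_cell C x \<noteq> {}"
      using x clusteringD(2)[OF cl xX] by auto
    ultimately show "resample \<mu> (label C x) (own_cell C x) = cond_pmf \<mu> {y. ?R x y}"
      by (simp add: resample_def)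
  qed
  also have "\<dots> = \<mu>"
  proof (rule bind_cond_pmf_cancel)
    fix x y assume "x \<in> set_pmf \<mu>" "y \<in> set_pmf \<mu>" "?R x y"
    then show "measure_pmf.prob \<mu> {y. ?R x y} = measure_pmf.prob \<mu> {x. ?R x y}"
      by (auto intro!: arg_cong[where f = "measure_pmf.prob \<mu>"])
  qed (use \<mu> in auto)
  finally show ?thesis .
qed

lemma draws_check_equivalence:
  assumes \<mu>: "set_pmf \<mu> \<subseteq> X" and \<nu>: "set_pmf \<nu> \<subseteq> X"
  shows "draws (\<lambda>b. clustered C (if b then \<mu> else \<nu>)) (label C) check_equivalence
    (map_pmf (\<lambda>(x, y). wide (own_cell C x) \<or> wide (own_cell C y)) (pair_pmf \<mu> \<nu>))"
  unfolding draws_def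
proof
  fix g :: "bool \<Rightarrow> (bool, nat \<Rightarrow> nat) algo"
  let ?smp = "\<lambda>b. clustered C (if b then \<mu> else \<nu>)"
  have "run ?smp (label C) (check_equivalence g) = bind_pmf \<mu> (\<lambda>x. run ?smp (label C)
      (Sample False (\<lambda>r'. learn_cell n d t r' (\<lambda>S'. g (wide (own_cell C x) \<or> wide S')))))"
    unfolding check_equivalence_def
    by (subst run.simps(2)) (simp only: if_True run_sample_learn[OF \<mu>])
  also have "\<dots> = bind_pmf \<mu> (\<lambda>x. bind_pmf \<nu> (\<lambda>y. run ?smp (label C) (g (wide (own_cell C x) \<or> wide (own_cell C y)))))"
    unfolding run.simps if_False by (intro bind_pmf_cong refl run_sample_learn[OF \<nu>])
  finally show "run ?smp (label C) (check_equivalence g) =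
      bind_pmf (map_pmf (\<lambda>(x, y). wide (own_cell C x) \<or> wide (own_cell C y)) (pair_pmf \<mu> \<nu>)) (\<lambda>b. run ?smp (label C) (g b))"
    by (simp add: bind_map_pmf pair_pmf_def bind_assoc_pmf bind_return_pmf)
qed

lemma draws_pair_equivalence:
  "draws (\<lambda>b. clustered C (if b then \<mu> else \<nu>)) (label C) pair_equivalence (pair_pmf (clustered C \<mu>) (clustered C \<nu>))"
  by (simp add: draws_def pair_equivalence_def pair_pmf_def bind_assoc_pmf bind_return_pmf)

lemma identity_correct:
  assumes \<mu>: "set_pmf \<mu> \<subseteq> X" and \<nu>: "set_pmf \<nu> \<subseteq> X"
  defines "out \<equiv> run (\<lambda>_. clustered C \<mu>) (label C) (identity_algo \<nu>)"
  shows "diam_condition dst \<Delta> \<epsilon> C \<mu> \<Longrightarrow> measure_pmf.prob out {Cluster_Reject} \<le> 1 / 6"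
    and "\<mu> = \<nu> \<Longrightarrow> 5 / 6 \<le> measure_pmf.prob out {Accept, Cluster_Reject}"
    and "\<epsilon> < EMD dst \<mu> \<nu> \<Longrightarrow> 5 / 6 \<le> measure_pmf.prob out {Reject, Cluster_Reject}"
proof -
  let ?K = "\<lambda>x. resample \<nu> (label C x) (own_cell C x)"
  let ?\<mu>' = "bind_pmf \<mu> ?K"
  let ?D = "map_pmf (\<lambda>x. wide (own_cell C x)) \<mu>"
  let ?F = "final_dist k \<nu> m ?\<mu>' far"
  have wide: "measure_pmf.prob ?D {True} = wide_prob C \<mu>"
    by (simp add: vimage_def)
  have K: "set_pmf (?K x) \<subseteq> own_cell C x" if "x \<in> set_pmf \<mu>" for x
    using resample_subset[OF \<nu>] that \<mu> by auto
  have \<mu>': "set_pmf ?\<mu>' \<subseteq> X"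
    using K own_cell_subset[OF cl] \<mu> by fastforce
  note run = guarded_run[OF draws_check_identity[OF \<mu>] draws_rand_step[OF finite_grid \<nu>] draws_pair_identity[OF \<mu> \<nu>],
      of N0 k m far, folded identity_algo_def]
  note prob = guarded_prob[where N = N0 and Dc = ?D and R = ?F, folded run, folded out_def, unfolded wide]
  show "measure_pmf.prob out {Cluster_Reject} \<le> 1 / 6" if "diam_condition dst \<Delta> \<epsilon> C \<mu>"
  proof -
    have "wide_prob C \<mu> \<le> guard_const * \<epsilon>"
      using that by (simp add: diam_condition_def)
    moreover have "0 \<le> wide_prob C \<mu>"
      by simp
    ultimately have "real N0 * wide_prob C \<mu> \<le> 1 / 6"
      by (intro few_wide) linarith+
    with prob(1) show ?thesis
      by linarith
  qed
  show "5 / 6 \<le> measure_pmf.prob out {Accept, Cluster_Reject}" if "\<mu> = \<nu>"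
  proof -
    have "?\<mu>' = \<nu>"
      using resample_same[OF \<mu>] that by simp
    then have "measure_pmf.prob ?F {True} \<le> 1 / 6"
      using far_same[OF \<nu>] by simp
    with prob(2) show ?thesis
      by linarith
  qed
  show "5 / 6 \<le> measure_pmf.prob out {Reject, Cluster_Reject}" if EMD: "\<epsilon> < EMD dst \<mu> \<nu>"
  \<comment> \<open>Either the checks catch the wide cells, or moving points inside cells is cheap
    and the comparison catches the distance.\<close>
  proof (cases "\<epsilon> / 16 < wide_prob C \<mu>")
    case True
    have "(1 - wide_prob C \<mu>) ^ N0 * measure_pmf.prob ?F {False} \<le> 1 / 6 * 1"
      by (intro mult_mono many_wide True) auto
    with prob(3) show ?thesis
      by linarith
  next
    case False
    define P where "P = bind_pmf \<mu> (\<lambda>x. map_pmf (Pair x) (?K x))"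
    \<comment> \<open>The known distribution represents itself, at cost 0.\<close>
    define Q where "Q = map_pmf (\<lambda>x. (x, x)) \<nu>"
    have P: "set_pmf P \<subseteq> X \<times> X" "expect P (\<lambda>(x, y). dst x y) \<le> 3 * \<epsilon> / 16" "map_pmf fst P = \<mu>" "map_pmf snd P = ?\<mu>'"
      unfolding P_def using False by (intro representative_cost[OF cl \<mu> K]; simp)+
    have Q: "set_pmf Q \<subseteq> X \<times> X" "expect Q (\<lambda>(x, y). dst x y) \<le> 3 * \<epsilon> / 16" "map_pmf fst Q = \<nu>" "map_pmf snd Q = \<nu>"
      using \<nu> \<epsilon>_pos by (auto simp: Q_def pmf.map_comp o_def ndist_self[OF p])
    obtain l where l: "l \<in> {1..L}" "2 ^ l * \<epsilon> / (4 * real L) \<le> (\<Sum>c\<in>subcubes d l.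
        \<bar>measure_pmf.prob ?\<mu>' {x. subcube n d l x = c} - measure_pmf.prob \<nu> {x. subcube n d l x = c}\<bar>)"
      using level_of_EMD[OF P(1) Q(1) P(2) Q(2)] EMD unfolding P Q by blast
    have "(1 - wide_prob C \<mu>) ^ N0 * measure_pmf.prob ?F {False} \<le> 1 * (1 / 6)"
      by (intro mult_mono far_different[OF \<mu>' \<nu> l] power_le_one) auto
    with prob(3) show ?thesis
      by linarith
  qed
qed

lemma equivalence_correct:
  assumes \<mu>: "set_pmf \<mu> \<subseteq> X" and \<nu>: "set_pmf \<nu> \<subseteq> X"
  defines "out \<equiv> run (\<lambda>b. clustered C (if b then \<mu> else \<nu>)) (label C) equivalence_algo"
  shows "diam_condition dst \<Delta> \<epsilon> C \<mu> \<Longrightarrow> diam_condition dst \<Delta> \<epsilon> C \<nu> \<Longrightarrow> measure_pmf.prob out {Cluster_Reject} \<le> 1 / 6"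
    and "\<mu> = \<nu> \<Longrightarrow> 5 / 6 \<le> measure_pmf.prob out {Accept, Cluster_Reject}"
    and "\<epsilon> < EMD dst \<mu> \<nu> \<Longrightarrow> 5 / 6 \<le> measure_pmf.prob out {Reject, Cluster_Reject}"
proof -
  let ?w = "\<lambda>x. wide (own_cell C x)"
  let ?D = "map_pmf (\<lambda>(x, y). ?w x \<or> ?w y) (pair_pmf \<mu> \<nu>)"
  let ?F = "final_dist k (clustered C \<nu>) m (clustered C \<mu>) far"
  let ?\<beta> = "measure_pmf.prob ?D {True}"
  have vim: "(\<lambda>(x, y). ?w x \<or> ?w y) -` {True} = fst -` {x. ?w x} \<union> snd -` {y. ?w y}"
    by (rule set_eqI) (simp add: split_beta)
  have margin: "wide_prob C \<mu> = measure_pmf.prob (pair_pmf \<mu> \<nu>) (fst -` {x. ?w x})"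
    "wide_prob C \<nu> = measure_pmf.prob (pair_pmf \<mu> \<nu>) (snd -` {x. ?w x})"
    by (simp_all only: measure_map_pmf[symmetric] map_fst_pair_pmf map_snd_pair_pmf)
  \<comment> \<open>The union bound serves the guard condition; the bounds from below show that few
    alarms mean little wide mass under both distributions.\<close>
  have \<beta>_le: "?\<beta> \<le> wide_prob C \<mu> + wide_prob C \<nu>"
    unfolding margin measure_map_pmf vim by (rule measure_Un_le) auto
  have \<beta>_ge: "wide_prob C \<mu> \<le> ?\<beta>" "wide_prob C \<nu> \<le> ?\<beta>"
    unfolding margin measure_map_pmf vim by (rule measure_pmf.finite_measure_mono; simp)+
  have draw_F: "draws (\<lambda>b. clustered C (if b then \<mu> else \<nu>)) (label C) (Sample False) (clustered C \<nu>)"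
    by (simp add: draws_def)
  note run = guarded_run[OF draws_check_equivalence[OF \<mu> \<nu>] draw_F draws_pair_equivalence,
      of N0 k m far, folded equivalence_algo_def]
  note prob = guarded_prob[where N = N0 and Dc = ?D and R = ?F, folded run, folded out_def]
  show "measure_pmf.prob out {Cluster_Reject} \<le> 1 / 6"
    if "diam_condition dst \<Delta> \<epsilon> C \<mu>" "diam_condition dst \<Delta> \<epsilon> C \<nu>"
  proof -
    have "?\<beta> \<le> 2 * (guard_const * \<epsilon>)"
      using that \<beta>_le unfolding diam_condition_def by linarith
    then have "real N0 * ?\<beta> \<le> 1 / 6"
      by (rule few_wide) (rule measure_nonneg)
    with prob(1) show ?thesis
      by linarith
  qed
  show "5 / 6 \<le> measure_pmf.prob out {Accept, Cluster_Reject}" if "\<mu> = \<nu>"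
  proof -
    have "measure_pmf.prob ?F {True} \<le> 1 / 6"
      using far_same[OF clustered_subset[OF \<nu>]] that by simp
    with prob(2) show ?thesis
      by linarith
  qed
  show "5 / 6 \<le> measure_pmf.prob out {Reject, Cluster_Reject}" if EMD: "\<epsilon> < EMD dst \<mu> \<nu>"
  proof (cases "\<epsilon> / 16 < ?\<beta>")
    case True
    have "(1 - ?\<beta>) ^ N0 * measure_pmf.prob ?F {False} \<le> 1 / 6 * 1"
      by (intro mult_mono many_wide True measure_pmf.prob_le_1 measure_nonneg) simp
    with prob(3) show ?thesis
      by linarith
  next
    case False
    let ?P = "\<lambda>\<mu>. bind_pmf \<mu> (\<lambda>x. map_pmf (Pair x) (return_pmf (label C x)))"
    have sub_\<mu>: "set_pmf (return_pmf (label C x)) \<subseteq> own_cell C x" if "x \<in> set_pmf \<mu>" for x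
      using clusteringD(3)[OF cl, of x] that \<mu> by auto
    have sub_\<nu>: "set_pmf (return_pmf (label C x)) \<subseteq> own_cell C x" if "x \<in> set_pmf \<nu>" for x
      using clusteringD(3)[OF cl, of x] that \<nu> by auto
    have wides: "wide_prob C \<mu> \<le> \<epsilon> / 16" "wide_prob C \<nu> \<le> \<epsilon> / 16"
      using False \<beta>_ge by linarith+
    have bind_label: "bind_pmf \<rho> (\<lambda>x. return_pmf (label C x)) = clustered C \<rho>" for \<rho>
      by (simp add: clustered_def map_pmf_def)
    have P: "set_pmf (?P \<mu>) \<subseteq> X \<times> X" "expect (?P \<mu>) (\<lambda>(x, y). dst x y) \<le> 3 * \<epsilon> / 16"
      "map_pmf fst (?P \<mu>) = \<mu>" "map_pmf snd (?P \<mu>) = clustered C \<mu>"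
      unfolding bind_label[symmetric] by (intro representative_cost[OF cl \<mu>] sub_\<mu> wides; assumption)+
    have Q: "set_pmf (?P \<nu>) \<subseteq> X \<times> X" "expect (?P \<nu>) (\<lambda>(x, y). dst x y) \<le> 3 * \<epsilon> / 16"
      "map_pmf fst (?P \<nu>) = \<nu>" "map_pmf snd (?P \<nu>) = clustered C \<nu>"
      unfolding bind_label[symmetric] by (intro representative_cost[OF cl \<nu>] sub_\<nu> wides; assumption)+
    obtain l where l: "l \<in> {1..L}" "2 ^ l * \<epsilon> / (4 * real L) \<le> (\<Sum>c\<in>subcubes d l.
        \<bar>measure_pmf.prob (clustered C \<mu>) {x. subcube n d l x = c} - measure_pmf.prob (clustered C \<nu>) {x. subcube n d l x = c}\<bar>)"
      using level_of_EMD[OF P(1) Q(1) P(2) Q(2)] EMD unfolding P(3) Q(3) P(4) Q(4) by blast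
    have "(1 - ?\<beta>) ^ N0 * measure_pmf.prob ?F {False} \<le> 1 * (1 / 6)"
      by (intro mult_mono far_different[OF clustered_subset[OF \<mu>] clustered_subset[OF \<nu>] l] power_le_one) auto
    with prob(3) show ?thesis
      by linarith
  qed
qed

end

lemma identity_algo_tester:
  assumes "set_pmf \<nu> \<subseteq> X"
  shows "identity_tester X dst (box_clusterings n d) (box_clusterings n d) \<Delta> \<epsilon> \<nu> (identity_algo \<nu>)"
  unfolding identity_tester_def Let_def using identity_correct[OF _ _ assms] by blast

lemma equivalence_algo_tester:
  "equivalence_tester X dst (box_clusterings n d) (box_clusterings n d) \<Delta> \<epsilon> equivalence_algo"
  unfolding equivalence_tester_def Let_def using equivalence_correct by blast

end

section \<open>Sample and query bounds\<close>

text \<open>The worst level is the finest for \<open>a \<ge> 0\<close> and the coarsest for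
  \<open>a < 0\<close>; \<open>max 0 a\<close> treats both at once. The factor \<open>8 ^ d\<close>
  comes from \<open>2 ^ l \<le> 8 / \<epsilon>\<close>.\<close>

lemma two_powr_level_le:
  fixes \<epsilon> a e :: real
  assumes \<epsilon>: "0 < \<epsilon>" "\<epsilon> < 1" and l: "2 ^ l \<le> 8 / \<epsilon>" and a: "a \<le> real d" "a \<le> e - 2" "2 \<le> e"
  shows "2 powr (real l * a) \<le> 8 ^ d * (1 / \<epsilon>) powr e * \<epsilon>\<^sup>2"
proof -
  define c where "c = max 0 a"
  have c: "0 \<le> c" "a \<le> c" "c \<le> real d" "c \<le> e - 2"
    using a by (auto simp: c_def)
  have "2 powr (real l * a) \<le> 2 powr (real l * c)"
    using c by (intro powr_mono mult_left_mono) auto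
  also have "\<dots> = (2 powr real l) powr c"
    by (simp only: powr_powr)
  also have "\<dots> = (2 ^ l) powr c"
    by (simp add: powr_realpow)
  also have "\<dots> \<le> (8 / \<epsilon>) powr c"
    using l c by (intro powr_mono2) auto
  also have "\<dots> = 8 powr c * (1 / \<epsilon>) powr c"
    by (simp add: powr_mult[symmetric])
  also have "\<dots> \<le> 8 powr real d * (1 / \<epsilon>) powr (e - 2)"
    using c \<epsilon> by (intro mult_mono powr_mono) auto
  also have "(1 / \<epsilon>) powr (e - 2) = (1 / \<epsilon>) powr e * \<epsilon>\<^sup>2"
    using \<epsilon> by (simp add: powr_diff powr_numeral power_divide)
  finally show ?thesis
    by (simp add: powr_realpow mult.assoc)
qed

text \<open>Condenses the sample condition of all levels into one number \<open>G\<close>. The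
  constant is 5000 * 5 * 32; the factors \<open>L\<close> are one explicit, one from
  \<open>sqrt (24 * L) \<le> 5 * L\<close>, and two from the squared threshold.\<close>

lemma level_test_subcubes:
  fixes \<epsilon> G :: real
  assumes \<epsilon>: "0 < \<epsilon>" "\<epsilon> < 1" and n: "1 \<le> n" and L: "1 \<le> L" "2 ^ L \<le> 8 / \<epsilon>" and k: "0 < k"
    and G: "\<And>l. l \<in> {1..L} \<Longrightarrow> 2 ^ (l * d) / (sqrt (min (real k) (2 ^ (l * d))) * 4 ^ l) \<le> G * \<epsilon>\<^sup>2"
    and m: "800000 * real L ^ 4 * G \<le> real m"
  shows "level_test (subcube n d) (subcubes d) (\<lambda>l. 2 ^ (l * d)) (\<lambda>l. 2 ^ l * \<epsilon> / (4 * real L)) (grid n d) L k m"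
proof
  fix l assume l: "l \<in> {1..L}"
  show "0 < 2 ^ l * \<epsilon> / (4 * real L)"
    using \<epsilon> L by simp
  have "2 ^ l * \<epsilon> \<le> 2 ^ L * \<epsilon>"
    using l \<epsilon> by (intro mult_right_mono power_increasing) auto
  also have "\<dots> \<le> 8"
    using L(2) \<epsilon> by (simp add: field_simps)
  finally have "2 ^ l * \<epsilon> \<le> 8 * real L"
    using L(1) by linarith
  then show "2 ^ l * \<epsilon> / (4 * real L) \<le> 2"
    using L(1) by (simp add: divide_le_eq)
  define N \<mu> :: real where "N = 2 ^ (l * d)" and "\<mu> = min (real k) N"
  have N: "0 < N" and \<mu>: "0 < \<mu>"
    using k by (auto simp: N_def \<mu>_def)
  have "24 * real L \<le> (5 * real L)\<^sup>2"
    using L(1) by (simp add: power2_eq_square)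
  then have "sqrt (24 * real L / \<mu>) \<le> 5 * real L / sqrt \<mu>"
    unfolding real_sqrt_divide using \<mu> by (intro divide_right_mono real_le_lsqrt) auto
  then have "5000 * real L * sqrt (24 * real L / \<mu>) \<le> 5000 * real L * (5 * real L / sqrt \<mu>)"
    by (intro mult_left_mono) auto
  also have "\<dots> = (800000 * real L ^ 4 * (N / (sqrt \<mu> * 4 ^ l))) * (4 ^ l / (32 * (real L)\<^sup>2 * N))"
    using N \<mu> L(1) by (simp add: field_simps power2_eq_square power4_eq_xxxx)
  also have "\<dots> \<le> (800000 * real L ^ 4 * (G * \<epsilon>\<^sup>2)) * (4 ^ l / (32 * (real L)\<^sup>2 * N))"
    using G[OF l] N by (intro mult_right_mono mult_left_mono) (auto simp: N_def \<mu>_def)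
  also have "\<dots> = (800000 * real L ^ 4 * G) * (\<epsilon>\<^sup>2 * 4 ^ l / (32 * (real L)\<^sup>2 * N))"
    by simp
  also have "\<dots> \<le> real m * (\<epsilon>\<^sup>2 * 4 ^ l / (32 * (real L)\<^sup>2 * N))"
    using m N by (intro mult_right_mono) auto
  also have "\<epsilon>\<^sup>2 * 4 ^ l / (32 * (real L)\<^sup>2 * N) = (2 ^ l * \<epsilon> / (4 * real L))\<^sup>2 / (2 * N)"
  proof -
    have "(4::real) ^ l = 2 ^ l * 2 ^ l"
      by (simp add: power_mult_distrib[symmetric])
    then show ?thesis
      by (simp add: power2_eq_square mult_ac)
  qed
  finally show "5000 * real L * sqrt (24 * real L / min (real k) (2 ^ (l * d))) \<le>
      real m * ((2 ^ l * \<epsilon> / (4 * real L))\<^sup>2 / (2 * 2 ^ (l * d)))"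
    by (simp add: N_def \<mu>_def)
qed (use n L k in \<open>simp_all add: finite_grid finite_subcubes subcube_in card_subcubes\<close>)

lemma two_powr_split:
  "2 ^ (l * d) / (sqrt (2 ^ (l * d)) * 4 ^ l) = 2 powr (real l * (real d / 2 - 2))"
  "2 ^ (l * d) / 4 ^ l = 2 powr (real l * (real d - 2))"
proof -
  have N: "(2::real) ^ (l * d) = 2 powr (real l * real d)"
    by (simp add: powr_realpow[symmetric])
  have four: "(4::real) ^ l = 2 powr (real l * 2)"
  proof -
    have "(4::real) ^ l = (2 ^ 2) ^ l"
      by simp
    also have "\<dots> = 2 ^ (2 * l)"
      by (rule power_mult[symmetric])
    also have "\<dots> = 2 powr (real l * 2)"
      by (simp add: powr_realpow[symmetric] mult.commute)
    finally show ?thesis .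
  qed
  have sqrtN: "sqrt (2 powr (real l * real d)) = 2 powr (real l * real d / 2)"
    by (simp add: powr_half_sqrt[symmetric] powr_powr)
  show "2 ^ (l * d) / (sqrt (2 ^ (l * d)) * 4 ^ l) = 2 powr (real l * (real d / 2 - 2))"
    unfolding N four sqrtN powr_add[symmetric] powr_diff[symmetric]
    by (rule arg_cong[where f = "\<lambda>x. 2 powr x"]) (simp add: algebra_simps)
  show "2 ^ (l * d) / 4 ^ l = 2 powr (real l * (real d - 2))"
    unfolding N four powr_diff[symmetric]
    by (rule arg_cong[where f = "\<lambda>x. 2 powr x"]) (simp add: algebra_simps)
qed

text \<open>With as many flattening samples as finest subcubes, the minimum is the number of
  subcubes at every level.\<close>

lemma identity_level_bound:
  fixes \<epsilon> :: real
  assumes "0 < \<epsilon>" "\<epsilon> < 1" "2 ^ L \<le> 8 / \<epsilon>" "l \<in> {1..L}"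
  shows "2 ^ (l * d) / (sqrt (min (real (2 ^ (L * d))) (2 ^ (l * d))) * 4 ^ l) \<le>
    8 ^ d * (1 / \<epsilon>) powr max 2 (real d / 2) * \<epsilon>\<^sup>2"
proof -
  have "(2::real) ^ (l * d) \<le> 2 ^ (L * d)"
    using assms by (intro power_increasing mult_right_mono) auto
  then have min: "min (real (2 ^ (L * d))) (2 ^ (l * d)) = 2 ^ (l * d)"
    by (intro min_absorb2) simp
  have "(2::real) ^ l \<le> 2 ^ L"
    using assms by (intro power_increasing) auto
  with assms(3) have "(2::real) ^ l \<le> 8 / \<epsilon>"
    by (rule order_trans[rotated])
  then show ?thesis
    unfolding min two_powr_split(1) using assms by (intro two_powr_level_le) auto
qed

text \<open>The inverse root of the minimum is at most the sum of both inverse roots. The term with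
  \<open>k\<close> is bounded using the exponent \<open>3 * e / 2 \<ge> d\<close>; dividing by
  \<open>sqrt k\<close> takes off \<open>e / 2\<close> and leaves \<open>e\<close>.\<close>

lemma equivalence_level_bound:
  fixes \<epsilon> :: real and d :: nat
  assumes \<epsilon>: "0 < \<epsilon>" "\<epsilon> < 1" and "2 ^ L \<le> 8 / \<epsilon>" "l \<in> {1..L}"
  defines "e \<equiv> max 2 (2 * real d / 3)"
  assumes k: "(1 / \<epsilon>) powr e \<le> real k"
  shows "2 ^ (l * d) / (sqrt (min (real k) (2 ^ (l * d))) * 4 ^ l) \<le> 2 * 8 ^ d * (1 / \<epsilon>) powr e * \<epsilon>\<^sup>2"
proof -
  let ?N = "2 ^ (l * d) :: real"
  have k_pos: "0 < real k"
    using k \<epsilon> by (smt (verit) powr_gt_zero divide_pos_pos)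
  have "(2::real) ^ l \<le> 2 ^ L"
    using assms by (intro power_increasing) auto
  with assms(3) have l: "(2::real) ^ l \<le> 8 / \<epsilon>"
    by (rule order_trans[rotated])
  have "?N / (sqrt (min (real k) ?N) * 4 ^ l) \<le> ?N / (sqrt ?N * 4 ^ l) + ?N / 4 ^ l / sqrt (real k)"
    using k_pos by (auto simp: min_def field_simps)
  also have "?N / (sqrt ?N * 4 ^ l) \<le> 8 ^ d * (1 / \<epsilon>) powr e * \<epsilon>\<^sup>2"
    unfolding two_powr_split using \<epsilon> l by (intro two_powr_level_le) (auto simp: e_def)
  also have "?N / 4 ^ l / sqrt (real k) \<le> (8 ^ d * (1 / \<epsilon>) powr (3 * e / 2) * \<epsilon>\<^sup>2) / sqrt ((1 / \<epsilon>) powr e)"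
    unfolding two_powr_split using \<epsilon> l k
    by (intro frac_le two_powr_level_le real_sqrt_le_mono) (auto simp: e_def)
  also have "\<dots> = 8 ^ d * (1 / \<epsilon>) powr e * \<epsilon>\<^sup>2"
  proof -
    have "(1 / \<epsilon>) powr (3 * e / 2) = (1 / \<epsilon>) powr e * (1 / \<epsilon>) powr (e / 2)"
      by (simp add: powr_add[symmetric])
    moreover have "sqrt ((1 / \<epsilon>) powr e) = (1 / \<epsilon>) powr (e / 2)"
      using \<epsilon> by (simp add: powr_half_sqrt[symmetric] powr_powr)
    moreover have "0 < (1 / \<epsilon>) powr (e / 2)"
      using \<epsilon> by simp
    ultimately show ?thesis
      by simp
  qed
  finally show ?thesis
    by (simp add: mult_ac)
qed

section \<open>Choice of levels, search depth and sample numbers\<close>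

lemma obtain_levels:
  fixes \<epsilon> :: real
  assumes \<epsilon>: "0 < \<epsilon>" "\<epsilon> < 1"
  obtains L :: nat where "1 \<le> L" "4 / \<epsilon> \<le> 2 ^ L" "2 ^ L \<le> 8 / \<epsilon>" "real L \<le> 5 * ln (exp 1 + 1 / \<epsilon>)"
proof -
  define L where "L = nat \<lceil>log 2 (4 / \<epsilon>)\<rceil>"
  have "log 2 4 \<le> log 2 (4 / \<epsilon>)"
    using \<epsilon> by (intro log_mono) (auto simp: field_simps)
  moreover have "log 2 (4::real) = 2"
    using log_pow_cancel[of 2 2] by simp
  ultimately have big: "2 \<le> log 2 (4 / \<epsilon>)"
    by simp
  then have L: "log 2 (4 / \<epsilon>) \<le> real L" "real L \<le> log 2 (4 / \<epsilon>) + 1"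
    unfolding L_def by linarith+
  have pow: "(2::real) ^ L = 2 powr real L"
    by (simp add: powr_realpow)
  have "4 / \<epsilon> = 2 powr log 2 (4 / \<epsilon>)"
    using \<epsilon> by simp
  also have "\<dots> \<le> 2 ^ L"
    unfolding pow using L by (intro powr_mono) auto
  finally have low: "4 / \<epsilon> \<le> 2 ^ L" .
  have "2 ^ L \<le> 2 powr (log 2 (4 / \<epsilon>) + 1)"
    unfolding pow using L by (intro powr_mono) auto
  also have "\<dots> = 8 / \<epsilon>"
    using \<epsilon> by (simp add: powr_add)
  finally have high: "2 ^ L \<le> 8 / \<epsilon>" .
  have "ln 1 \<le> ln (1 / \<epsilon>)" "ln (1 / \<epsilon>) \<le> ln (exp 1 + 1 / \<epsilon>)"
    using \<epsilon> by (intro ln_mono; simp add: add_pos_pos field_simps)+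
  moreover have "ln (exp 1) \<le> ln (exp 1 + 1 / \<epsilon>)"
    using \<epsilon> by (intro ln_mono) (auto simp: add_pos_pos)
  moreover have "real L \<le> 3 + 3 / 2 * ln (1 / \<epsilon>)"
  proof -
    have "log 2 (4 / \<epsilon>) = 2 + log 2 (1 / \<epsilon>)"
      using \<epsilon> \<open>log 2 4 = 2\<close> by (simp add: log_divide)
    moreover have "log 2 (1 / \<epsilon>) \<le> ln (1 / \<epsilon>) / (2 / 3)"
      unfolding log_def using calculation \<open>ln 1 \<le> ln (1 / \<epsilon>)\<close> ln2_ge_two_thirds
      by (intro divide_left_mono) auto
    ultimately show ?thesis
      using L(2) by simp
  qed
  ultimately have "real L \<le> 5 * ln (exp 1 + 1 / \<epsilon>)"
    by simp
  then show thesis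
    using big L(1) low high by (intro that[of L]) auto
qed

lemma obtain_search_depth:
  assumes "1 \<le> n"
  obtains t :: nat where "n \<le> 2 ^ t" "real t \<le> 3 * ln (real n)"
\<comment> \<open>For \<open>n = 1\<close> the bound is 0 and no query may be spent; otherwise
  \<open>log 2 n \<ge> 1\<close> absorbs the rounding.\<close>
proof (cases "n = 1")
  case True
  then show ?thesis
    by (intro that[of 0]) auto
next
  case False
  with assms have n: "2 \<le> real n"
    by simp
  define t where "t = nat \<lceil>log 2 (real n)\<rceil>"
  have log_n: "1 \<le> log 2 (real n)"
    using n by (simp add: le_log_iff)
  then have t: "log 2 (real n) \<le> real t" "real t \<le> log 2 (real n) + 1"
    unfolding t_def by linarith+
  have "real n = 2 powr log 2 (real n)"
    using n by simp
  also have "\<dots> \<le> 2 powr real t"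
    using t by (intro powr_mono) auto
  also have "\<dots> = real (2 ^ t)"
    by (simp add: powr_realpow)
  finally have "n \<le> 2 ^ t"
    by (simp only: of_nat_le_iff)
  moreover have "real t \<le> 3 * ln (real n)"
  proof -
    have "real t \<le> 2 * log 2 (real n)"
      using t log_n by simp
    also have "log 2 (real n) \<le> ln (real n) / (2 / 3)"
      unfolding log_def using n ln2_ge_two_thirds by (intro divide_left_mono) auto
    finally show ?thesis
      by simp
  qed
  ultimately show ?thesis
    by (rule that)
qed

lemma obtain_checks:
  fixes \<epsilon> :: real
  assumes "0 < \<epsilon>" "\<epsilon> < 1"
  obtains N0 :: nat where "16 * ln 24 / \<epsilon> \<le> real N0" "real N0 \<le> 32 * ln 24 / \<epsilon>" "real N0 \<le> 160 / \<epsilon>"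
proof -
  define N0 where "N0 = nat \<lceil>16 * ln 24 / \<epsilon>\<rceil>"
  have "ln (exp 1) \<le> ln (24::real)"
    using exp_le by (intro ln_mono) auto
  then have ln24: "1 \<le> ln (24::real)"
    by simp
  have "ln (24::real) \<le> ln (2 ^ 5)"
    by simp
  also have "\<dots> = 5 * ln (2::real)"
    by (subst ln_realpow) simp_all
  finally have "ln (24::real) \<le> 5"
    using ln_2_less_1 by simp
  have "16 * 1 / 1 \<le> 16 * ln 24 / \<epsilon>"
    using ln24 assms by (intro frac_le mult_left_mono) auto
  then have "16 * ln 24 / \<epsilon> \<le> real N0" and up: "real N0 \<le> 2 * (16 * ln 24 / \<epsilon>)"
    unfolding N0_def by linarith+
  moreover have "32 * ln 24 / \<epsilon> \<le> 160 / \<epsilon>"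
    using \<open>ln 24 \<le> 5\<close> assms by (intro divide_right_mono) auto
  ultimately show thesis
    by (intro that[of N0]) auto
qed

lemma obtain_pairs:
  fixes G \<eta> :: real
  assumes "1 \<le> G" "1 \<le> L" "real L \<le> 5 * \<eta>"
  obtains m :: nat where "800000 * real L ^ 4 * G \<le> real m" "real m \<le> 600000000 * (G * \<eta> ^ 4)"
proof -
  define m where "m = nat \<lceil>800000 * real L ^ 4 * G\<rceil>"
  have "1 * 1 \<le> real L ^ 4 * G"
    using assms by (intro mult_mono one_le_power) auto
  then have LG: "1 \<le> real L ^ 4 * G"
    by simp
  then have m: "800000 * real L ^ 4 * G \<le> real m" "real m \<le> 800001 * (real L ^ 4 * G)"
    unfolding m_def by linarith+
  have "real L ^ 4 * G \<le> (5 * \<eta>) ^ 4 * G"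
    using assms by (intro mult_right_mono power_mono) auto
  also have "\<dots> = 625 * (G * \<eta> ^ 4)"
    by (simp add: power_mult_distrib)
  finally have "real m \<le> 600000000 * (G * \<eta> ^ 4)"
    using m(2) LG by linarith
  with m(1) show thesis
    by (rule that)
qed

text \<open>\<open>2 powr (3 * d)\<close> is the \<open>8 ^ d\<close> of the level bounds, and the
  fourth power of the logarithm comes from \<open>L ^ 4\<close>. The constant covers the larger
  case, equivalence: four times 1200000000, plus checks and flattening.\<close>

definition sample_bound :: "(nat \<Rightarrow> real) \<Rightarrow> nat \<Rightarrow> real \<Rightarrow> real" where
  "sample_bound e d \<epsilon> = 2 powr (3 * real d) * (10 ^ 10 * (1 / \<epsilon>) powr e d * ln (exp 1 + 1 / \<epsilon>) ^ 4)"

lemma ln_offset_ge_1: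
  fixes \<epsilon> :: real
  assumes "0 < \<epsilon>"
  shows "1 \<le> ln (exp 1 + 1 / \<epsilon>)"
proof -
  have "ln (exp 1) \<le> ln (exp 1 + 1 / \<epsilon>)"
    using assms by (intro ln_mono) (auto simp: add_pos_pos)
  then show ?thesis
    by simp
qed

lemma sample_bound_nonneg: "0 < \<epsilon> \<Longrightarrow> 0 \<le> sample_bound e d \<epsilon>"
  using ln_offset_ge_1[of \<epsilon>] by (simp add: sample_bound_def)

lemma exp_soft_O_sample_bound: "exp_soft_O e (sample_bound e)"
  unfolding exp_soft_O_def
  by (intro exI[of _ 3] exI[of _ "10 ^ 10"] exI[of _ 4] allI impI)
    (use sample_bound_nonneg in \<open>simp add: sample_bound_def\<close>)

lemma sample_bound_eq:
  "sample_bound e d \<epsilon> = 10 ^ 10 * (8 ^ d * (1 / \<epsilon>) powr e d * ln (exp 1 + 1 / \<epsilon>) ^ 4)"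
proof -
  have "2 powr (3 * real d) = (2 powr 3) powr real d"
    by (simp only: powr_powr)
  also have "\<dots> = 8 ^ d"
    by (simp add: powr_realpow powr_numeral)
  finally show ?thesis
    unfolding sample_bound_def by simp
qed

lemma inverse_le_sample:
  fixes \<epsilon> :: real
  assumes \<epsilon>: "0 < \<epsilon>" "\<epsilon> < 1" and e: "2 \<le> e d"
  shows "1 / \<epsilon> \<le> 8 ^ d * (1 / \<epsilon>) powr e d * ln (exp 1 + 1 / \<epsilon>) ^ 4"
    and "(1 / \<epsilon>) powr e d \<le> 8 ^ d * (1 / \<epsilon>) powr e d * ln (exp 1 + 1 / \<epsilon>) ^ 4"
    and "1 \<le> 8 ^ d * (1 / \<epsilon>) powr e d"
proof -
  have "1 * (1 / \<epsilon>) powr e d * 1 \<le> 8 ^ d * (1 / \<epsilon>) powr e d * ln (exp 1 + 1 / \<epsilon>) ^ 4"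
    using ln_offset_ge_1[OF \<epsilon>(1)] by (intro mult_mono one_le_power) auto
  then show main: "(1 / \<epsilon>) powr e d \<le> 8 ^ d * (1 / \<epsilon>) powr e d * ln (exp 1 + 1 / \<epsilon>) ^ 4"
    by simp
  have powr: "(1 / \<epsilon>) powr 1 \<le> (1 / \<epsilon>) powr e d"
    using \<epsilon> e by (intro powr_mono) auto
  then have inv: "1 / \<epsilon> \<le> (1 / \<epsilon>) powr e d"
    using \<epsilon> by simp
  with main show "1 / \<epsilon> \<le> 8 ^ d * (1 / \<epsilon>) powr e d * ln (exp 1 + 1 / \<epsilon>) ^ 4"
    by linarith
  have "1 \<le> 1 / \<epsilon>"
    using \<epsilon> by simp
  then have "1 * 1 \<le> 8 ^ d * (1 / \<epsilon>) powr e d"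
    using inv by (intro mult_mono) auto
  then show "1 \<le> 8 ^ d * (1 / \<epsilon>) powr e d"
    by simp
qed

text \<open>Settles \<open>\<epsilon> \<ge> 1\<close>: nothing is farther than
  \<open>\<epsilon>\<close>, so accepting without any oracle call is a valid tester.\<close>

lemma EMD_le_1:
  assumes "1 \<le> p" "1 \<le> n" "1 \<le> d" "set_pmf \<mu> \<subseteq> grid n d" "set_pmf \<nu> \<subseteq> grid n d"
  shows "EMD (ndist p n d) \<mu> \<nu> \<le> 1"
proof -
  have "EMD (ndist p n d) \<mu> \<nu> \<le> expect (pair_pmf \<mu> \<nu>) (\<lambda>(x, y). ndist p n d x y)"
    by (rule EMD_le_expect) (auto simp: couplings_def map_fst_pair_pmf map_snd_pair_pmf ndist_nonneg)
  also have "\<dots> \<le> expect (pair_pmf \<mu> \<nu>) (\<lambda>_. 1)"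
    using assms finite_subset[OF _ finite_grid]
    by (intro expect_mono) (auto intro!: ndist_grid_le_1)
  finally show ?thesis
    by simp
qed

lemma identity_tester_exists:
  assumes n: "1 \<le> n" and d: "1 \<le> d" and p: "1 \<le> p" and \<Delta>: "0 < 8 * \<Delta>" "8 * \<Delta> \<le> \<epsilon>" and \<nu>: "set_pmf \<nu> \<subseteq> grid n d"
  defines "M \<equiv> sample_bound (\<lambda>d. max 2 (real d / 2)) d \<epsilon>"
  shows "\<exists>T s q. identity_tester (grid n d) (ndist p n d) (box_clusterings n d) (box_clusterings n d) \<Delta> \<epsilon> \<nu> T \<and>
    uses_at_most (grid n d) T s q \<and> real s \<le> M \<and> real q \<le> 6 * (M * (real d * ln (real n)))"
proof (cases "\<epsilon> < 1")
  case False
  have pos: "0 < \<epsilon>"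
    using \<Delta> by linarith
  have "identity_tester (grid n d) (ndist p n d) (box_clusterings n d) (box_clusterings n d) \<Delta> \<epsilon> \<nu> (Output Accept)"
    using EMD_le_1[OF p n d _ \<nu>] False unfolding identity_tester_def by fastforce
  then show ?thesis
    using n sample_bound_nonneg[OF pos] by (intro exI[of _ "Output Accept"] exI[of _ 0]) (auto simp: M_def)
next
  case True
  have \<epsilon>: "0 < \<epsilon>" "\<epsilon> < 1"
    using True \<Delta> by auto
  let ?e = "\<lambda>d. max 2 (real d / 2)"
  let ?G = "8 ^ d * (1 / \<epsilon>) powr ?e d"
  note G = inverse_le_sample[OF \<epsilon>, of ?e d]
  obtain L where L: "1 \<le> L" "4 / \<epsilon> \<le> 2 ^ L" "2 ^ L \<le> 8 / \<epsilon>" "real L \<le> 5 * ln (exp 1 + 1 / \<epsilon>)"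
    by (rule obtain_levels[OF \<epsilon>])
  obtain t where t: "n \<le> 2 ^ t" "real t \<le> 3 * ln (real n)"
    by (rule obtain_search_depth[OF n])
  obtain N0 :: nat where checks: "16 * ln 24 / \<epsilon> \<le> real N0" "real N0 \<le> 32 * ln 24 / \<epsilon>" "real N0 \<le> 160 / \<epsilon>"
    by (rule obtain_checks[OF \<epsilon>])
  obtain m where m: "800000 * real L ^ 4 * ?G \<le> real m" "real m \<le> 600000000 * (?G * ln (exp 1 + 1 / \<epsilon>) ^ 4)"
    using obtain_pairs[OF G(3) L(1) L(4)] by auto
  \<comment> \<open>The \<open>2 ^ (L * d)\<close> flattening samples come from the known \<nu> and
    enter neither count.\<close>
  interpret lt: level_test "subcube n d" "subcubes d" "\<lambda>l. 2 ^ (l * d)" "\<lambda>l. 2 ^ l * \<epsilon> / (4 * real L)" "grid n d" L "2 ^ (L * d)" m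
    by (rule level_test_subcubes[OF \<epsilon> n L(1) L(3) _ identity_level_bound[OF \<epsilon> L(3)] m(1)]) simp
  interpret gp: guarded_params n d \<epsilon> L "2 ^ (L * d)" m p \<Delta> t N0
    by unfold_locales (use n d p \<Delta> \<epsilon> t L checks in auto)
  have s: "real (N0 + 2 * m) \<le> M"
    using checks(3) m(2) G(1) unfolding M_def sample_bound_eq by simp
  have "real ((N0 + 2 * m) * (d * (2 * t))) = real (N0 + 2 * m) * (real d * (2 * real t))"
    by simp
  also have "\<dots> \<le> M * (real d * (2 * (3 * ln (real n))))"
    using s t(2) sample_bound_nonneg[OF \<epsilon>(1)] unfolding M_def by (intro mult_mono) auto
  finally have q: "real ((N0 + 2 * m) * (d * (2 * t))) \<le> 6 * (M * (real d * ln (real n)))"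
    by (simp add: algebra_simps)
  show ?thesis
    using gp.identity_algo_tester[OF \<nu>] gp.identity_cost[of \<nu>] s q by blast
qed

lemma equivalence_tester_exists:
  assumes n: "1 \<le> n" and d: "1 \<le> d" and p: "1 \<le> p" and \<Delta>: "0 < 8 * \<Delta>" "8 * \<Delta> \<le> \<epsilon>"
  defines "M \<equiv> sample_bound (\<lambda>d. max 2 (2 * real d / 3)) d \<epsilon>"
  shows "\<exists>T s q. equivalence_tester (grid n d) (ndist p n d) (box_clusterings n d) (box_clusterings n d) \<Delta> \<epsilon> T \<and>
    uses_at_most (grid n d) T s q \<and> real s \<le> M \<and> real q \<le> 1920 * (1 / \<epsilon> * (real d * ln (real n)))"
proof (cases "\<epsilon> < 1")
  case False
  have pos: "0 < \<epsilon>"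
    using \<Delta> by linarith
  have "equivalence_tester (grid n d) (ndist p n d) (box_clusterings n d) (box_clusterings n d) \<Delta> \<epsilon> (Output Accept)"
    using EMD_le_1[OF p n d] False unfolding equivalence_tester_def by fastforce
  then show ?thesis
    using n pos sample_bound_nonneg[OF pos] by (intro exI[of _ "Output Accept"] exI[of _ 0]) (auto simp: M_def)
next
  case True
  have \<epsilon>: "0 < \<epsilon>" "\<epsilon> < 1"
    using True \<Delta> by auto
  let ?e = "\<lambda>d. max 2 (2 * real d / 3)"
  let ?G = "8 ^ d * (1 / \<epsilon>) powr ?e d"
  note G = inverse_le_sample[OF \<epsilon>, of ?e d]
  obtain L where L: "1 \<le> L" "4 / \<epsilon> \<le> 2 ^ L" "2 ^ L \<le> 8 / \<epsilon>" "real L \<le> 5 * ln (exp 1 + 1 / \<epsilon>)"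
    by (rule obtain_levels[OF \<epsilon>])
  obtain t where t: "n \<le> 2 ^ t" "real t \<le> 3 * ln (real n)"
    by (rule obtain_search_depth[OF n])
  obtain N0 :: nat where checks: "16 * ln 24 / \<epsilon> \<le> real N0" "real N0 \<le> 32 * ln 24 / \<epsilon>" "real N0 \<le> 160 / \<epsilon>"
    by (rule obtain_checks[OF \<epsilon>])
  have "1 \<le> 2 * 8 ^ d * (1 / \<epsilon>) powr ?e d"
    using G(3) by simp
  then obtain m where m: "800000 * real L ^ 4 * (2 * 8 ^ d * (1 / \<epsilon>) powr ?e d) \<le> real m"
    "real m \<le> 600000000 * (2 * 8 ^ d * (1 / \<epsilon>) powr ?e d * ln (exp 1 + 1 / \<epsilon>) ^ 4)"
    using obtain_pairs[OF _ L(1) L(4)] by blast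
  \<comment> \<open>Flattening samples now count as samples, so their number is set to the leading
    term of the sample bound.\<close>
  define k where "k = nat \<lceil>(1 / \<epsilon>) powr ?e d\<rceil>"
  have k: "(1 / \<epsilon>) powr ?e d \<le> real k" "real k \<le> (1 / \<epsilon>) powr ?e d + 1"
    unfolding k_def by (simp_all add: of_nat_ceiling)
  have one: "1 \<le> (1 / \<epsilon>) powr ?e d"
    using \<epsilon> by (intro ge_one_powr_ge_zero) auto
  then have "0 < k"
    using k(1) by (cases k) auto
  interpret lt: level_test "subcube n d" "subcubes d" "\<lambda>l. 2 ^ (l * d)" "\<lambda>l. 2 ^ l * \<epsilon> / (4 * real L)" "grid n d" L k m
    by (rule level_test_subcubes[OF \<epsilon> n L(1) L(3) \<open>0 < k\<close> equivalence_level_bound[OF \<epsilon> L(3) _ k(1)] m(1)])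
  interpret gp: guarded_params n d \<epsilon> L k m p \<Delta> t N0
    by unfold_locales (use n d p \<Delta> \<epsilon> t L checks in auto)
  have s: "real (2 * N0 + k + 4 * m) \<le> M"
    using checks(3) m(2) G(1,2) k(2) one unfolding M_def sample_bound_eq by simp
  \<comment> \<open>Only the checks query: two boxes per check and two searches per coordinate,
    hence 2 * 160 * 2 * 3 = 1920.\<close>
  have "real (2 * N0 * (d * (2 * t))) = 2 * real N0 * (real d * (2 * real t))"
    by simp
  also have "\<dots> \<le> 2 * (160 / \<epsilon>) * (real d * (2 * (3 * ln (real n))))"
    using checks(3) t(2) \<epsilon> by (intro mult_mono) auto
  finally have q: "real (2 * N0 * (d * (2 * t))) \<le> 1920 * (1 / \<epsilon> * (real d * ln (real n)))"
    by (simp add: algebra_simps)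
  show ?thesis
    using gp.equivalence_algo_tester gp.equivalence_cost s q by blast
qed

theorem theorem3p17:
  shows "(\<exists>(m :: nat \<Rightarrow> real \<Rightarrow> real) (K :: real).
            exp_soft_O (\<lambda>d. max 2 (real d / 2)) m \<and>
            (\<forall>(n::nat) (d::nat) (p::real) (\<Delta>::real) (\<epsilon>::real) (\<nu> :: (nat \<Rightarrow> nat) pmf).
               n \<ge> 1 \<and> d \<ge> 1 \<and> p \<ge> 1 \<and> 0 < 8 * \<Delta> \<and> 8 * \<Delta> \<le> \<epsilon> \<and> set_pmf \<nu> \<subseteq> grid n d \<longrightarrow>
               (\<exists>T s q.
                  identity_tester (grid n d) (ndist p n d)
                    (box_clusterings n d) (box_clusterings n d) \<Delta> \<epsilon> \<nu> T \<and>
                  uses_at_most (grid n d) T s q \<and>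
                  real s \<le> m d \<epsilon> \<and>
                  real q \<le> K * (m d \<epsilon> * (real d * ln (real n))))))
       \<and> (\<exists>(m :: nat \<Rightarrow> real \<Rightarrow> real) (K :: real).
            exp_soft_O (\<lambda>d. max 2 (2 * real d / 3)) m \<and>
            (\<forall>(n::nat) (d::nat) (p::real) (\<Delta>::real) (\<epsilon>::real).
               n \<ge> 1 \<and> d \<ge> 1 \<and> p \<ge> 1 \<and> 0 < 8 * \<Delta> \<and> 8 * \<Delta> \<le> \<epsilon> \<longrightarrow>
               (\<exists>T s q.
                  equivalence_tester (grid n d) (ndist p n d)
                    (box_clusterings n d) (box_clusterings n d) \<Delta> \<epsilon> T \<and>
                  uses_at_most (grid n d) T s q \<and>
                  real s \<le> m d \<epsilon> \<and>
                  real q \<le> K * (1 / \<epsilon> * (real d * ln (real n))))))"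
  by (rule conjI; rule exI, rule exI, rule conjI, rule exp_soft_O_sample_bound, intro allI impI, elim conjE)
    (rule identity_tester_exists equivalence_tester_exists; assumption)+

end
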